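(* Let $G$ be a finite group whose order is divisible by $p$, let $b$ be a block idempotent of $\mathcal{O}G$ with defect group $D$, let $i\in(\mathcal{O}Gb)^D$ be a source idempotent of $b$, and let $A=i\mathcal{O}Gi$ be the corresponding source algebra of $b$. Let $\bar b\in Z(kG)$ be the image of $b$ under the canonical surjection $\mathcal{O}G\to kG$ (a block idempotent of $kG$ with the same defect group $D$), and let $\bar A=i\mathcal{O}Gi/J(\mathcal{O})\,i\mathcal{O}Gi$, which is a source algebra of $\bar b$. If $\bar A$ is a uniform source $D$-algebra of $\bar b$, then $A$ is a uniform source $D$-algebra of $b$.
   Context: Let $p$ be a prime and let $\mathcal{O}$ be a complete (local) principal ideal domain whose residue field $k=\mathcal{O}/J(\mathcal{O})$ is algebraically closed of characteristic $p$; thus either $\mathcal{O}=k$ (with $J(\mathcal{O})=0$) or $\mathcal{O}$ is a complete discrete valuation ring. Let $R\in\{\mathcal{O},k\}$. A block idempotent of $RG$ is a primitive idempotent of $Z(RG)$. For a $p$-subgroup $D$ of $G$, $(RG)^D$ denotes the subalgebra of elements of $RG$ fixed under conjugation by $D$, and the Brauer map $\mathrm{Br}_D:(RG)^D\to kC_G(D)$ is the algebra homomorphism sending $\sum_g\lambda_g g$ to $\sum_{g\in C_G(D)}\bar\lambda_g g$, where $\bar\lambda_g$ is the image of $\lambda_g$ in $k$. If $b$ is a block idempotent of $RG$ with defect group $D$, a source idempotent of $b$ is a primitive idempotent $i$ of $(RGb)^D$ with $\mathrm{Br}_D(i)\neq 0$; the algebra $iRGi$ (with identity element $i$, and viewed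 as an interior $D$-algebra via $u\mapsto ui$, $u\in D$) is then called a source algebra (source $D$-algebra) of $b$. The group $D\times D$ acts on $iRGi$ by $(u,v)\cdot a=uav^{-1}$. A source algebra $iRGi$ is called a uniform source $D$-algebra of $b$ if it has an $R$-basis that is stable under this action of $D\times D$ and is unital, i.e. consists of invertible elements of the algebra $iRGi$. *)

theory Defs
  imports
    "HOL-Algebra.Algebra"
    "Jordan_Normal_Form.Missing_VectorSpace"
    "HOL-Computational_Algebra.Primes"
begin

hide_const (open) Multiset.mult Wellorder_Constructions.zero

section \<open>The coefficient ring\<close>

text \<open>The Jacobson radical of a commutative ring.\<close>

definition jacobson_radical :: "('a, 'r) ring_scheme \<Rightarrow> 'a set" where
  "jacobson_radical R = \<Inter> {M. maximalideal M R}"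

definition residue_field :: "('a, 'r) ring_scheme \<Rightarrow> 'a set ring" where
  "residue_field R = R Quot (jacobson_radical R)"

definition residue_map :: "('a, 'r) ring_scheme \<Rightarrow> 'a \<Rightarrow> 'a set" where
  "residue_map R a = jacobson_radical R +>\<^bsub>R\<^esub> a"

text \<open>The \<open>n\<close>-th power \<open>J(R)\<^sup>n\<close> in the semiring of ideals of \<open>R\<close>; in particular
  \<open>J(R)\<^sup>0 = R\<close>.\<close>

definition radical_power :: "('a, 'r) ring_scheme \<Rightarrow> nat \<Rightarrow> 'a set" where
  "radical_power R n = jacobson_radical R [^]\<^bsub>ideals_set R\<^esub> n"

text \<open>Completeness is bijectivity of the canonical map from \<open>R\<close> to the inverse limit of the
  quotients \<open>R / J(R)\<^sup>n\<close>.  Fields are included, with \<open>J(R) = 0\<close>.\<close>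

locale complete_local_pid = principal_domain R for R (structure) +
  assumes local: "\<exists>!M. maximalideal M R"
    and separated: "(\<Inter>n. radical_power R n) = {\<zero>}"
    and complete: "\<lbrakk>\<And>n. s n \<in> carrier R; \<And>n. s (Suc n) \<ominus> s n \<in> radical_power R n\<rbrakk>
      \<Longrightarrow> \<exists>l\<in>carrier R. \<forall>n. l \<ominus> s n \<in> radical_power R n"

definition has_characteristic :: "('a, 'r) ring_scheme \<Rightarrow> nat \<Rightarrow> bool" where
  "has_characteristic R p \<longleftrightarrow> (\<forall>n::nat. [n] \<cdot>\<^bsub>R\<^esub> \<one>\<^bsub>R\<^esub> = \<zero>\<^bsub>R\<^esub> \<longleftrightarrow> p dvd n)"


section \<open>Group algebras\<close>

text \<open>For a finite group \<open>G\<close>, the element \<open>\<Sum>\<^sub>g \<lambda>\<^sub>g g\<close> of \<open>RG\<close> is the extensional function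
  \<open>g \<mapsto> \<lambda>\<^sub>g\<close> on \<open>G\<close>.\<close>

definition group_algebra ::
  "('a, 'r) ring_scheme \<Rightarrow> ('g, 'm) monoid_scheme \<Rightarrow> ('a, 'g \<Rightarrow> 'a) module" where
  "group_algebra R G =
    \<lparr> carrier = carrier G \<rightarrow>\<^sub>E carrier R,
      mult = (\<lambda>a b. \<lambda>g\<in>carrier G.
        \<Oplus>\<^bsub>R\<^esub>h\<in>carrier G. a h \<otimes>\<^bsub>R\<^esub> b (inv\<^bsub>G\<^esub> h \<otimes>\<^bsub>G\<^esub> g)),
      one = (\<lambda>g\<in>carrier G. if g = \<one>\<^bsub>G\<^esub> then \<one>\<^bsub>R\<^esub> else \<zero>\<^bsub>R\<^esub>),
      zero = (\<lambda>g\<in>carrier G. \<zero>\<^bsub>R\<^esub>),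
      add = (\<lambda>a b. \<lambda>g\<in>carrier G. a g \<oplus>\<^bsub>R\<^esub> b g),
      smult = (\<lambda>r a. \<lambda>g\<in>carrier G. r \<otimes>\<^bsub>R\<^esub> a g) \<rparr>"

definition group_element ::
  "('a, 'r) ring_scheme \<Rightarrow> ('g, 'm) monoid_scheme \<Rightarrow> 'g \<Rightarrow> 'g \<Rightarrow> 'a" where
  "group_element R G x = (\<lambda>g\<in>carrier G. if g = x then \<one>\<^bsub>R\<^esub> else \<zero>\<^bsub>R\<^esub>)"

definition reduce_coeffs ::
  "('a, 'r) ring_scheme \<Rightarrow> ('g, 'm) monoid_scheme \<Rightarrow> ('g \<Rightarrow> 'a) \<Rightarrow> 'g \<Rightarrow> 'a set" where
  "reduce_coeffs R G a = (\<lambda>g\<in>carrier G. residue_map R (a g))"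

definition ring_center :: "('b, 'c) ring_scheme \<Rightarrow> 'b set" where
  "ring_center A = {z \<in> carrier A. \<forall>x\<in>carrier A. z \<otimes>\<^bsub>A\<^esub> x = x \<otimes>\<^bsub>A\<^esub> z}"

definition conj_fixed_points ::
  "('a, 'r) ring_scheme \<Rightarrow> ('g, 'm) monoid_scheme \<Rightarrow> 'g set \<Rightarrow> ('g \<Rightarrow> 'a) set \<Rightarrow> ('g \<Rightarrow> 'a) set"
where
  "conj_fixed_points R G D S =
    {a \<in> S. \<forall>u\<in>D. group_element R G u \<otimes>\<^bsub>group_algebra R G\<^esub> a
        \<otimes>\<^bsub>group_algebra R G\<^esub> group_element R G (inv\<^bsub>G\<^esub> u) = a}"

text \<open>Primitive idempotents of a subalgebra \<open>S\<close> of \<open>A\<close>; the identity element of \<open>S\<close> need not be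
  that of \<open>A\<close>.\<close>

definition primitive_idempotent :: "('b, 'c) ring_scheme \<Rightarrow> 'b set \<Rightarrow> 'b \<Rightarrow> bool" where
  "primitive_idempotent A S e \<longleftrightarrow>
    e \<in> S \<and> e \<otimes>\<^bsub>A\<^esub> e = e \<and> e \<noteq> \<zero>\<^bsub>A\<^esub> \<and>
    \<not> (\<exists>x\<in>S. \<exists>y\<in>S. x \<noteq> \<zero>\<^bsub>A\<^esub> \<and> y \<noteq> \<zero>\<^bsub>A\<^esub> \<and> x \<otimes>\<^bsub>A\<^esub> x = x \<and> y \<otimes>\<^bsub>A\<^esub> y = y \<and>
        x \<otimes>\<^bsub>A\<^esub> y = \<zero>\<^bsub>A\<^esub> \<and> y \<otimes>\<^bsub>A\<^esub> x = \<zero>\<^bsub>A\<^esub> \<and> e = x \<oplus>\<^bsub>A\<^esub> y)"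


section \<open>Blocks, defect groups and source idempotents\<close>

definition block_idempotent ::
  "('a, 'r) ring_scheme \<Rightarrow> ('g, 'm) monoid_scheme \<Rightarrow> ('g \<Rightarrow> 'a) \<Rightarrow> bool" where
  "block_idempotent R G b \<longleftrightarrow>
    primitive_idempotent (group_algebra R G) (ring_center (group_algebra R G)) b"

definition block_algebra ::
  "('a, 'r) ring_scheme \<Rightarrow> ('g, 'm) monoid_scheme \<Rightarrow> ('g \<Rightarrow> 'a) \<Rightarrow> ('g \<Rightarrow> 'a) set" where
  "block_algebra R G b = {a \<otimes>\<^bsub>group_algebra R G\<^esub> b | a. a \<in> carrier (group_algebra R G)}"

definition subgroup_centralizer :: "('g, 'm) monoid_scheme \<Rightarrow> 'g set \<Rightarrow> 'g set" where
  "subgroup_centralizer G D = {g \<in> carrier G. \<forall>u\<in>D. g \<otimes>\<^bsub>G\<^esub> u = u \<otimes>\<^bsub>G\<^esub> g}"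

abbreviation brauer_target ::
  "('a, 'r) ring_scheme \<Rightarrow> ('g, 'm) monoid_scheme \<Rightarrow> 'g set \<Rightarrow> ('a set, 'g \<Rightarrow> 'a set) module" where
  "brauer_target R G D \<equiv>
    group_algebra (residue_field R) (G\<lparr>carrier := subgroup_centralizer G D\<rparr>)"

text \<open>If \<open>R = k\<close> is itself a field then \<open>J(k) = 0\<close>, and the coefficients of the Brauer map lie in
  \<open>k / 0\<close>, which is \<open>k\<close> up to the canonical isomorphism.\<close>

definition brauer_map ::
  "('a, 'r) ring_scheme \<Rightarrow> ('g, 'm) monoid_scheme \<Rightarrow> 'g set \<Rightarrow> ('g \<Rightarrow> 'a) \<Rightarrow> 'g \<Rightarrow> 'a set" where
  "brauer_map R G D a = (\<lambda>g\<in>subgroup_centralizer G D. residue_map R (a g))"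

definition p_subgroup :: "nat \<Rightarrow> ('g, 'm) monoid_scheme \<Rightarrow> 'g set \<Rightarrow> bool" where
  "p_subgroup p G P \<longleftrightarrow> subgroup P G \<and> (\<exists>n. card P = p ^ n)"

text \<open>A defect group of \<open>b\<close> is a maximal \<open>p\<close>-subgroup \<open>P\<close> of \<open>G\<close> with \<open>Br\<^sub>P(b) \<noteq> 0\<close>.\<close>

definition defect_group ::
  "nat \<Rightarrow> ('a, 'r) ring_scheme \<Rightarrow> ('g, 'm) monoid_scheme \<Rightarrow> ('g \<Rightarrow> 'a) \<Rightarrow> 'g set \<Rightarrow> bool" where
  "defect_group p R G b D \<longleftrightarrow>
    p_subgroup p G D \<and> brauer_map R G D b \<noteq> \<zero>\<^bsub>brauer_target R G D\<^esub> \<and>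
    (\<forall>P. p_subgroup p G P \<and> D \<subseteq> P \<and> brauer_map R G P b \<noteq> \<zero>\<^bsub>brauer_target R G P\<^esub> \<longrightarrow> P = D)"

definition source_idempotent ::
  "('a, 'r) ring_scheme \<Rightarrow> ('g, 'm) monoid_scheme \<Rightarrow> 'g set \<Rightarrow> ('g \<Rightarrow> 'a) \<Rightarrow> ('g \<Rightarrow> 'a) \<Rightarrow> bool" where
  "source_idempotent R G D b i \<longleftrightarrow>
    primitive_idempotent (group_algebra R G) (conj_fixed_points R G D (block_algebra R G b)) i \<and>
    brauer_map R G D i \<noteq> \<zero>\<^bsub>brauer_target R G D\<^esub>"


section \<open>Interior algebras and source algebras\<close>

text \<open>An interior \<open>D\<close>-algebra over \<open>R\<close> is an \<open>R\<close>-algebra with a structure map from \<open>D\<close> into its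
  group of units.  The structure map is only relevant on \<open>D\<close>.\<close>

record ('a, 'b, 'g) interior_algebra = "('a, 'b) module" +
  structure_map :: "'g \<Rightarrow> 'b"

definition source_algebra ::
  "('a, 'r) ring_scheme \<Rightarrow> ('g, 'm) monoid_scheme \<Rightarrow> ('g \<Rightarrow> 'a) \<Rightarrow> ('a, 'g \<Rightarrow> 'a, 'g) interior_algebra"
where
  "source_algebra R G i = (let RG = group_algebra R G in
    \<lparr> carrier = {i \<otimes>\<^bsub>RG\<^esub> a \<otimes>\<^bsub>RG\<^esub> i | a. a \<in> carrier RG},
      mult = mult RG, one = i, zero = zero RG, add = add RG, smult = smult RG,
      structure_map = (\<lambda>u. group_element R G u \<otimes>\<^bsub>RG\<^esub> i) \<rparr>)"

text \<open>The interior algebra \<open>A / J(R)A\<close> over the residue field, where \<open>J(R)A\<close> is the additive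
  subgroup generated by the products \<open>r a\<close> with \<open>r \<in> J(R)\<close> and \<open>a \<in> A\<close>.\<close>

definition radical_submodule ::
  "('a, 'r) ring_scheme \<Rightarrow> ('a, 'b, 'c) module_scheme \<Rightarrow> 'b set" where
  "radical_submodule R A =
    generate (add_monoid A) {r \<odot>\<^bsub>A\<^esub> a | r a. r \<in> jacobson_radical R \<and> a \<in> carrier A}"

definition reduced_algebra ::
  "('a, 'r) ring_scheme \<Rightarrow> ('a, 'b, 'g) interior_algebra \<Rightarrow> ('a set, 'b set, 'g) interior_algebra"
where
  "reduced_algebra R A = (let I = radical_submodule R A; Q = A Quot I in
    \<lparr> carrier = carrier Q, mult = mult Q, one = one Q, zero = zero Q, add = add Q,
      smult = (\<lambda>c x. \<Union>r\<in>c. \<Union>a\<in>x. I +>\<^bsub>A\<^esub> (r \<odot>\<^bsub>A\<^esub> a)),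
      structure_map = (\<lambda>u. I +>\<^bsub>A\<^esub> structure_map A u) \<rparr>)"

definition interior_algebra_iso ::
  "('a, 'r) ring_scheme \<Rightarrow> 'g set \<Rightarrow> ('a, 'b, 'g) interior_algebra \<Rightarrow> ('a, 'c, 'g) interior_algebra
    \<Rightarrow> ('b \<Rightarrow> 'c) set" where
  "interior_algebra_iso R D A B =
    {f \<in> ring_iso A B.
      (\<forall>r\<in>carrier R. \<forall>a\<in>carrier A. f (r \<odot>\<^bsub>A\<^esub> a) = r \<odot>\<^bsub>B\<^esub> f a) \<and>
      (\<forall>u\<in>D. f (structure_map A u) = structure_map B u)}"

text \<open>Source algebras are understood up to isomorphism of interior \<open>D\<close>-algebras, so that
  \<open>iOGi / J(O) iOGi\<close> can be a source algebra of a block of \<open>kG\<close>.\<close>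

definition is_source_algebra ::
  "('a, 'r) ring_scheme \<Rightarrow> ('g, 'm) monoid_scheme \<Rightarrow> 'g set \<Rightarrow> ('g \<Rightarrow> 'a)
    \<Rightarrow> ('a, 'b, 'g) interior_algebra \<Rightarrow> bool" where
  "is_source_algebra R G D b A \<longleftrightarrow>
    (\<exists>i. source_idempotent R G D b i \<and>
         interior_algebra_iso R D A (source_algebra R G i) \<noteq> {})"

definition is_module_basis ::
  "('a, 'r) ring_scheme \<Rightarrow> ('a, 'b, 'c) module_scheme \<Rightarrow> 'b set \<Rightarrow> bool" where
  "is_module_basis R M B \<longleftrightarrow>
    B \<subseteq> carrier M \<and> \<not> module.lin_dep R M B \<and> module.span R M B = carrier M"

definition has_unital_stable_basis ::
  "('a, 'r) ring_scheme \<Rightarrow> ('g, 'm) monoid_scheme \<Rightarrow> 'g set \<Rightarrow> ('a, 'b, 'g) interior_algebra \<Rightarrow> bool"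
where
  "has_unital_stable_basis R G D A \<longleftrightarrow>
    (\<exists>B. is_module_basis R A B \<and> B \<subseteq> Units A \<and>
      (\<forall>u\<in>D. \<forall>v\<in>D. \<forall>x\<in>B.
        structure_map A u \<otimes>\<^bsub>A\<^esub> x \<otimes>\<^bsub>A\<^esub> structure_map A (inv\<^bsub>G\<^esub> v) \<in> B))"

definition uniform_source_algebra ::
  "('a, 'r) ring_scheme \<Rightarrow> ('g, 'm) monoid_scheme \<Rightarrow> 'g set \<Rightarrow> ('g \<Rightarrow> 'a)
    \<Rightarrow> ('a, 'b, 'g) interior_algebra \<Rightarrow> bool" where
  "uniform_source_algebra R G D b A \<longleftrightarrow>
    is_source_algebra R G D b A \<and> has_unital_stable_basis R G D A"

end

theory Submission
  imports Defs
begin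

text \<open>
  Choose a set-theoretic section of \<open>O \<rightarrow> k\<close> and apply it to each coefficient of an element of
  \<open>kG\<close>.  The resulting section of \<open>OG \<rightarrow> kG\<close> is not additive, but it commutes with left and right
  multiplication by group elements, so that it preserves every invariance property: it maps \<open>Z(kG)\<close>
  into \<open>Z(OG)\<close> and \<open>(kG)\<^sup>D\<close> into \<open>(OG)\<^sup>D\<close>.  Hence idempotents lift along
  \<open>Z(OG) \<rightarrow> Z(kG)\<close> and \<open>(OGb)\<^sup>D \<rightarrow> (kGb)\<^sup>D\<close>, by the Newton iteration \<open>x \<mapsto> 3x\<^sup>2 - 2x\<^sup>3\<close>, and
  primitive idempotents remain primitive modulo \<open>J(O)\<close>.  Multiplying the section by \<open>i\<close> on both
  sides gives a \<open>D \<times> D\<close>-equivariant section of \<open>iOGi \<rightarrow> iOGi / J(O)iOGi\<close>.  The image of a unital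
  stable basis under it is stable; it is a basis by Nakayama's lemma, and it consists of units
  because an element that is invertible modulo \<open>J(O)\<close> is invertible.
\<close>

section \<open>Group algebras of finite groups\<close>

text \<open>The obstacle is stability. Preimages of the members of a stable basis may be chosen one
  by one, and every such choice gives a basis of units; but the chosen set is stable only if the
  preimage of x is fixed by each element of \<open>D\<close> x \<open>D\<close> that fixes x. A
  section that commutes with the whole action avoids any discussion of orbits and stabilisers. It
  exists because translations by group elements merely permute coefficients, while the
  representative of a residue is chosen without regard to the group element that carries it.
  Additivity is never asked of it, since it is applied to single elements only and every later
  correction is a limit. All limits are taken coefficientwise in \<open>R\<close>: the Newton
  sequence, a geometric series for inverses, and the coefficients of expansions in the lifted basis.
  A generator \<open>\<pi>\<close> of the radical serves fields and discrete valuation rings at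
  once; it is zero for a field, so a power of it is cancelled only when nonzero. The quotient of the
  source algebra consists of cosets, the corner of \<open>kG\<close> of functions;
  \<open>quot_iso\<close> passes between the two.\<close>

lemma (in abelian_monoid) finsum_swap:
  assumes "finite A" "finite B"
    and "\<And>x y. \<lbrakk>x \<in> A; y \<in> B\<rbrakk> \<Longrightarrow> f x y \<in> carrier G"
  shows "(\<Oplus>x\<in>A. \<Oplus>y\<in>B. f x y) = (\<Oplus>y\<in>B. \<Oplus>x\<in>A. f x y)"
  using assms(1,3)
proof (induction A)
  case empty
  then show ?case by simp
next
  case (insert a A)
  have "(\<Oplus>y\<in>B. \<Oplus>x\<in>insert a A. f x y) = (\<Oplus>y\<in>B. f a y \<oplus> (\<Oplus>x\<in>A. f x y))"
    by (rule finsum_cong') (use insert in \<open>auto intro!: finsum_closed\<close>)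
  also have "\<dots> = (\<Oplus>y\<in>B. f a y) \<oplus> (\<Oplus>y\<in>B. \<Oplus>x\<in>A. f x y)"
    by (rule finsum_addf) (use insert in \<open>auto intro!: finsum_closed\<close>)
  also have "\<dots> = (\<Oplus>x\<in>insert a A. \<Oplus>y\<in>B. f x y)"
    using insert by (simp add: Pi_def)
  finally show ?case by simp
qed

locale finite_group_algebra = cring R + G: group G
  for R :: "('a, 'r) ring_scheme" (structure) and G :: "('g, 'm) monoid_scheme" +
  assumes finite_G: "finite (carrier G)"
begin

abbreviation "RG \<equiv> group_algebra R G"
abbreviation "\<delta> \<equiv> group_element R G"

lemma coeff_closed: "\<lbrakk>a \<in> carrier RG; g \<in> carrier G\<rbrakk> \<Longrightarrow> a g \<in> carrier R"
  by (auto simp: group_algebra_def)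

lemma ga_eqI:
  assumes "a \<in> carrier RG" "b \<in> carrier RG" "\<And>g. g \<in> carrier G \<Longrightarrow> a g = b g"
  shows "a = b"
  using assms by (auto simp: group_algebra_def intro: PiE_ext)

lemma ga_memI: "(\<And>g. g \<in> carrier G \<Longrightarrow> f g \<in> carrier R) \<Longrightarrow> (\<lambda>g\<in>carrier G. f g) \<in> carrier RG"
  by (auto simp: group_algebra_def)

lemma coeff_mult:
  "g \<in> carrier G \<Longrightarrow> (a \<otimes>\<^bsub>RG\<^esub> b) g = (\<Oplus>h\<in>carrier G. a h \<otimes> b (inv\<^bsub>G\<^esub> h \<otimes>\<^bsub>G\<^esub> g))"
  by (simp add: group_algebra_def)

lemma coeff_add: "g \<in> carrier G \<Longrightarrow> (a \<oplus>\<^bsub>RG\<^esub> b) g = a g \<oplus> b g"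
  by (simp add: group_algebra_def)

lemma coeff_zero: "g \<in> carrier G \<Longrightarrow> \<zero>\<^bsub>RG\<^esub> g = \<zero>"
  by (simp add: group_algebra_def)

lemma coeff_smult: "g \<in> carrier G \<Longrightarrow> (r \<odot>\<^bsub>RG\<^esub> a) g = r \<otimes> a g"
  by (simp add: group_algebra_def)

lemma coeff_delta: "g \<in> carrier G \<Longrightarrow> \<delta> u g = (if g = u then \<one> else \<zero>)"
  by (simp add: group_element_def)

lemma delta_closed: "\<delta> u \<in> carrier RG"
  unfolding group_element_def by (rule ga_memI) simp

lemma ga_add_closed: "\<lbrakk>a \<in> carrier RG; b \<in> carrier RG\<rbrakk> \<Longrightarrow> a \<oplus>\<^bsub>RG\<^esub> b \<in> carrier RG"
  by (auto simp: group_algebra_def)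

lemma ga_smult_closed: "\<lbrakk>r \<in> carrier R; b \<in> carrier RG\<rbrakk> \<Longrightarrow> r \<odot>\<^bsub>RG\<^esub> b \<in> carrier RG"
  by (auto simp: group_algebra_def)

lemma ga_zero_closed: "\<zero>\<^bsub>RG\<^esub> \<in> carrier RG"
  by (auto simp: group_algebra_def)

lemma ga_one_closed: "\<one>\<^bsub>RG\<^esub> \<in> carrier RG"
  by (auto simp: group_algebra_def)

lemma ga_mult_closed: "\<lbrakk>a \<in> carrier RG; b \<in> carrier RG\<rbrakk> \<Longrightarrow> a \<otimes>\<^bsub>RG\<^esub> b \<in> carrier RG"
  by (auto simp: group_algebra_def intro!: finsum_closed)

lemma ga_abelian_group: "abelian_group RG"
proof (rule abelian_groupI)
  fix a assume a: "a \<in> carrier RG"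
  show "\<exists>b\<in>carrier RG. b \<oplus>\<^bsub>RG\<^esub> a = \<zero>\<^bsub>RG\<^esub>"
  proof (rule bexI)
    show *: "(\<lambda>g\<in>carrier G. \<ominus> a g) \<in> carrier RG"
      by (rule ga_memI) (use a in \<open>auto intro: coeff_closed\<close>)
    show "(\<lambda>g\<in>carrier G. \<ominus> a g) \<oplus>\<^bsub>RG\<^esub> a = \<zero>\<^bsub>RG\<^esub>"
      by (rule ga_eqI) (use a * in \<open>auto simp: coeff_add coeff_zero coeff_closed l_neg
          intro: ga_add_closed ga_zero_closed\<close>)
  qed
next
  fix x y z assume xyz: "x \<in> carrier RG" "y \<in> carrier RG" "z \<in> carrier RG"
  show "x \<oplus>\<^bsub>RG\<^esub> y \<oplus>\<^bsub>RG\<^esub> z = x \<oplus>\<^bsub>RG\<^esub> (y \<oplus>\<^bsub>RG\<^esub> z)"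
    by (rule ga_eqI) (use xyz in \<open>simp_all add: ga_add_closed coeff_add coeff_closed a_assoc\<close>)
next
  fix x y assume xy: "x \<in> carrier RG" "y \<in> carrier RG"
  show "x \<oplus>\<^bsub>RG\<^esub> y = y \<oplus>\<^bsub>RG\<^esub> x"
    by (rule ga_eqI) (use xy in \<open>simp_all add: ga_add_closed coeff_add coeff_closed a_comm\<close>)
next
  fix x assume x: "x \<in> carrier RG"
  show "\<zero>\<^bsub>RG\<^esub> \<oplus>\<^bsub>RG\<^esub> x = x"
    by (rule ga_eqI)
      (use x in \<open>simp_all add: ga_add_closed ga_zero_closed coeff_add coeff_zero coeff_closed\<close>)
qed (simp_all add: ga_add_closed ga_zero_closed)

lemma reindex_l:
  assumes "\<And>g. g \<in> carrier G \<Longrightarrow> f g \<in> carrier R" "u \<in> carrier G"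
  shows "(\<Oplus>h\<in>carrier G. f h) = (\<Oplus>h\<in>carrier G. f (u \<otimes>\<^bsub>G\<^esub> h))"
proof -
  have im: "(\<lambda>h. u \<otimes>\<^bsub>G\<^esub> h) ` carrier G = carrier G"
    using G.surj_const_mult[OF assms(2)] .
  show ?thesis
    using add.finprod_reindex[of f "\<lambda>h. u \<otimes>\<^bsub>G\<^esub> h" "carrier G"]
      G.inj_on_cmult[OF assms(2)] assms(1) by (simp add: im Pi_def)
qed

lemma reindex_inv:
  assumes "\<And>g. g \<in> carrier G \<Longrightarrow> f g \<in> carrier R"
  shows "(\<Oplus>h\<in>carrier G. f h) = (\<Oplus>h\<in>carrier G. f (inv\<^bsub>G\<^esub> h))"
proof -
  have im: "(\<lambda>h. inv\<^bsub>G\<^esub> h) ` carrier G = carrier G"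
    by (metis G.inv_closed G.inv_inv image_eqI image_subsetI subsetI subset_antisym)
  show ?thesis
    using add.finprod_reindex[of f "\<lambda>h. inv\<^bsub>G\<^esub> h" "carrier G"]
      G.inv_inj assms(1) by (simp add: im Pi_def)
qed

lemma ga_mult_assoc:
  assumes "a \<in> carrier RG" "b \<in> carrier RG" "c \<in> carrier RG"
  shows "a \<otimes>\<^bsub>RG\<^esub> b \<otimes>\<^bsub>RG\<^esub> c = a \<otimes>\<^bsub>RG\<^esub> (b \<otimes>\<^bsub>RG\<^esub> c)"
proof (rule ga_eqI)
  fix g assume g: "g \<in> carrier G"
  note cl = assms[THEN coeff_closed] 
  have "(a \<otimes>\<^bsub>RG\<^esub> b \<otimes>\<^bsub>RG\<^esub> c) g =
      (\<Oplus>h\<in>carrier G. (\<Oplus>l\<in>carrier G. a l \<otimes> b (inv\<^bsub>G\<^esub> l \<otimes>\<^bsub>G\<^esub> h)) \<otimes> c (inv\<^bsub>G\<^esub> h \<otimes>\<^bsub>G\<^esub> g))"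
    using g cl by (auto simp: coeff_mult intro!: finsum_cong' finsum_closed)
  also have "\<dots> = (\<Oplus>h\<in>carrier G. \<Oplus>l\<in>carrier G.
      a l \<otimes> (b (inv\<^bsub>G\<^esub> l \<otimes>\<^bsub>G\<^esub> h) \<otimes> c (inv\<^bsub>G\<^esub> h \<otimes>\<^bsub>G\<^esub> g)))"
    using g cl by (intro finsum_cong' refl)
      (auto simp: finsum_ldistr[OF finite_G] m_assoc intro!: finsum_cong' finsum_closed)
  also have "\<dots> = (\<Oplus>l\<in>carrier G. \<Oplus>h\<in>carrier G.
      a l \<otimes> (b (inv\<^bsub>G\<^esub> l \<otimes>\<^bsub>G\<^esub> h) \<otimes> c (inv\<^bsub>G\<^esub> h \<otimes>\<^bsub>G\<^esub> g)))"
    by (rule finsum_swap) (use g cl finite_G in auto)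
  also have "\<dots> = (\<Oplus>l\<in>carrier G. a l \<otimes> (b \<otimes>\<^bsub>RG\<^esub> c) (inv\<^bsub>G\<^esub> l \<otimes>\<^bsub>G\<^esub> g))"
  proof (rule finsum_cong' [OF refl])
    fix l assume l: "l \<in> carrier G"
    have "(\<Oplus>h\<in>carrier G. a l \<otimes> (b (inv\<^bsub>G\<^esub> l \<otimes>\<^bsub>G\<^esub> h) \<otimes> c (inv\<^bsub>G\<^esub> h \<otimes>\<^bsub>G\<^esub> g))) =
      (\<Oplus>h\<in>carrier G. a l \<otimes> (b (inv\<^bsub>G\<^esub> l \<otimes>\<^bsub>G\<^esub> (l \<otimes>\<^bsub>G\<^esub> h)) \<otimes> c (inv\<^bsub>G\<^esub> (l \<otimes>\<^bsub>G\<^esub> h) \<otimes>\<^bsub>G\<^esub> g)))"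
      by (rule reindex_l) (use g l cl in auto)
    also have "\<dots> = (\<Oplus>h\<in>carrier G. a l \<otimes> (b h \<otimes> c (inv\<^bsub>G\<^esub> h \<otimes>\<^bsub>G\<^esub> (inv\<^bsub>G\<^esub> l \<otimes>\<^bsub>G\<^esub> g))))"
      using g l cl by (intro finsum_cong' refl)
        (auto simp: G.m_assoc[symmetric] G.inv_mult_group)
    also have "\<dots> = a l \<otimes> (b \<otimes>\<^bsub>RG\<^esub> c) (inv\<^bsub>G\<^esub> l \<otimes>\<^bsub>G\<^esub> g)"
      using g l cl by (simp add: coeff_mult finsum_rdistr[OF finite_G] Pi_def)
    finally show "(\<Oplus>h\<in>carrier G. a l \<otimes> (b (inv\<^bsub>G\<^esub> l \<otimes>\<^bsub>G\<^esub> h) \<otimes> c (inv\<^bsub>G\<^esub> h \<otimes>\<^bsub>G\<^esub> g))) = \<dots>" .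
  qed (use g cl assms in \<open>simp add: coeff_closed ga_mult_closed\<close>)
  also have "\<dots> = (a \<otimes>\<^bsub>RG\<^esub> (b \<otimes>\<^bsub>RG\<^esub> c)) g"
    by (simp only: coeff_mult[OF g])
  finally show "(a \<otimes>\<^bsub>RG\<^esub> b \<otimes>\<^bsub>RG\<^esub> c) g = (a \<otimes>\<^bsub>RG\<^esub> (b \<otimes>\<^bsub>RG\<^esub> c)) g" .
qed (use assms in \<open>auto intro: ga_mult_closed\<close>)

lemma delta_mult:
  assumes "u \<in> carrier G" "a \<in> carrier RG" "g \<in> carrier G"
  shows "(\<delta> u \<otimes>\<^bsub>RG\<^esub> a) g = a (inv\<^bsub>G\<^esub> u \<otimes>\<^bsub>G\<^esub> g)"
proof -
  have "(\<delta> u \<otimes>\<^bsub>RG\<^esub> a) g = (\<Oplus>h\<in>carrier G. if h = u then a (inv\<^bsub>G\<^esub> h \<otimes>\<^bsub>G\<^esub> g) else \<zero>)"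
    using assms by (auto simp: coeff_mult coeff_delta coeff_closed intro!: finsum_cong')
  also have "\<dots> = a (inv\<^bsub>G\<^esub> u \<otimes>\<^bsub>G\<^esub> g)"
    by (rule add.finprod_singleton_swap) (use assms finite_G in \<open>auto simp: coeff_closed\<close>)
  finally show ?thesis .
qed

lemma mult_delta:
  assumes "u \<in> carrier G" "a \<in> carrier RG" "g \<in> carrier G"
  shows "(a \<otimes>\<^bsub>RG\<^esub> \<delta> u) g = a (g \<otimes>\<^bsub>G\<^esub> inv\<^bsub>G\<^esub> u)"
proof -
  have *: "inv\<^bsub>G\<^esub> h \<otimes>\<^bsub>G\<^esub> g = u \<longleftrightarrow> h = g \<otimes>\<^bsub>G\<^esub> inv\<^bsub>G\<^esub> u" if "h \<in> carrier G" for h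
    using that assms by (metis G.inv_closed G.inv_solve_left G.inv_solve_right G.inv_inv)
  have "(a \<otimes>\<^bsub>RG\<^esub> \<delta> u) g = (\<Oplus>h\<in>carrier G. if h = g \<otimes>\<^bsub>G\<^esub> inv\<^bsub>G\<^esub> u then a h else \<zero>)"
    using assms by (auto simp: coeff_mult coeff_delta coeff_closed * intro!: finsum_cong')
  also have "\<dots> = a (g \<otimes>\<^bsub>G\<^esub> inv\<^bsub>G\<^esub> u)"
    by (rule add.finprod_singleton_swap) (use assms finite_G in \<open>auto simp: coeff_closed\<close>)
  finally show ?thesis .
qed

lemma one_eq_delta: "\<one>\<^bsub>RG\<^esub> = \<delta> \<one>\<^bsub>G\<^esub>"
  by (simp add: group_algebra_def group_element_def)

lemma ga_ring: "ring RG"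
proof (rule ringI)
  show "abelian_group RG" by (rule ga_abelian_group)
  show "Group.monoid RG"
  proof (rule monoidI)
    fix x assume x: "x \<in> carrier RG"
    show "\<one>\<^bsub>RG\<^esub> \<otimes>\<^bsub>RG\<^esub> x = x" "x \<otimes>\<^bsub>RG\<^esub> \<one>\<^bsub>RG\<^esub> = x"
      unfolding one_eq_delta by (rule ga_eqI;
        use x in \<open>simp add: ga_mult_closed delta_closed delta_mult mult_delta coeff_closed\<close>)+
  qed (simp_all add: ga_mult_closed ga_one_closed ga_mult_assoc)
next
  fix x y z assume "x \<in> carrier RG" "y \<in> carrier RG" "z \<in> carrier RG"
  note xyz = this and cl = this[THEN coeff_closed]
  show "(x \<oplus>\<^bsub>RG\<^esub> y) \<otimes>\<^bsub>RG\<^esub> z = x \<otimes>\<^bsub>RG\<^esub> z \<oplus>\<^bsub>RG\<^esub> y \<otimes>\<^bsub>RG\<^esub> z"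
  proof (rule ga_eqI)
    fix g assume g: "g \<in> carrier G"
    have "((x \<oplus>\<^bsub>RG\<^esub> y) \<otimes>\<^bsub>RG\<^esub> z) g = (\<Oplus>h\<in>carrier G. x h \<otimes> z (inv\<^bsub>G\<^esub> h \<otimes>\<^bsub>G\<^esub> g) \<oplus> y h \<otimes> z (inv\<^bsub>G\<^esub> h \<otimes>\<^bsub>G\<^esub> g))"
      unfolding coeff_mult[OF g]
      by (rule finsum_cong') (use g cl in \<open>auto simp: coeff_add l_distr\<close>)
    also have "\<dots> = (x \<otimes>\<^bsub>RG\<^esub> z \<oplus>\<^bsub>RG\<^esub> y \<otimes>\<^bsub>RG\<^esub> z) g"
      unfolding coeff_add[OF g] coeff_mult[OF g]
      by (rule finsum_addf) (use g cl in auto)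
    finally show "((x \<oplus>\<^bsub>RG\<^esub> y) \<otimes>\<^bsub>RG\<^esub> z) g = \<dots>" .
  qed (use xyz in \<open>auto intro!: ga_mult_closed ga_add_closed\<close>)
  show "z \<otimes>\<^bsub>RG\<^esub> (x \<oplus>\<^bsub>RG\<^esub> y) = z \<otimes>\<^bsub>RG\<^esub> x \<oplus>\<^bsub>RG\<^esub> z \<otimes>\<^bsub>RG\<^esub> y"
  proof (rule ga_eqI)
    fix g assume g: "g \<in> carrier G"
    have "(z \<otimes>\<^bsub>RG\<^esub> (x \<oplus>\<^bsub>RG\<^esub> y)) g = (\<Oplus>h\<in>carrier G. z h \<otimes> x (inv\<^bsub>G\<^esub> h \<otimes>\<^bsub>G\<^esub> g) \<oplus> z h \<otimes> y (inv\<^bsub>G\<^esub> h \<otimes>\<^bsub>G\<^esub> g))"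
      unfolding coeff_mult[OF g]
      by (rule finsum_cong') (use g cl in \<open>auto simp: coeff_add r_distr\<close>)
    also have "\<dots> = (z \<otimes>\<^bsub>RG\<^esub> x \<oplus>\<^bsub>RG\<^esub> z \<otimes>\<^bsub>RG\<^esub> y) g"
      unfolding coeff_add[OF g] coeff_mult[OF g]
      by (rule finsum_addf) (use g cl in auto)
    finally show "(z \<otimes>\<^bsub>RG\<^esub> (x \<oplus>\<^bsub>RG\<^esub> y)) g = \<dots>" .
  qed (use xyz in \<open>auto intro!: ga_mult_closed ga_add_closed\<close>)
qed

lemma ga_module: "module R RG"
proof (rule moduleI)
  show "cring R" by (rule is_cring)
  show "abelian_group RG" by (rule ga_abelian_group)
next
  fix r s x assume "r \<in> carrier R" "s \<in> carrier R" "x \<in> carrier RG"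
  note * = this
  show "(r \<oplus> s) \<odot>\<^bsub>RG\<^esub> x = r \<odot>\<^bsub>RG\<^esub> x \<oplus>\<^bsub>RG\<^esub> s \<odot>\<^bsub>RG\<^esub> x"
    by (rule ga_eqI)
      (use * in \<open>simp_all add: ga_smult_closed ga_add_closed coeff_add coeff_smult coeff_closed l_distr\<close>)
  show "(r \<otimes> s) \<odot>\<^bsub>RG\<^esub> x = r \<odot>\<^bsub>RG\<^esub> (s \<odot>\<^bsub>RG\<^esub> x)"
    by (rule ga_eqI)
      (use * in \<open>simp_all add: ga_smult_closed coeff_smult coeff_closed m_assoc\<close>)
next
  fix r x y assume "r \<in> carrier R" "x \<in> carrier RG" "y \<in> carrier RG"
  note * = this
  show "r \<odot>\<^bsub>RG\<^esub> (x \<oplus>\<^bsub>RG\<^esub> y) = r \<odot>\<^bsub>RG\<^esub> x \<oplus>\<^bsub>RG\<^esub> r \<odot>\<^bsub>RG\<^esub> y"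
    by (rule ga_eqI)
      (use * in \<open>simp_all add: ga_smult_closed ga_add_closed coeff_add coeff_smult coeff_closed r_distr\<close>)
next
  fix x assume x: "x \<in> carrier RG"
  show "\<one> \<odot>\<^bsub>RG\<^esub> x = x"
    by (rule ga_eqI) (use x in \<open>simp_all add: ga_smult_closed coeff_smult coeff_closed\<close>)
qed (simp_all add: ga_smult_closed)

sublocale RG: ring "group_algebra R G" by (rule ga_ring)
sublocale RG: module R "group_algebra R G" by (rule ga_module)

lemma ga_smult_mult_l:
  assumes "r \<in> carrier R" "a \<in> carrier RG" "b \<in> carrier RG"
  shows "(r \<odot>\<^bsub>RG\<^esub> a) \<otimes>\<^bsub>RG\<^esub> b = r \<odot>\<^bsub>RG\<^esub> (a \<otimes>\<^bsub>RG\<^esub> b)"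
proof (rule ga_eqI)
  fix g assume g: "g \<in> carrier G"
  show "((r \<odot>\<^bsub>RG\<^esub> a) \<otimes>\<^bsub>RG\<^esub> b) g = (r \<odot>\<^bsub>RG\<^esub> (a \<otimes>\<^bsub>RG\<^esub> b)) g"
    using g assms(1) assms(2,3)[THEN coeff_closed]
    by (auto simp: coeff_mult coeff_smult finsum_rdistr[OF finite_G] m_assoc intro!: finsum_cong')
qed (use assms in auto)

lemma ga_smult_mult_r:
  assumes "r \<in> carrier R" "a \<in> carrier RG" "b \<in> carrier RG"
  shows "a \<otimes>\<^bsub>RG\<^esub> (r \<odot>\<^bsub>RG\<^esub> b) = r \<odot>\<^bsub>RG\<^esub> (a \<otimes>\<^bsub>RG\<^esub> b)"
proof (rule ga_eqI)
  fix g assume g: "g \<in> carrier G"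
  show "(a \<otimes>\<^bsub>RG\<^esub> (r \<odot>\<^bsub>RG\<^esub> b)) g = (r \<odot>\<^bsub>RG\<^esub> (a \<otimes>\<^bsub>RG\<^esub> b)) g"
    using g assms(1) assms(2,3)[THEN coeff_closed]
    by (auto simp: coeff_mult coeff_smult finsum_rdistr[OF finite_G] m_lcomm intro!: finsum_cong')
qed (use assms in auto)

lemma delta_mult_delta:
  assumes "u \<in> carrier G" "v \<in> carrier G"
  shows "\<delta> u \<otimes>\<^bsub>RG\<^esub> \<delta> v = \<delta> (u \<otimes>\<^bsub>G\<^esub> v)"
proof (rule ga_eqI)
  fix g assume g: "g \<in> carrier G"
  show "(\<delta> u \<otimes>\<^bsub>RG\<^esub> \<delta> v) g = \<delta> (u \<otimes>\<^bsub>G\<^esub> v) g"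
    using g assms by (simp add: delta_mult delta_closed coeff_delta)
      (metis G.inv_solve_left)
qed (use assms in \<open>auto intro: delta_closed\<close>)

lemma delta_mult_delta_coeff:
  assumes "u \<in> carrier G" "v \<in> carrier G" "a \<in> carrier RG" "g \<in> carrier G"
  shows "(\<delta> u \<otimes>\<^bsub>RG\<^esub> a \<otimes>\<^bsub>RG\<^esub> \<delta> v) g = a (inv\<^bsub>G\<^esub> u \<otimes>\<^bsub>G\<^esub> (g \<otimes>\<^bsub>G\<^esub> inv\<^bsub>G\<^esub> v))"
  using assms by (simp add: mult_delta delta_mult delta_closed)

text \<open>Central elements are the class functions. The condition only equates coefficients with
  each other, so it survives any map applied to all coefficients alike, in either direction between
  \<open>R\<close> and its residue field.\<close>

lemma ring_center_iff:
  "z \<in> ring_center RG \<longleftrightarrow> z \<in> carrier RG \<and>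
    (\<forall>x\<in>carrier G. \<forall>y\<in>carrier G. z (x \<otimes>\<^bsub>G\<^esub> y) = z (y \<otimes>\<^bsub>G\<^esub> x))"
proof (intro iffI conjI ballI)
  assume z: "z \<in> ring_center RG"
  then show zc: "z \<in> carrier RG" by (simp add: ring_center_def)
  fix x y assume xy: "x \<in> carrier G" "y \<in> carrier G"
  \<comment> \<open>Centrality is tested on the single group element \<open>inv y\<close>; the
    coefficients at \<open>x\<close> of the two products are the two sides of the claim.\<close>
  have "(z \<otimes>\<^bsub>RG\<^esub> \<delta> (inv\<^bsub>G\<^esub> y)) x = (\<delta> (inv\<^bsub>G\<^esub> y) \<otimes>\<^bsub>RG\<^esub> z) x"
    using z delta_closed by (simp add: ring_center_def)
  then show "z (x \<otimes>\<^bsub>G\<^esub> y) = z (y \<otimes>\<^bsub>G\<^esub> x)"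
    using xy zc by (simp add: mult_delta delta_mult)
next
  assume z: "z \<in> carrier RG \<and>
    (\<forall>x\<in>carrier G. \<forall>y\<in>carrier G. z (x \<otimes>\<^bsub>G\<^esub> y) = z (y \<otimes>\<^bsub>G\<^esub> x))"
  have "z \<otimes>\<^bsub>RG\<^esub> a = a \<otimes>\<^bsub>RG\<^esub> z" if a: "a \<in> carrier RG" for a
  proof (rule ga_eqI)
    fix g assume g: "g \<in> carrier G"
    note cl = conjunct1[OF z, THEN coeff_closed] a[THEN coeff_closed]
    \<comment> \<open>Substituting first \<open>g h\<close> and then \<open>inv h\<close> for the
      summation variable turns the argument of \<open>a\<close> into \<open>h\<close>; the class
      function property then moves \<open>g\<close> to the other side inside
      \<open>z\<close>.\<close>
    have "(z \<otimes>\<^bsub>RG\<^esub> a) g = (\<Oplus>h\<in>carrier G. z (g \<otimes>\<^bsub>G\<^esub> h) \<otimes> a (inv\<^bsub>G\<^esub> (g \<otimes>\<^bsub>G\<^esub> h) \<otimes>\<^bsub>G\<^esub> g))"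
      unfolding coeff_mult[OF g] by (rule reindex_l) (use g cl in auto)
    also have "\<dots> = (\<Oplus>h\<in>carrier G. z (g \<otimes>\<^bsub>G\<^esub> h) \<otimes> a (inv\<^bsub>G\<^esub> h))"
      using g cl by (intro finsum_cong' refl) (auto simp: G.inv_mult_group G.m_assoc)
    also have "\<dots> = (\<Oplus>h\<in>carrier G. z (g \<otimes>\<^bsub>G\<^esub> inv\<^bsub>G\<^esub> h) \<otimes> a (inv\<^bsub>G\<^esub> (inv\<^bsub>G\<^esub> h)))"
      by (rule reindex_inv) (use g cl in auto)
    also have "\<dots> = (\<Oplus>h\<in>carrier G. a h \<otimes> z (inv\<^bsub>G\<^esub> h \<otimes>\<^bsub>G\<^esub> g))"
    proof (rule finsum_cong' [OF refl])
      fix h assume h: "h \<in> carrier G"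
      have "z (g \<otimes>\<^bsub>G\<^esub> inv\<^bsub>G\<^esub> h) = z (inv\<^bsub>G\<^esub> h \<otimes>\<^bsub>G\<^esub> g)"
        using z g h by (meson G.inv_closed)
      then show "z (g \<otimes>\<^bsub>G\<^esub> inv\<^bsub>G\<^esub> h) \<otimes> a (inv\<^bsub>G\<^esub> (inv\<^bsub>G\<^esub> h)) = a h \<otimes> z (inv\<^bsub>G\<^esub> h \<otimes>\<^bsub>G\<^esub> g)"
        using g h cl by (simp add: m_comm)
    qed (use g cl in auto)
    also have "\<dots> = (a \<otimes>\<^bsub>RG\<^esub> z) g" by (simp add: coeff_mult[OF g])
    finally show "(z \<otimes>\<^bsub>RG\<^esub> a) g = (a \<otimes>\<^bsub>RG\<^esub> z) g" .
  qed (use conjunct1[OF z] a in \<open>simp_all add: ga_mult_closed\<close>)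
  then show "z \<in> ring_center RG" using conjunct1[OF z] by (simp add: ring_center_def)
qed

end

section \<open>Complete local principal ideal domains and the adic filtration\<close>

text \<open>Here u = (1 - 2x)d, so x + u = 3x^2 - 2x^3. Since (1 - 2x)^2 = 1 + 4d, the terms linear
  in d cancel and the new defect is u^2 - 4d^2, which is quadratic in d. Integer multiples are
  written as repeated sums.\<close>

lemma (in ring) newton_idempotent_step:
  assumes x: "x \<in> carrier R"
    and d_def: "d = x \<otimes> x \<ominus> x" and u_def: "u = d \<ominus> (x \<otimes> d \<oplus> x \<otimes> d)"
  shows "(x \<oplus> u) \<otimes> (x \<oplus> u) \<ominus> (x \<oplus> u) =
    u \<otimes> u \<ominus> (d \<otimes> d \<oplus> d \<otimes> d \<oplus> d \<otimes> d \<oplus> d \<otimes> d)"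
proof -
  \<comment> \<open>The elements x, d and u commute as polynomials in x, but the ring is
    noncommutative, so the needed products in both orders are computed by hand and expressed
    linearly in w and e.\<close>
  define w where "w = x \<otimes> d"
  define e where "e = d \<otimes> d"
  have d: "d \<in> carrier R" and w: "w \<in> carrier R" and e: "e \<in> carrier R"
    using x by (simp_all add: d_def w_def e_def)
  have u: "u \<in> carrier R" and u_eq: "u = d \<ominus> (w \<oplus> w)"
    using x d w by (simp_all add: u_def w_def)
  have xx: "x \<otimes> x = x \<oplus> d" unfolding d_def using x by algebra
  have dx: "d \<otimes> x = w" unfolding w_def d_def using x by algebra
  have xw: "x \<otimes> w = w \<oplus> e"
    using x d by (simp add: w_def e_def m_assoc[symmetric] xx l_distr)
  have wx: "w \<otimes> x = w \<oplus> e"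
    using x d xw by (simp add: w_def m_assoc dx[unfolded w_def])
  have xu: "x \<otimes> u = \<ominus> w \<ominus> e \<ominus> e"
  proof -
    have "x \<otimes> u = x \<otimes> d \<ominus> (x \<otimes> w \<oplus> x \<otimes> w)"
      unfolding u_eq using x d w by algebra
    also have "\<dots> = \<ominus> w \<ominus> e \<ominus> e"
      unfolding xw w_def[symmetric] using w e by algebra
    finally show ?thesis .
  qed
  have ux: "u \<otimes> x = \<ominus> w \<ominus> e \<ominus> e"
  proof -
    have "u \<otimes> x = d \<otimes> x \<ominus> (w \<otimes> x \<oplus> w \<otimes> x)"
      unfolding u_eq using x d w by algebra
    also have "\<dots> = \<ominus> w \<ominus> e \<ominus> e"
      unfolding wx dx using w e by algebra
    finally show ?thesis .
  qed
  define f where "f = u \<otimes> u"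
  have f: "f \<in> carrier R" using u by (simp add: f_def)
  have "(x \<oplus> u) \<otimes> (x \<oplus> u) \<ominus> (x \<oplus> u) = x \<otimes> x \<oplus> x \<otimes> u \<oplus> u \<otimes> x \<oplus> f \<ominus> (x \<oplus> u)"
    unfolding f_def using x u by algebra
  also have "\<dots> = x \<oplus> d \<oplus> (\<ominus> w \<ominus> e \<ominus> e) \<oplus> (\<ominus> w \<ominus> e \<ominus> e) \<oplus> f \<ominus> (x \<oplus> (d \<ominus> (w \<oplus> w)))"
    unfolding xx xu ux by (simp only: u_eq)
  also have "\<dots> = f \<ominus> (e \<oplus> e \<oplus> e \<oplus> e)"
    using x d w e f by algebra
  finally show ?thesis by (simp add: f_def e_def)
qed

lemma maximalideal_of_field:
  assumes "Ring.field K"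
  shows "maximalideal M K \<longleftrightarrow> M = {\<zero>\<^bsub>K\<^esub>}"
proof -
  interpret field K by fact
  have z: "maximalideal {\<zero>\<^bsub>K\<^esub>} K" by (rule zeromaximalideal)
  moreover have "M = {\<zero>\<^bsub>K\<^esub>}" if "maximalideal M K"
  proof -
    interpret M: maximalideal M K by fact
    have "M \<in> {I. ideal I K}" using M.is_ideal by simp
    then have "M = {\<zero>\<^bsub>K\<^esub>} \<or> M = carrier K" using all_ideals by auto
    then show ?thesis using M.I_notcarr by auto
  qed
  ultimately show ?thesis by blast
qed

text \<open>The Brauer map over the residue field again passes to a residue field, now the quotient
  by the zero ideal.\<close>

lemma jacobson_radical_field: "Ring.field K \<Longrightarrow> jacobson_radical K = {\<zero>\<^bsub>K\<^esub>}"
  by (simp add: jacobson_radical_def maximalideal_of_field)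

text \<open>Stated for any ring whose radical is an ideal, because it is applied both to
  \<open>R\<close> and to its residue field.\<close>

lemma residue_map_eq_zero_iff:
  assumes "ring R" "ideal (jacobson_radical R) R" "x \<in> carrier R"
  shows "residue_map R x = \<zero>\<^bsub>residue_field R\<^esub> \<longleftrightarrow> x \<in> jacobson_radical R"
proof -
  interpret ideal "jacobson_radical R" R by fact
  show ?thesis
    using assms(3) rcos_const_imp_mem a_rcos_const
    by (auto simp only: residue_map_def residue_field_def FactRing_def ring.simps)
qed

lemma (in cring) ideal_prod_cgenideal:
  assumes "a \<in> carrier R" "b \<in> carrier R"
  shows "(PIdl a) \<cdot> (PIdl b) = PIdl (a \<otimes> b)"
proof -
  have i: "ideal (PIdl (a \<otimes> b)) R" using assms by (simp add: cgenideal_ideal)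
  have "(PIdl a) \<cdot> (PIdl b) = Idl (PIdl (a \<otimes> b))"
    using assms by (simp add: ideal_prod_eq_genideal cgenideal_ideal cgenideal_prod)
  also have "\<dots> = PIdl (a \<otimes> b)"
  proof
    show "Idl (PIdl (a \<otimes> b)) \<subseteq> PIdl (a \<otimes> b)" by (rule genideal_minimal[OF i subset_refl])
    show "PIdl (a \<otimes> b) \<subseteq> Idl (PIdl (a \<otimes> b))"
      by (rule genideal_self) (use ideal.Icarr[OF i] in blast)
  qed
  finally show ?thesis .
qed

context complete_local_pid
begin

abbreviation "J \<equiv> jacobson_radical R"
abbreviation "\<kappa> \<equiv> residue_field R"
abbreviation "res \<equiv> residue_map R"

lemma J_maximal: "maximalideal J R"
proof -
  obtain M where M: "maximalideal M R" "\<And>N. maximalideal N R \<Longrightarrow> N = M" using local by blast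
  then have "{M. maximalideal M R} = {M}" by blast
  then show ?thesis using M(1) by (simp add: jacobson_radical_def)
qed

sublocale J: maximalideal "jacobson_radical R" R by (rule J_maximal)

lemma residue_field_field: "Ring.field \<kappa>"
  unfolding residue_field_def by (rule J.quotient_is_field) (rule is_cring)

sublocale \<kappa>: field "residue_field R" by (rule residue_field_field)

lemma res_hom: "res \<in> ring_hom R \<kappa>"
  using J.rcos_ring_hom unfolding residue_map_def[abs_def] residue_field_def by simp

sublocale res: ring_hom_ring R "residue_field R" "residue_map R"
  by (rule ring_hom_ringI2) (simp_all add: res_hom ring_axioms \<kappa>.ring_axioms)

lemma res_surj: "res ` carrier R = carrier \<kappa>"
  by (auto simp: residue_map_def residue_field_def FactRing_def A_RCOSETS_def')

lemma res_zero_iff: "x \<in> carrier R \<Longrightarrow> res x = \<zero>\<^bsub>\<kappa>\<^esub> \<longleftrightarrow> x \<in> J"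
  by (rule residue_map_eq_zero_iff) (simp_all add: ring_axioms J.is_ideal)

text \<open>A prime element if \<open>R\<close> is a discrete valuation ring, and zero if
  \<open>R\<close> is a field. The existence of a generator is the principal ideal property.\<close>

definition uniformizer :: 'a where
  "uniformizer = (SOME \<pi>. \<pi> \<in> carrier R \<and> J = PIdl \<pi>)"

abbreviation "\<pi> \<equiv> uniformizer"

lemma uniformizer: "\<pi> \<in> carrier R" "J = PIdl \<pi>"
proof -
  have "\<exists>\<pi>. \<pi> \<in> carrier R \<and> J = PIdl \<pi>" using exists_gen[OF J.is_ideal] by blast
  then show "\<pi> \<in> carrier R" "J = PIdl \<pi>"
    unfolding uniformizer_def by (metis (mono_tags, lifting) someI_ex)+
qed

text \<open>Turns the filtration by powers of the radical into divisibility by powers of one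
  element, the form in which all later estimates are made.\<close>

lemma radical_power_eq: "radical_power R n = PIdl (\<pi> [^] n)"
proof (induction n)
  case 0
  then show ?case
    by (force simp: radical_power_def ideals_set_def cgenideal_def nat_pow_def)
next
  case (Suc n)
  have "radical_power R (Suc n) = radical_power R n \<cdot> J"
    by (simp add: radical_power_def ideals_set_def nat_pow_def)
  also have "\<dots> = (PIdl (\<pi> [^] n)) \<cdot> (PIdl \<pi>)" using Suc uniformizer by simp
  also have "\<dots> = PIdl (\<pi> [^] Suc n)"
    using uniformizer(1) by (simp add: ideal_prod_cgenideal)
  finally show ?case .
qed

lemma radical_power_iff: "x \<in> radical_power R n \<longleftrightarrow> (\<exists>y\<in>carrier R. x = \<pi> [^] n \<otimes> y)"
  using uniformizer(1) by (auto simp: radical_power_eq cgenideal_def m_comm)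

lemma radical_power_1: "radical_power R (Suc 0) = J"
  using uniformizer by (simp add: radical_power_eq)

lemma res_zero_iff_uniformizer:
  assumes "x \<in> carrier R" shows "res x = \<zero>\<^bsub>\<kappa>\<^esub> \<longleftrightarrow> (\<exists>y\<in>carrier R. x = \<pi> \<otimes> y)"
  using radical_power_iff[of x "Suc 0"] uniformizer(1)
  by (simp add: res_zero_iff[OF assms] radical_power_1)

lemma limit_unique_zero:
  assumes "x \<in> carrier R" "\<And>n. \<exists>y\<in>carrier R. x = \<pi> [^] (n::nat) \<otimes> y"
  shows "x = \<zero>"
proof -
  have "x \<in> (\<Inter>n. radical_power R n)" using assms(2) by (simp add: radical_power_iff)
  then show ?thesis by (simp add: separated)
qed

end

section \<open>The adic filtration of the group algebra\<close>

locale complete_group_algebra = complete_local_pid R + finite_group_algebra R G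
  for R :: "('a, 'r) ring_scheme" (structure) and G :: "('g, 'm) monoid_scheme"
begin

sublocale K: finite_group_algebra "residue_field R" G
  by (intro finite_group_algebra.intro finite_group_algebra_axioms.intro)
    (rule \<kappa>.is_cring G.group_axioms finite_G)+

text \<open>As a set of multiples of a power of \<open>\<pi>\<close> it is visibly multiplicative,
  and \<open>adic 0\<close> is everything. The coefficientwise description required for limits is
  \<open>adic_iff_coeff\<close>.\<close>

definition adic :: "nat \<Rightarrow> ('g \<Rightarrow> 'a) set" where
  "adic n = (\<lambda>x. \<pi> [^] n \<odot>\<^bsub>RG\<^esub> x) ` carrier RG"

lemma adic_subset: "adic n \<subseteq> carrier RG"
  using uniformizer(1) by (auto simp: adic_def intro!: RG.smult_closed)

lemma adic_iff_coeff:
  "a \<in> adic n \<longleftrightarrow> a \<in> carrier RG \<and> (\<forall>g\<in>carrier G. a g \<in> radical_power R n)"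
proof
  assume "a \<in> adic n"
  then show "a \<in> carrier RG \<and> (\<forall>g\<in>carrier G. a g \<in> radical_power R n)"
    using adic_subset[of n]
    by (auto simp: adic_def radical_power_iff coeff_smult intro: coeff_closed)
next
  assume a: "a \<in> carrier RG \<and> (\<forall>g\<in>carrier G. a g \<in> radical_power R n)"
  then have "\<forall>g\<in>carrier G. \<exists>y\<in>carrier R. a g = \<pi> [^] n \<otimes> y"
    by (simp add: radical_power_iff)
  then obtain y where y: "\<And>g. g \<in> carrier G \<Longrightarrow> y g \<in> carrier R"
    "\<And>g. g \<in> carrier G \<Longrightarrow> a g = \<pi> [^] n \<otimes> y g" by metis
  have *: "restrict y (carrier G) \<in> carrier RG" by (rule ga_memI) (rule y)
  have "a = \<pi> [^] n \<odot>\<^bsub>RG\<^esub> restrict y (carrier G)"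
    by (rule ga_eqI) (use a y * uniformizer(1) in \<open>auto simp: coeff_smult intro!: RG.smult_closed\<close>)
  then show "a \<in> adic n" using * by (auto simp: adic_def)
qed

lemma adic_ideal: "ideal (adic n) RG"
proof (rule idealI)
  have pn: "\<pi> [^] n \<in> carrier R" using uniformizer(1) by simp
  show "ring RG" by (rule ga_ring)
  show "subgroup (adic n) (add_monoid RG)"
  proof (rule RG.add.subgroupI)
    show "adic n \<subseteq> carrier RG" by (rule adic_subset)
    show "adic n \<noteq> {}" by (auto simp: adic_def)
  next
    fix a assume "a \<in> adic n"
    then obtain x where "x \<in> carrier RG" "a = \<pi> [^] n \<odot>\<^bsub>RG\<^esub> x" by (auto simp: adic_def)
    then show "\<ominus>\<^bsub>RG\<^esub> a \<in> adic n"
      using pn by (auto simp: adic_def RG.smult_r_minus[symmetric])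
  next
    fix a b assume "a \<in> adic n" "b \<in> adic n"
    then obtain x y where "x \<in> carrier RG" "a = \<pi> [^] n \<odot>\<^bsub>RG\<^esub> x"
      "y \<in> carrier RG" "b = \<pi> [^] n \<odot>\<^bsub>RG\<^esub> y" by (auto simp: adic_def)
    then show "a \<oplus>\<^bsub>RG\<^esub> b \<in> adic n"
      using pn by (auto simp: adic_def RG.smult_r_distr[symmetric])
  qed
next
  fix a x assume "a \<in> adic n" and x: "x \<in> carrier RG"
  then obtain y where y: "y \<in> carrier RG" "a = \<pi> [^] n \<odot>\<^bsub>RG\<^esub> y" by (auto simp: adic_def)
  have pn: "\<pi> [^] n \<in> carrier R" using uniformizer(1) by simp
  show "x \<otimes>\<^bsub>RG\<^esub> a \<in> adic n" "a \<otimes>\<^bsub>RG\<^esub> x \<in> adic n"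
    using x y pn by (auto simp: adic_def ga_smult_mult_l ga_smult_mult_r)
qed

lemma adic_mult:
  assumes "a \<in> adic m" "b \<in> adic n" shows "a \<otimes>\<^bsub>RG\<^esub> b \<in> adic (m + n)"
proof -
  obtain x y where xy: "x \<in> carrier RG" "a = \<pi> [^] m \<odot>\<^bsub>RG\<^esub> x"
    "y \<in> carrier RG" "b = \<pi> [^] n \<odot>\<^bsub>RG\<^esub> y" using assms by (auto simp: adic_def)
  have p: "\<pi> [^] m \<in> carrier R" "\<pi> [^] n \<in> carrier R" using uniformizer(1) by simp_all
  have "a \<otimes>\<^bsub>RG\<^esub> b = \<pi> [^] (m + n) \<odot>\<^bsub>RG\<^esub> (x \<otimes>\<^bsub>RG\<^esub> y)"
    using xy p uniformizer(1) nat_pow_mult[OF uniformizer(1), of m n, symmetric]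
    by (simp add: ga_smult_mult_l ga_smult_mult_r RG.smult_assoc1[symmetric] m_comm)
  then show ?thesis using xy by (auto simp: adic_def)
qed

lemma adic_antimono:
  assumes "m \<le> n" shows "adic n \<subseteq> adic m"
proof
  fix a assume "a \<in> adic n"
  then obtain x where x: "x \<in> carrier RG" "a = \<pi> [^] n \<odot>\<^bsub>RG\<^esub> x" by (auto simp: adic_def)
  have "\<pi> [^] n = \<pi> [^] m \<otimes> \<pi> [^] (n - m)"
    using nat_pow_mult[OF uniformizer(1), of m "n - m"] assms by simp
  then have "a = \<pi> [^] m \<odot>\<^bsub>RG\<^esub> (\<pi> [^] (n - m) \<odot>\<^bsub>RG\<^esub> x)"
    using x uniformizer(1) by (simp add: RG.smult_assoc1)
  then show "a \<in> adic m" using x uniformizer(1) by (auto simp: adic_def)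
qed

lemma adic_separated:
  assumes "\<And>n. a \<in> adic n" shows "a = \<zero>\<^bsub>RG\<^esub>"
proof (rule ga_eqI)
  show a: "a \<in> carrier RG" using assms adic_subset by blast
  fix g assume g: "g \<in> carrier G"
  have "a g = \<zero>"
    using assms g a by (intro limit_unique_zero)
      (auto simp: adic_iff_coeff radical_power_iff[symmetric] coeff_closed)
  then show "a g = \<zero>\<^bsub>RG\<^esub> g" using g by (simp add: coeff_zero)
qed simp

lemma coeff_minus:
  assumes "a \<in> carrier RG" "b \<in> carrier RG" "g \<in> carrier G"
  shows "(a \<ominus>\<^bsub>RG\<^esub> b) g = a g \<ominus> b g"
proof -
  \<comment> \<open>Negatives in \<open>RG\<close> are inverses in the additive group and not given
    by a formula, so the coefficient of a difference is found by adding \<open>b\<close>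
    back.\<close>
  have "(a \<ominus>\<^bsub>RG\<^esub> b) g \<oplus> b g = a g"
    using assms by (simp add: coeff_add[symmetric] RG.minus_eq RG.a_assoc RG.l_neg)
  then show ?thesis
    using assms coeff_closed by (metis RG.minus_closed add.inv_solve_right' minus_eq)
qed

text \<open>The limit is assembled from limits of the coefficients. Completeness of \<open>R\<close>
  prescribes the rate, an error of order \<open>n\<close> at stage \<open>n\<close>, so the same
  rate holds for all coefficients at once.\<close>

lemma adic_complete:
  assumes "\<And>n. s n \<in> carrier RG" "\<And>n. s (Suc n) \<ominus>\<^bsub>RG\<^esub> s n \<in> adic n"
  shows "\<exists>l\<in>carrier RG. \<forall>n. l \<ominus>\<^bsub>RG\<^esub> s n \<in> adic n"
proof -
  have "\<exists>l\<in>carrier R. \<forall>n. l \<ominus> s n g \<in> radical_power R n" if g: "g \<in> carrier G" for g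
    using assms(1,2) g
    by (intro complete) (auto simp: coeff_closed adic_iff_coeff coeff_minus)
  then obtain l where l: "\<And>g. g \<in> carrier G \<Longrightarrow> l g \<in> carrier R"
    "\<And>g n. g \<in> carrier G \<Longrightarrow> l g \<ominus> s n g \<in> radical_power R n" by metis
  have *: "restrict l (carrier G) \<in> carrier RG" by (rule ga_memI) (rule l)
  show ?thesis
    by (rule bexI[OF _ *]) (use * assms(1) l in \<open>simp add: adic_iff_coeff coeff_minus\<close>)
qed

section \<open>Reduction of coefficients and its equivariant section\<close>

abbreviation "kG \<equiv> group_algebra \<kappa> G"
abbreviation "red \<equiv> reduce_coeffs R G"

lemma coeff_red: "g \<in> carrier G \<Longrightarrow> red a g = res (a g)"
  by (simp add: reduce_coeffs_def)

lemma red_closed: "a \<in> carrier RG \<Longrightarrow> red a \<in> carrier kG"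
  unfolding reduce_coeffs_def by (rule K.ga_memI) (simp add: coeff_closed)

lemma red_add: "\<lbrakk>a \<in> carrier RG; b \<in> carrier RG\<rbrakk> \<Longrightarrow> red (a \<oplus>\<^bsub>RG\<^esub> b) = red a \<oplus>\<^bsub>kG\<^esub> red b"
  by (rule K.ga_eqI)
    (simp_all add: red_closed coeff_red coeff_add K.coeff_add coeff_closed)

lemma red_mult:
  assumes "a \<in> carrier RG" "b \<in> carrier RG"
  shows "red (a \<otimes>\<^bsub>RG\<^esub> b) = red a \<otimes>\<^bsub>kG\<^esub> red b"
proof (rule K.ga_eqI)
  fix g assume g: "g \<in> carrier G"
  note cl = assms[THEN coeff_closed]
  have "red (a \<otimes>\<^bsub>RG\<^esub> b) g =
      (\<Oplus>\<^bsub>\<kappa>\<^esub>h\<in>carrier G. (res \<circ> (\<lambda>h. a h \<otimes> b (inv\<^bsub>G\<^esub> h \<otimes>\<^bsub>G\<^esub> g))) h)"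
    unfolding coeff_red[OF g] coeff_mult[OF g]
    by (subst res.hom_finsum) (use g cl in \<open>auto simp: comp_def\<close>)
  also have "\<dots> = (red a \<otimes>\<^bsub>kG\<^esub> red b) g"
    unfolding K.coeff_mult[OF g]
    by (rule \<kappa>.finsum_cong') (use g cl in \<open>auto simp: coeff_red\<close>)
  finally show "red (a \<otimes>\<^bsub>RG\<^esub> b) g = (red a \<otimes>\<^bsub>kG\<^esub> red b) g" .
qed (use assms in \<open>simp_all add: red_closed\<close>)

lemma red_delta: "u \<in> carrier G \<Longrightarrow> red (\<delta> u) = group_element \<kappa> G u"
  by (rule K.ga_eqI)
    (simp_all add: red_closed delta_closed K.delta_closed coeff_red coeff_delta K.coeff_delta)

lemma red_smult:
  "\<lbrakk>r \<in> carrier R; a \<in> carrier RG\<rbrakk> \<Longrightarrow> red (r \<odot>\<^bsub>RG\<^esub> a) = res r \<odot>\<^bsub>kG\<^esub> red a"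
  by (rule K.ga_eqI)
    (simp_all add: red_closed coeff_red coeff_smult K.coeff_smult coeff_closed)

lemma red_one: "red \<one>\<^bsub>RG\<^esub> = \<one>\<^bsub>kG\<^esub>"
  by (simp add: one_eq_delta K.one_eq_delta red_delta)

sublocale red: ring_hom_ring "group_algebra R G" "group_algebra (residue_field R) G"
  "reduce_coeffs R G"
  by (rule ring_hom_ringI)
    (simp_all add: ga_ring K.ga_ring red_closed red_mult red_add red_one)

lemma red_zero_iff: "a \<in> carrier RG \<Longrightarrow> red a = \<zero>\<^bsub>kG\<^esub> \<longleftrightarrow> a \<in> adic 1"
proof -
  assume a: "a \<in> carrier RG"
  have "red a = \<zero>\<^bsub>kG\<^esub> \<longleftrightarrow> (\<forall>g\<in>carrier G. red a g = \<zero>\<^bsub>\<kappa>\<^esub>)"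
    using a red_closed K.coeff_zero by (metis K.ga_eqI K.ga_zero_closed)
  then show ?thesis
    using a by (simp add: adic_iff_coeff coeff_red res_zero_iff coeff_closed radical_power_1)
qed

lemma red_eq_iff:
  assumes "a \<in> carrier RG" "b \<in> carrier RG"
  shows "red a = red b \<longleftrightarrow> a \<ominus>\<^bsub>RG\<^esub> b \<in> adic 1"
  using assms red_zero_iff[of "a \<ominus>\<^bsub>RG\<^esub> b"]
  by (simp add: RG.minus_eq K.RG.minus_eq[symmetric])

text \<open>The representative depends on the residue \<open>c g\<close> alone, so equal
  coefficients have equal lifts; equivariance rests on this.\<close>

definition lift_coeffs :: "('g \<Rightarrow> 'a set) \<Rightarrow> 'g \<Rightarrow> 'a" where
  "lift_coeffs c = (\<lambda>g\<in>carrier G. inv_into (carrier R) res (c g))"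

lemma lift_coeffs_closed: "c \<in> carrier kG \<Longrightarrow> lift_coeffs c \<in> carrier RG"
  unfolding lift_coeffs_def
  by (rule ga_memI) (auto intro!: inv_into_into simp: res_surj K.coeff_closed)

lemma coeff_lift: "g \<in> carrier G \<Longrightarrow> lift_coeffs c g = inv_into (carrier R) res (c g)"
  by (simp add: lift_coeffs_def)

lemma red_lift_coeffs: "c \<in> carrier kG \<Longrightarrow> red (lift_coeffs c) = c"
  by (rule K.ga_eqI) (simp_all add: red_closed lift_coeffs_closed coeff_red coeff_lift
      f_inv_into_f res_surj K.coeff_closed)

text \<open>On both sides the coefficient at g is the lift of the coefficient of c at the product of
  \<open>inv u\<close>, g and \<open>inv v\<close>: translation permutes coefficients and the
  section acts on each of them separately.\<close>

lemma lift_coeffs_translate: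
  assumes "c \<in> carrier kG" "u \<in> carrier G" "v \<in> carrier G"
  shows "lift_coeffs (group_element \<kappa> G u \<otimes>\<^bsub>kG\<^esub> c \<otimes>\<^bsub>kG\<^esub> group_element \<kappa> G v) =
    \<delta> u \<otimes>\<^bsub>RG\<^esub> lift_coeffs c \<otimes>\<^bsub>RG\<^esub> \<delta> v"
  by (rule ga_eqI) (use assms in \<open>simp_all add: lift_coeffs_closed delta_closed K.delta_closed
      coeff_lift delta_mult_delta_coeff K.delta_mult_delta_coeff\<close>)

lemma lift_coeffs_center: "c \<in> ring_center kG \<Longrightarrow> lift_coeffs c \<in> ring_center RG"
  unfolding ring_center_iff K.ring_center_iff by (simp add: lift_coeffs_closed coeff_lift)

lemma red_center: "c \<in> ring_center RG \<Longrightarrow> red c \<in> ring_center kG"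
  unfolding ring_center_iff K.ring_center_iff by (simp add: red_closed coeff_red)

end

section \<open>Lifting idempotents\<close>

lemma (in Group.monoid) mult_commutes:
  assumes "z \<in> carrier G" "w \<in> carrier G" "x \<in> carrier G"
    and "z \<otimes> x = x \<otimes> z" "w \<otimes> x = x \<otimes> w"
  shows "z \<otimes> w \<otimes> x = x \<otimes> (z \<otimes> w)"
  using assms(1-4) by (simp add: m_assoc assms(5)) (simp add: m_assoc[symmetric] assms(4))

text \<open>Reduces the Brauer conditions in defect groups and source idempotents to a membership
  test for coefficients, over any ring, so that the conditions over \<open>R\<close> and over its
  residue field can be compared.\<close>

lemma brauer_map_eq_zero_iff:
  assumes "ring S" "ideal (jacobson_radical S) S" "\<And>g. g \<in> carrier G \<Longrightarrow> a g \<in> carrier S"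
  shows "brauer_map S G P a = \<zero>\<^bsub>brauer_target S G P\<^esub> \<longleftrightarrow>
    (\<forall>g\<in>subgroup_centralizer G P. a g \<in> jacobson_radical S)"
proof -
  have "brauer_map S G P a = \<zero>\<^bsub>brauer_target S G P\<^esub> \<longleftrightarrow>
    (\<forall>g\<in>subgroup_centralizer G P. residue_map S (a g) = \<zero>\<^bsub>residue_field S\<^esub>)"
    by (auto simp: brauer_map_def group_algebra_def fun_eq_iff restrict_def)
  then show ?thesis
    using assms by (simp add: residue_map_eq_zero_iff subgroup_centralizer_def)
qed

context finite_group_algebra
begin

lemma ring_centerD:
  "z \<in> ring_center RG \<Longrightarrow> z \<in> carrier RG"
  "\<lbrakk>z \<in> ring_center RG; x \<in> carrier RG\<rbrakk> \<Longrightarrow> z \<otimes>\<^bsub>RG\<^esub> x = x \<otimes>\<^bsub>RG\<^esub> z"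
  by (simp_all add: ring_center_def)

lemma block_idempotentD:
  assumes "block_idempotent R G b"
  shows "b \<in> ring_center RG" "b \<in> carrier RG" "b \<otimes>\<^bsub>RG\<^esub> b = b"
proof -
  show b: "b \<in> ring_center RG" and "b \<otimes>\<^bsub>RG\<^esub> b = b"
    using assms by (auto simp: block_idempotent_def primitive_idempotent_def)
  show "b \<in> carrier RG" using b by (rule ring_centerD)
qed

text \<open>Rewrites the fixed points of the block as the solutions of the equations
  \<open>x b = x\<close> and \<open>\<delta> u x = x \<delta> u\<close>, which pass to limits and
  are respected by reduction. The first uses that \<open>b\<close> is idempotent, the second that
  \<open>\<delta> u\<close> is invertible.\<close>

lemma conj_fixed_block_eq:
  assumes b: "b \<in> carrier RG" "b \<otimes>\<^bsub>RG\<^esub> b = b" and D: "D \<subseteq> carrier G"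
  shows "conj_fixed_points R G D (block_algebra R G b) =
    {x \<in> carrier RG. x \<otimes>\<^bsub>RG\<^esub> b = x \<and> (\<forall>u\<in>D. \<delta> u \<otimes>\<^bsub>RG\<^esub> x = x \<otimes>\<^bsub>RG\<^esub> \<delta> u)}"
proof -
  have blk: "x \<in> block_algebra R G b \<longleftrightarrow> x \<in> carrier RG \<and> x \<otimes>\<^bsub>RG\<^esub> b = x" for x
  proof
    assume "x \<in> block_algebra R G b"
    then obtain a where "a \<in> carrier RG" "x = a \<otimes>\<^bsub>RG\<^esub> b" by (auto simp: block_algebra_def)
    then show "x \<in> carrier RG \<and> x \<otimes>\<^bsub>RG\<^esub> b = x" using b by (simp add: RG.m_assoc)
  next
    assume "x \<in> carrier RG \<and> x \<otimes>\<^bsub>RG\<^esub> b = x"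
    then show "x \<in> block_algebra R G b" unfolding block_algebra_def by (metis (mono_tags, lifting) mem_Collect_eq)
  qed
  have "\<delta> u \<otimes>\<^bsub>RG\<^esub> x \<otimes>\<^bsub>RG\<^esub> \<delta> (inv\<^bsub>G\<^esub> u) = x \<longleftrightarrow> \<delta> u \<otimes>\<^bsub>RG\<^esub> x = x \<otimes>\<^bsub>RG\<^esub> \<delta> u"
    if x: "x \<in> carrier RG" and u: "u \<in> carrier G" for u x
  proof -
    have "\<delta> u \<otimes>\<^bsub>RG\<^esub> x = \<delta> u \<otimes>\<^bsub>RG\<^esub> x \<otimes>\<^bsub>RG\<^esub> (\<delta> (inv\<^bsub>G\<^esub> u) \<otimes>\<^bsub>RG\<^esub> \<delta> u)"
      "x = x \<otimes>\<^bsub>RG\<^esub> (\<delta> u \<otimes>\<^bsub>RG\<^esub> \<delta> (inv\<^bsub>G\<^esub> u))"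
      using x u by (simp_all add: delta_mult_delta one_eq_delta[symmetric] delta_closed)
    note eq = this
    show ?thesis
    proof
      assume *: "\<delta> u \<otimes>\<^bsub>RG\<^esub> x \<otimes>\<^bsub>RG\<^esub> \<delta> (inv\<^bsub>G\<^esub> u) = x"
      have "\<delta> u \<otimes>\<^bsub>RG\<^esub> x = \<delta> u \<otimes>\<^bsub>RG\<^esub> x \<otimes>\<^bsub>RG\<^esub> \<delta> (inv\<^bsub>G\<^esub> u) \<otimes>\<^bsub>RG\<^esub> \<delta> u"
        using x by (subst eq(1)) (simp add: RG.m_assoc delta_closed)
      then show "\<delta> u \<otimes>\<^bsub>RG\<^esub> x = x \<otimes>\<^bsub>RG\<^esub> \<delta> u" unfolding * .
    next
      assume *: "\<delta> u \<otimes>\<^bsub>RG\<^esub> x = x \<otimes>\<^bsub>RG\<^esub> \<delta> u"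
      show "\<delta> u \<otimes>\<^bsub>RG\<^esub> x \<otimes>\<^bsub>RG\<^esub> \<delta> (inv\<^bsub>G\<^esub> u) = x"
        unfolding * using x eq(2) by (simp add: RG.m_assoc delta_closed)
    qed
  qed
  then show ?thesis
    using D by (auto simp: conj_fixed_points_def blk)
qed

end

context complete_group_algebra
begin

lemma adic_add: "\<lbrakk>a \<in> adic n; b \<in> adic n\<rbrakk> \<Longrightarrow> a \<oplus>\<^bsub>RG\<^esub> b \<in> adic n"
  using adic_ideal[of n] by (simp add: additive_subgroup.a_closed ideal.axioms(1))

lemma adic_uminus: "a \<in> adic n \<Longrightarrow> \<ominus>\<^bsub>RG\<^esub> a \<in> adic n"
  using adic_ideal[of n] by (simp add: additive_subgroup.a_inv_closed ideal.axioms(1))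

lemma adic_minus: "\<lbrakk>a \<in> adic n; b \<in> adic n\<rbrakk> \<Longrightarrow> a \<ominus>\<^bsub>RG\<^esub> b \<in> adic n"
  by (simp add: RG.minus_eq adic_add adic_uminus)

lemma adic_mult_l: "\<lbrakk>a \<in> carrier RG; b \<in> adic n\<rbrakk> \<Longrightarrow> a \<otimes>\<^bsub>RG\<^esub> b \<in> adic n"
  and adic_mult_r: "\<lbrakk>a \<in> carrier RG; b \<in> adic n\<rbrakk> \<Longrightarrow> b \<otimes>\<^bsub>RG\<^esub> a \<in> adic n"
  using adic_ideal[of n] by (simp_all add: ideal.I_l_closed ideal.I_r_closed)

lemma adic_Suc: "a \<in> adic (Suc n) \<Longrightarrow> a \<in> adic n"
  using adic_antimono[of n "Suc n"] by auto

lemma adic_closed: "a \<in> adic n \<Longrightarrow> a \<in> carrier RG"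
  using adic_subset by blast

text \<open>The device by which identities are carried over to limits: both sides are approximated
  by the same sequence.\<close>

lemma adic_eqI:
  assumes "x \<in> carrier RG" "y \<in> carrier RG"
    and "\<And>n. c n \<in> carrier RG" "\<And>n. x \<ominus>\<^bsub>RG\<^esub> c n \<in> adic n" "\<And>n. y \<ominus>\<^bsub>RG\<^esub> c n \<in> adic n"
  shows "x = y"
proof -
  have "x \<ominus>\<^bsub>RG\<^esub> y \<in> adic n" for n
  proof -
    have "x \<ominus>\<^bsub>RG\<^esub> y = (x \<ominus>\<^bsub>RG\<^esub> c n) \<ominus>\<^bsub>RG\<^esub> (y \<ominus>\<^bsub>RG\<^esub> c n)"
      using assms(1-3) by algebra
    then show ?thesis using adic_minus[OF assms(4,5)] by simp
  qed
  then have "x \<ominus>\<^bsub>RG\<^esub> y = \<zero>\<^bsub>RG\<^esub>" by (rule adic_separated)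
  then show ?thesis using assms(1,2) by simp
qed

text \<open>No identity element is demanded, because the subrings in question, fixed points of a
  block and corners cut out by an idempotent, need not contain the identity of
  \<open>RG\<close>.\<close>

definition adically_closed_subring :: "('g \<Rightarrow> 'a) set \<Rightarrow> bool" where
  "adically_closed_subring S \<longleftrightarrow> S \<subseteq> carrier RG \<and>
    (\<forall>x\<in>S. \<forall>y\<in>S. x \<oplus>\<^bsub>RG\<^esub> y \<in> S \<and> x \<ominus>\<^bsub>RG\<^esub> y \<in> S \<and> x \<otimes>\<^bsub>RG\<^esub> y \<in> S) \<and>
    (\<forall>s. \<forall>l\<in>carrier RG. (\<forall>n. s n \<in> S \<and> l \<ominus>\<^bsub>RG\<^esub> s n \<in> adic n) \<longrightarrow> l \<in> S)"

lemma lift_idempotent: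
  assumes S: "adically_closed_subring S" and a: "a \<in> S" "a \<otimes>\<^bsub>RG\<^esub> a \<ominus>\<^bsub>RG\<^esub> a \<in> adic 1"
  shows "\<exists>e\<in>S. e \<otimes>\<^bsub>RG\<^esub> e = e \<and> e \<ominus>\<^bsub>RG\<^esub> a \<in> adic 1"
proof -
  have Sc: "x \<in> carrier RG" if "x \<in> S" for x
    using S that by (auto simp: adically_closed_subring_def)
  have Sop: "x \<oplus>\<^bsub>RG\<^esub> y \<in> S" "x \<ominus>\<^bsub>RG\<^esub> y \<in> S" "x \<otimes>\<^bsub>RG\<^esub> y \<in> S" if "x \<in> S" "y \<in> S" for x y
    using S that by (auto simp: adically_closed_subring_def)
  define d where "d x = x \<otimes>\<^bsub>RG\<^esub> x \<ominus>\<^bsub>RG\<^esub> x" for x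
  define u where "u x = d x \<ominus>\<^bsub>RG\<^esub> (x \<otimes>\<^bsub>RG\<^esub> d x \<oplus>\<^bsub>RG\<^esub> x \<otimes>\<^bsub>RG\<^esub> d x)" for x
  \<comment> \<open>One step sends x to x + u = 3x^2 - 2x^3. This polynomial has no constant term,
    so the iteration stays inside \<open>S\<close> although \<open>S\<close> may lack the
    identity.\<close>
  define s where "s n = ((\<lambda>x. x \<oplus>\<^bsub>RG\<^esub> u x) ^^ n) a" for n
  have s_Suc: "s (Suc n) = s n \<oplus>\<^bsub>RG\<^esub> u (s n)" for n by (simp add: s_def)
  have sS: "s n \<in> S" for n
    by (induction n) (simp_all add: s_def a Sop u_def d_def)
  note sc = sS[THEN Sc]
  have u_adic: "u x \<in> adic n" if "x \<in> carrier RG" "d x \<in> adic n" for x n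
    using that by (simp add: u_def adic_minus adic_add adic_mult_l)
  have d_adic: "d (s n) \<in> adic (Suc n)" for n
  proof (induction n)
    case 0
    then show ?case using a by (simp add: s_def d_def)
  next
    case (Suc n)
    have "d (s (Suc n)) = u (s n) \<otimes>\<^bsub>RG\<^esub> u (s n) \<ominus>\<^bsub>RG\<^esub> (d (s n) \<otimes>\<^bsub>RG\<^esub> d (s n) \<oplus>\<^bsub>RG\<^esub> d (s n) \<otimes>\<^bsub>RG\<^esub> d (s n)
        \<oplus>\<^bsub>RG\<^esub> d (s n) \<otimes>\<^bsub>RG\<^esub> d (s n) \<oplus>\<^bsub>RG\<^esub> d (s n) \<otimes>\<^bsub>RG\<^esub> d (s n))"
      unfolding s_Suc d_def[of "s n \<oplus>\<^bsub>RG\<^esub> u (s n)"]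
      by (rule RG.newton_idempotent_step[OF sc d_def u_def])
    \<comment> \<open>Every term is a product of two elements of \<open>adic (Suc n)\<close>, so the
      order of the defect doubles. Of this gain only one order per step is kept, which is already
      the rate that completeness asks for.\<close>
    also have "\<dots> \<in> adic (Suc n + Suc n)"
      using adic_mult[OF u_adic[OF sc Suc] u_adic[OF sc Suc]] adic_mult[OF Suc Suc]
      by (simp add: adic_minus adic_add)
    finally show ?case using adic_antimono[of "Suc (Suc n)" "Suc n + Suc n"] by auto
  qed
  have step: "s (Suc n) \<ominus>\<^bsub>RG\<^esub> s n \<in> adic (Suc n)" for n
  proof -
    have uc: "u (s n) \<in> carrier RG" using u_adic[OF sc d_adic] adic_closed by blast
    have "s (Suc n) \<ominus>\<^bsub>RG\<^esub> s n = u (s n)"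
      unfolding s_Suc using sc[of n] uc by algebra
    then show ?thesis using u_adic[OF sc d_adic] by simp
  qed
  obtain l where l: "l \<in> carrier RG" "\<And>n. l \<ominus>\<^bsub>RG\<^esub> s n \<in> adic n"
    using adic_complete[of s] sc step adic_Suc by blast
  have lS: "l \<in> S" using S l sS unfolding adically_closed_subring_def by blast
  have "l \<otimes>\<^bsub>RG\<^esub> l \<ominus>\<^bsub>RG\<^esub> l \<in> adic n" for n
  proof -
    define t where "t = l \<ominus>\<^bsub>RG\<^esub> s n"
    have t: "t \<in> carrier RG" "t \<in> adic n" using l sc by (simp_all add: t_def)
    have lt: "l = s n \<oplus>\<^bsub>RG\<^esub> t" unfolding t_def using l(1) sc[of n] by algebra
    \<comment> \<open>The defect of the limit differs from that of \<open>s n\<close> by terms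
      containing the error \<open>t\<close>, hence is as small as \<open>t\<close> and
      \<open>d (s n)\<close> are.\<close>
    have "l \<otimes>\<^bsub>RG\<^esub> l \<ominus>\<^bsub>RG\<^esub> l = d (s n) \<oplus>\<^bsub>RG\<^esub> (s n \<otimes>\<^bsub>RG\<^esub> t \<oplus>\<^bsub>RG\<^esub> t \<otimes>\<^bsub>RG\<^esub> s n \<oplus>\<^bsub>RG\<^esub> t \<otimes>\<^bsub>RG\<^esub> t \<ominus>\<^bsub>RG\<^esub> t)"
      unfolding lt d_def using sc[of n] t(1) by algebra
    then show ?thesis
      using t sc d_adic[THEN adic_Suc] by (simp add: adic_add adic_minus adic_mult_l adic_mult_r)
  qed
  then have "l \<otimes>\<^bsub>RG\<^esub> l \<ominus>\<^bsub>RG\<^esub> l = \<zero>\<^bsub>RG\<^esub>" by (rule adic_separated)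
  then have "l \<otimes>\<^bsub>RG\<^esub> l = l" using l(1) by simp
  moreover have "l \<ominus>\<^bsub>RG\<^esub> a \<in> adic 1"
  proof -
    \<comment> \<open>The estimate at index 0 carries no information, since \<open>adic 0\<close> is
      everything. The comparison therefore goes through \<open>s 1\<close>: the limit agrees with it
      to first order, and the first Newton step has order one.\<close>
    have "l \<ominus>\<^bsub>RG\<^esub> a = (l \<ominus>\<^bsub>RG\<^esub> s 1) \<oplus>\<^bsub>RG\<^esub> (s (Suc 0) \<ominus>\<^bsub>RG\<^esub> s 0)"
      using l(1) sc[of 0] sc[of 1] by (simp add: s_def[of 0]) algebra
    then show ?thesis using l(2)[of 1] step[of 0] by (simp add: adic_add)
  qed
  ultimately show ?thesis using lS by blast
qed

text \<open>An idempotent in \<open>adic 1\<close> equals all its powers and so lies in every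
  \<open>adic n\<close>, which forces it to vanish.\<close>

lemma red_idempotent_nonzero:
  assumes "e \<in> carrier RG" "e \<otimes>\<^bsub>RG\<^esub> e = e" "e \<noteq> \<zero>\<^bsub>RG\<^esub>"
  shows "red e \<noteq> \<zero>\<^bsub>kG\<^esub>"
proof
  assume "red e = \<zero>\<^bsub>kG\<^esub>"
  then have e1: "e \<in> adic 1" using assms by (simp add: red_zero_iff)
  have "e \<in> adic n" for n
  proof (induction n)
    case 0
    then show ?case using e1 adic_Suc by simp
  next
    case (Suc n)
    then show ?case using adic_mult[OF Suc e1] assms(2) by simp
  qed
  then show False using adic_separated assms(3) by blast
qed

text \<open>A decomposition of \<open>red e\<close> lifts to one of \<open>e\<close>: the summand
  \<open>x\<close> is lifted to an idempotent \<open>f\<close> below \<open>e\<close>, and the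
  second summand is taken to be the complement of \<open>f\<close> in \<open>e\<close> and not a
  separate lift of \<open>y\<close>. About \<open>T'\<close> only the existence of preimages in
  \<open>T\<close> matters, so the lemma fits both centers and fixed points.\<close>

lemma primitive_idempotent_red:
  assumes T: "adically_closed_subring T" and e: "primitive_idempotent RG T e"
    and T': "T' \<subseteq> carrier kG" "red e \<in> T'" and lift: "\<And>x. x \<in> T' \<Longrightarrow> \<exists>a\<in>T. red a = x"
  shows "primitive_idempotent kG T' (red e)"
proof -
  have Tc: "x \<in> carrier RG" if "x \<in> T" for x
    using T that by (auto simp: adically_closed_subring_def)
  have Top: "x \<oplus>\<^bsub>RG\<^esub> y \<in> T" "x \<ominus>\<^bsub>RG\<^esub> y \<in> T" "x \<otimes>\<^bsub>RG\<^esub> y \<in> T" if "x \<in> T" "y \<in> T" for x y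
    using T that by (auto simp: adically_closed_subring_def)
  have eT: "e \<in> T" and ee: "e \<otimes>\<^bsub>RG\<^esub> e = e" and e0: "e \<noteq> \<zero>\<^bsub>RG\<^esub>"
    using e by (auto simp: primitive_idempotent_def)
  note ec = Tc[OF eT]
  have False
    if xy: "x \<in> T'" "y \<in> T'" "x \<noteq> \<zero>\<^bsub>kG\<^esub>" "y \<noteq> \<zero>\<^bsub>kG\<^esub>" "x \<otimes>\<^bsub>kG\<^esub> x = x" "x \<otimes>\<^bsub>kG\<^esub> y = \<zero>\<^bsub>kG\<^esub>"
      "y \<otimes>\<^bsub>kG\<^esub> x = \<zero>\<^bsub>kG\<^esub>" "red e = x \<oplus>\<^bsub>kG\<^esub> y" for x y
  proof -
    have xc: "x \<in> carrier kG" and yc: "y \<in> carrier kG" using xy(1,2) T'(1) by auto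
    have ex: "red e \<otimes>\<^bsub>kG\<^esub> x = x" "x \<otimes>\<^bsub>kG\<^esub> red e = x"
      using xy xc yc by (simp_all add: K.RG.l_distr K.RG.r_distr)
    obtain a0 where a0: "a0 \<in> T" "red a0 = x" using lift xy(1) by blast
    \<comment> \<open>Idempotent lifting is applied in the corner \<open>e T e\<close>. Only there
      does the lift satisfy \<open>e f = f = f e\<close>, so that \<open>e \<ominus> f\<close> is an
      idempotent orthogonal to \<open>f\<close>.\<close>
    define S where "S = {z \<in> T. e \<otimes>\<^bsub>RG\<^esub> z = z \<and> z \<otimes>\<^bsub>RG\<^esub> e = z}"
    \<comment> \<open>Compressing by \<open>e\<close> puts the preimage into the corner without
      changing its reduction, because \<open>red e\<close> acts as an identity on
      \<open>x\<close>.\<close>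
    define a where "a = e \<otimes>\<^bsub>RG\<^esub> a0 \<otimes>\<^bsub>RG\<^esub> e"
    have a0c: "a0 \<in> carrier RG" using Tc a0 by blast
    have aS: "a \<in> S"
    proof -
      have "e \<otimes>\<^bsub>RG\<^esub> a = e \<otimes>\<^bsub>RG\<^esub> e \<otimes>\<^bsub>RG\<^esub> a0 \<otimes>\<^bsub>RG\<^esub> e" "a \<otimes>\<^bsub>RG\<^esub> e = e \<otimes>\<^bsub>RG\<^esub> a0 \<otimes>\<^bsub>RG\<^esub> (e \<otimes>\<^bsub>RG\<^esub> e)"
        using ec a0c by (simp_all add: a_def RG.m_assoc)
      then show ?thesis by (simp add: S_def a_def Top eT a0 ee)
    qed
    have ac: "a \<in> carrier RG" using ec a0c by (simp add: a_def)
    have ra: "red a = x" using ec a0c a0 ex by (simp add: a_def)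
    have S: "adically_closed_subring S"
      unfolding adically_closed_subring_def
    proof (intro conjI ballI allI impI)
      show "S \<subseteq> carrier RG" using Tc by (auto simp: S_def)
    next
      fix z w assume zw: "z \<in> S" "w \<in> S"
      then have c: "z \<in> carrier RG" "w \<in> carrier RG" using Tc by (auto simp: S_def)
      show "z \<oplus>\<^bsub>RG\<^esub> w \<in> S"
        using zw c ec by (auto simp: S_def Top RG.l_distr RG.r_distr)
      show "z \<ominus>\<^bsub>RG\<^esub> w \<in> S"
        using zw c ec by (auto simp: S_def Top RG.l_distr RG.r_distr RG.minus_eq RG.l_minus RG.r_minus
            Top(2)[unfolded RG.minus_eq])
      show "z \<otimes>\<^bsub>RG\<^esub> w \<in> S"
        using zw c ec by (auto simp: S_def Top RG.m_assoc) (metis RG.m_assoc)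
    next
      fix s l assume l: "l \<in> carrier RG" and sl: "\<forall>n. s n \<in> S \<and> l \<ominus>\<^bsub>RG\<^esub> s n \<in> adic n"
      have sc: "s n \<in> carrier RG" for n using sl Tc by (auto simp: S_def)
      have "l \<in> T" using T l sl unfolding adically_closed_subring_def S_def by blast
      moreover have "e \<otimes>\<^bsub>RG\<^esub> l = l"
      proof (rule adic_eqI[of _ _ s])
        fix n
        have "e \<otimes>\<^bsub>RG\<^esub> l \<ominus>\<^bsub>RG\<^esub> s n = e \<otimes>\<^bsub>RG\<^esub> (l \<ominus>\<^bsub>RG\<^esub> s n)"
          using ec l sc[of n] sl by (simp add: RG.minus_eq RG.r_distr RG.r_minus S_def)
        then show "e \<otimes>\<^bsub>RG\<^esub> l \<ominus>\<^bsub>RG\<^esub> s n \<in> adic n" using sl ec by (simp add: adic_mult_l)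
      qed (use l sc ec sl in auto)
      moreover have "l \<otimes>\<^bsub>RG\<^esub> e = l"
      proof (rule adic_eqI[of _ _ s])
        fix n
        have "l \<otimes>\<^bsub>RG\<^esub> e \<ominus>\<^bsub>RG\<^esub> s n = (l \<ominus>\<^bsub>RG\<^esub> s n) \<otimes>\<^bsub>RG\<^esub> e"
          using ec l sc[of n] sl by (simp add: RG.minus_eq RG.l_distr RG.l_minus S_def)
        then show "l \<otimes>\<^bsub>RG\<^esub> e \<ominus>\<^bsub>RG\<^esub> s n \<in> adic n" using sl ec by (simp add: adic_mult_r)
      qed (use l sc ec sl in auto)
      ultimately show "l \<in> S" by (simp add: S_def)
    qed
    have "a \<otimes>\<^bsub>RG\<^esub> a \<ominus>\<^bsub>RG\<^esub> a \<in> adic 1"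
      using red_eq_iff[of "a \<otimes>\<^bsub>RG\<^esub> a" a] ac xy(5) ra by simp
    then obtain f where f: "f \<in> S" "f \<otimes>\<^bsub>RG\<^esub> f = f" "f \<ominus>\<^bsub>RG\<^esub> a \<in> adic 1"
      using lift_idempotent[OF S aS] by blast
    have fT: "f \<in> T" and ef: "e \<otimes>\<^bsub>RG\<^esub> f = f" "f \<otimes>\<^bsub>RG\<^esub> e = f" using f(1) by (auto simp: S_def)
    note fc = Tc[OF fT]
    have rf: "red f = x" using red_eq_iff[OF fc ac] f(3) ra by simp
    define h where "h = e \<ominus>\<^bsub>RG\<^esub> f"
    have hT: "h \<in> T" and hc: "h \<in> carrier RG" using Top(2)[OF eT fT] Tc by (auto simp: h_def)
    have efh: "e = f \<oplus>\<^bsub>RG\<^esub> h" unfolding h_def using ec fc by algebra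
    have "f \<noteq> \<zero>\<^bsub>RG\<^esub>" using rf xy(3) by auto
    moreover have "h \<noteq> \<zero>\<^bsub>RG\<^esub>"
    proof
      assume "h = \<zero>\<^bsub>RG\<^esub>"
      \<comment> \<open>A trivial complement would make \<open>red e\<close> equal to
        \<open>x\<close>, leaving nothing for \<open>y\<close>.\<close>
      then have "e = f" using efh fc by simp
      then have "x \<oplus>\<^bsub>kG\<^esub> y = x" using rf xy(8) by simp
      then show False using xc yc xy(4) by simp
    qed
    moreover have "f \<otimes>\<^bsub>RG\<^esub> h = \<zero>\<^bsub>RG\<^esub>" "h \<otimes>\<^bsub>RG\<^esub> f = \<zero>\<^bsub>RG\<^esub>"
      using fc ec ef f(2)
      by (simp_all add: h_def RG.minus_eq RG.l_distr RG.r_distr RG.l_minus RG.r_minus RG.r_neg)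
    moreover have "h \<otimes>\<^bsub>RG\<^esub> h = h"
    proof -
      have "h \<otimes>\<^bsub>RG\<^esub> h = e \<otimes>\<^bsub>RG\<^esub> h \<ominus>\<^bsub>RG\<^esub> f \<otimes>\<^bsub>RG\<^esub> h"
        using fc ec hc by (simp add: h_def RG.minus_eq RG.l_distr RG.l_minus)
      also have "e \<otimes>\<^bsub>RG\<^esub> h = h"
        using fc ec ef ee by (simp add: h_def RG.minus_eq RG.r_distr RG.r_minus)
      finally show ?thesis using hc \<open>f \<otimes>\<^bsub>RG\<^esub> h = \<zero>\<^bsub>RG\<^esub>\<close> by (simp add: RG.minus_eq)
    qed
    ultimately show False
      using e fT hT f(2) efh unfolding primitive_idempotent_def by blast
  qed
  moreover have "red e \<otimes>\<^bsub>kG\<^esub> red e = red e" using ec ee by (metis red_mult)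
  ultimately show ?thesis
    using T'(2) red_idempotent_nonzero[OF ec ee e0] unfolding primitive_idempotent_def by blast
qed

section \<open>Blocks, defect groups and source idempotents under reduction\<close>

lemma adically_closed_center: "adically_closed_subring (ring_center RG)"
  unfolding adically_closed_subring_def
proof (intro conjI ballI allI impI)
  show "ring_center RG \<subseteq> carrier RG" by (auto simp: ring_center_def)
next
  fix z w assume "z \<in> ring_center RG" "w \<in> ring_center RG"
  note zw = ring_centerD[OF this(1)] ring_centerD[OF this(2)]
  show "z \<oplus>\<^bsub>RG\<^esub> w \<in> ring_center RG" "z \<ominus>\<^bsub>RG\<^esub> w \<in> ring_center RG"
    using zw by (simp_all add: ring_center_def RG.l_distr RG.r_distr RG.minus_eq RG.l_minus RG.r_minus)
  show "z \<otimes>\<^bsub>RG\<^esub> w \<in> ring_center RG"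
    unfolding ring_center_def
    by (intro CollectI conjI ballI RG.mult_commutes RG.m_closed) (assumption | rule zw)+
next
  fix s l assume l: "l \<in> carrier RG" and sl: "\<forall>n. s n \<in> ring_center RG \<and> l \<ominus>\<^bsub>RG\<^esub> s n \<in> adic n"
  have sc: "s n \<in> carrier RG" "\<And>x. x \<in> carrier RG \<Longrightarrow> s n \<otimes>\<^bsub>RG\<^esub> x = x \<otimes>\<^bsub>RG\<^esub> s n" for n
    using sl ring_centerD by blast+
  have "l \<otimes>\<^bsub>RG\<^esub> x = x \<otimes>\<^bsub>RG\<^esub> l" if x: "x \<in> carrier RG" for x
  \<comment> \<open>One sequence approximates both products, because each \<open>s n\<close> is
    already central.\<close>
  proof (rule adic_eqI[of _ _ "\<lambda>n. x \<otimes>\<^bsub>RG\<^esub> s n"])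
    fix n
    have "l \<otimes>\<^bsub>RG\<^esub> x \<ominus>\<^bsub>RG\<^esub> x \<otimes>\<^bsub>RG\<^esub> s n = (l \<ominus>\<^bsub>RG\<^esub> s n) \<otimes>\<^bsub>RG\<^esub> x"
      "x \<otimes>\<^bsub>RG\<^esub> l \<ominus>\<^bsub>RG\<^esub> x \<otimes>\<^bsub>RG\<^esub> s n = x \<otimes>\<^bsub>RG\<^esub> (l \<ominus>\<^bsub>RG\<^esub> s n)"
      using l x sc by (simp_all add: RG.minus_eq RG.l_distr RG.r_distr RG.l_minus RG.r_minus)
    then show "l \<otimes>\<^bsub>RG\<^esub> x \<ominus>\<^bsub>RG\<^esub> x \<otimes>\<^bsub>RG\<^esub> s n \<in> adic n" "x \<otimes>\<^bsub>RG\<^esub> l \<ominus>\<^bsub>RG\<^esub> x \<otimes>\<^bsub>RG\<^esub> s n \<in> adic n"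
      using x sl by (simp_all add: adic_mult_l adic_mult_r)
  qed (use l sc x in auto)
  then show "l \<in> ring_center RG" using l by (simp add: ring_center_def)
qed

lemma block_idempotent_red:
  assumes "block_idempotent R G b" shows "block_idempotent \<kappa> G (red b)"
  unfolding block_idempotent_def
proof (rule primitive_idempotent_red[OF adically_closed_center])
  show "primitive_idempotent RG (ring_center RG) b"
    using assms by (simp add: block_idempotent_def)
  show "red b \<in> ring_center kG" by (rule red_center) (rule block_idempotentD[OF assms])
qed (auto simp: K.ring_centerD(1) intro!: bexI[OF _ lift_coeffs_center] red_lift_coeffs)

text \<open>Over the residue field the radical is zero, so both conditions say that the coefficients
  of \<open>a\<close> on the centralizer of \<open>P\<close> lie in \<open>J\<close>. Hence
  nonvanishing under Brauer maps, and with it the defect groups, cannot change under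
  reduction.\<close>

lemma brauer_map_red_eq_zero_iff:
  assumes "a \<in> carrier RG"
  shows "brauer_map \<kappa> G P (red a) = \<zero>\<^bsub>brauer_target \<kappa> G P\<^esub> \<longleftrightarrow>
    brauer_map R G P a = \<zero>\<^bsub>brauer_target R G P\<^esub>"
proof -
  have "brauer_map \<kappa> G P (red a) = \<zero>\<^bsub>brauer_target \<kappa> G P\<^esub> \<longleftrightarrow>
    (\<forall>g\<in>subgroup_centralizer G P. red a g \<in> {\<zero>\<^bsub>\<kappa>\<^esub>})"
    using brauer_map_eq_zero_iff[of \<kappa> G "red a" P] assms
    by (simp add: jacobson_radical_field residue_field_field \<kappa>.ring_axioms \<kappa>.zeroideal
        red_closed K.coeff_closed)
  also have "\<dots> \<longleftrightarrow> (\<forall>g\<in>subgroup_centralizer G P. a g \<in> J)"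
    using assms by (simp add: subgroup_centralizer_def coeff_red res_zero_iff coeff_closed)
  also have "\<dots> \<longleftrightarrow> brauer_map R G P a = \<zero>\<^bsub>brauer_target R G P\<^esub>"
    using brauer_map_eq_zero_iff[of R G a P] assms
    by (simp add: ring_axioms J.is_ideal coeff_closed)
  finally show ?thesis .
qed

lemma defect_group_red:
  assumes "b \<in> carrier RG" "defect_group p R G b D" shows "defect_group p \<kappa> G (red b) D"
  using assms by (simp add: defect_group_def brauer_map_red_eq_zero_iff)

text \<open>Compares the equivariance of the section for the pairs (u, 1) and (1, u).\<close>

lemma lift_coeffs_commute:
  assumes x: "x \<in> carrier kG" and u: "u \<in> carrier G"
    and c: "group_element \<kappa> G u \<otimes>\<^bsub>kG\<^esub> x = x \<otimes>\<^bsub>kG\<^esub> group_element \<kappa> G u"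
  shows "\<delta> u \<otimes>\<^bsub>RG\<^esub> lift_coeffs x = lift_coeffs x \<otimes>\<^bsub>RG\<^esub> \<delta> u"
  using lift_coeffs_translate[OF x u G.one_closed] lift_coeffs_translate[OF x G.one_closed u] x u c
  by (simp add: one_eq_delta[symmetric] K.one_eq_delta[symmetric] lift_coeffs_closed delta_closed
      K.delta_closed)

lemma source_idempotent_red:
  assumes b: "block_idempotent R G b" and D: "D \<subseteq> carrier G" and i: "source_idempotent R G D b i"
  shows "source_idempotent \<kappa> G D (red b) (red i)"
proof -
  note bD = block_idempotentD[OF b] and bD' = K.block_idempotentD[OF block_idempotent_red[OF b]]
  define T where "T = {x \<in> carrier RG. x \<otimes>\<^bsub>RG\<^esub> b = x \<and> (\<forall>u\<in>D. \<delta> u \<otimes>\<^bsub>RG\<^esub> x = x \<otimes>\<^bsub>RG\<^esub> \<delta> u)}"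
  define T' where "T' = {x \<in> carrier kG. x \<otimes>\<^bsub>kG\<^esub> red b = x \<and>
    (\<forall>u\<in>D. group_element \<kappa> G u \<otimes>\<^bsub>kG\<^esub> x = x \<otimes>\<^bsub>kG\<^esub> group_element \<kappa> G u)}"
  have T_eq: "conj_fixed_points R G D (block_algebra R G b) = T"
    unfolding T_def by (rule conj_fixed_block_eq[OF bD(2,3) D])
  have T'_eq: "conj_fixed_points \<kappa> G D (block_algebra \<kappa> G (red b)) = T'"
    unfolding T'_def by (rule K.conj_fixed_block_eq[OF bD'(2,3) D])
  have prim: "primitive_idempotent RG T i" using i by (simp add: source_idempotent_def T_eq)
  then have iT: "i \<in> T" by (simp add: primitive_idempotent_def)
  have dc: "\<delta> u \<in> carrier RG" for u by (rule delta_closed)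
  have closed: "adically_closed_subring T"
    unfolding adically_closed_subring_def
  proof (intro conjI ballI allI impI)
    show "T \<subseteq> carrier RG" by (auto simp: T_def)
  next
    fix z w assume zw: "z \<in> T" "w \<in> T"
    then show "z \<oplus>\<^bsub>RG\<^esub> w \<in> T" "z \<ominus>\<^bsub>RG\<^esub> w \<in> T"
      using bD(2) dc
      by (auto simp: T_def RG.l_distr RG.r_distr RG.minus_eq RG.l_minus RG.r_minus)
    show "z \<otimes>\<^bsub>RG\<^esub> w \<in> T"
    proof -
      have "z \<otimes>\<^bsub>RG\<^esub> w \<otimes>\<^bsub>RG\<^esub> \<delta> u = \<delta> u \<otimes>\<^bsub>RG\<^esub> (z \<otimes>\<^bsub>RG\<^esub> w)" if "u \<in> D" for u
        using zw that by (intro RG.mult_commutes dc) (auto simp: T_def)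
      then show ?thesis using zw bD(2) by (simp add: T_def RG.m_assoc)
    qed
  next
    fix s l assume l: "l \<in> carrier RG" and sl: "\<forall>n. s n \<in> T \<and> l \<ominus>\<^bsub>RG\<^esub> s n \<in> adic n"
    have sc: "s n \<in> carrier RG" "s n \<otimes>\<^bsub>RG\<^esub> b = s n"
      "\<And>u. u \<in> D \<Longrightarrow> \<delta> u \<otimes>\<^bsub>RG\<^esub> s n = s n \<otimes>\<^bsub>RG\<^esub> \<delta> u" for n
      using sl by (auto simp: T_def)
    have "l \<otimes>\<^bsub>RG\<^esub> b = l"
    proof (rule adic_eqI[of _ _ s])
      fix n
      have "l \<otimes>\<^bsub>RG\<^esub> b \<ominus>\<^bsub>RG\<^esub> s n = (l \<ominus>\<^bsub>RG\<^esub> s n) \<otimes>\<^bsub>RG\<^esub> b"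
        using l bD(2) sc by (simp add: RG.minus_eq RG.l_distr RG.l_minus)
      then show "l \<otimes>\<^bsub>RG\<^esub> b \<ominus>\<^bsub>RG\<^esub> s n \<in> adic n" using sl bD(2) by (simp add: adic_mult_r)
    qed (use l sc bD(2) sl in auto)
    moreover have "\<delta> u \<otimes>\<^bsub>RG\<^esub> l = l \<otimes>\<^bsub>RG\<^esub> \<delta> u" if u: "u \<in> D" for u
    proof (rule adic_eqI[of _ _ "\<lambda>n. s n \<otimes>\<^bsub>RG\<^esub> \<delta> u"])
      fix n
      have "\<delta> u \<otimes>\<^bsub>RG\<^esub> l \<ominus>\<^bsub>RG\<^esub> s n \<otimes>\<^bsub>RG\<^esub> \<delta> u = \<delta> u \<otimes>\<^bsub>RG\<^esub> (l \<ominus>\<^bsub>RG\<^esub> s n)"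
        "l \<otimes>\<^bsub>RG\<^esub> \<delta> u \<ominus>\<^bsub>RG\<^esub> s n \<otimes>\<^bsub>RG\<^esub> \<delta> u = (l \<ominus>\<^bsub>RG\<^esub> s n) \<otimes>\<^bsub>RG\<^esub> \<delta> u"
        using l dc sc u
        by (simp_all add: RG.minus_eq RG.l_distr RG.r_distr RG.l_minus RG.r_minus)
      then show "\<delta> u \<otimes>\<^bsub>RG\<^esub> l \<ominus>\<^bsub>RG\<^esub> s n \<otimes>\<^bsub>RG\<^esub> \<delta> u \<in> adic n"
        "l \<otimes>\<^bsub>RG\<^esub> \<delta> u \<ominus>\<^bsub>RG\<^esub> s n \<otimes>\<^bsub>RG\<^esub> \<delta> u \<in> adic n"
        using dc sl by (simp_all add: adic_mult_l adic_mult_r)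
    qed (use l sc dc in auto)
    ultimately show "l \<in> T" using l by (simp add: T_def)
  qed
  have "primitive_idempotent kG T' (red i)"
  proof (rule primitive_idempotent_red[OF closed prim])
    show "T' \<subseteq> carrier kG" by (auto simp: T'_def)
    have ic: "i \<in> carrier RG" and ib: "i \<otimes>\<^bsub>RG\<^esub> b = i"
      and iu: "\<And>u. u \<in> D \<Longrightarrow> \<delta> u \<otimes>\<^bsub>RG\<^esub> i = i \<otimes>\<^bsub>RG\<^esub> \<delta> u"
      using iT by (auto simp: T_def)
    have "group_element \<kappa> G u \<otimes>\<^bsub>kG\<^esub> red i = red i \<otimes>\<^bsub>kG\<^esub> group_element \<kappa> G u" if u: "u \<in> D" for u
      using red_mult[OF dc ic, of u] red_mult[OF ic dc, of u] iu[OF u] red_delta[of u] u D by auto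
    moreover have "red i \<otimes>\<^bsub>kG\<^esub> red b = red i"
      using red_mult[OF ic bD(2)] ib by simp
    ultimately show "red i \<in> T'" using ic by (simp add: T'_def red_closed)
  next
    fix x assume x: "x \<in> T'"
    then have xc: "x \<in> carrier kG" by (simp add: T'_def)
    \<comment> \<open>The coefficientwise lift commutes with \<open>D\<close> but may leave the
      block. Multiplication by \<open>b\<close> brings it back, keeps the commutation because
      \<open>b\<close> is central, and is invisible after reduction because \<open>x\<close> already
      lies in the block of \<open>red b\<close>.\<close>
    define a where "a = lift_coeffs x \<otimes>\<^bsub>RG\<^esub> b"
    have lc: "lift_coeffs x \<in> carrier RG" using xc by (rule lift_coeffs_closed)
    have "red a = x"
      using x xc lc bD(2) by (simp add: a_def red_lift_coeffs T'_def)
    moreover have "a \<in> T"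
    proof -
      have "\<delta> u \<otimes>\<^bsub>RG\<^esub> a = a \<otimes>\<^bsub>RG\<^esub> \<delta> u" if u: "u \<in> D" for u
      proof -
        have "\<delta> u \<otimes>\<^bsub>RG\<^esub> lift_coeffs x = lift_coeffs x \<otimes>\<^bsub>RG\<^esub> \<delta> u"
          by (rule lift_coeffs_commute) (use x u D in \<open>auto simp: T'_def\<close>)
        then have "\<delta> u \<otimes>\<^bsub>RG\<^esub> a = lift_coeffs x \<otimes>\<^bsub>RG\<^esub> (\<delta> u \<otimes>\<^bsub>RG\<^esub> b)"
          using lc dc bD(2) by (simp add: a_def RG.m_assoc[symmetric])
        also have "\<delta> u \<otimes>\<^bsub>RG\<^esub> b = b \<otimes>\<^bsub>RG\<^esub> \<delta> u" using ring_centerD(2)[OF bD(1) dc] by simp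
        finally show ?thesis using lc dc bD(2) by (simp add: a_def RG.m_assoc)
      qed
      then show ?thesis using lc bD by (simp add: T_def a_def RG.m_assoc)
    qed
    ultimately show "\<exists>a\<in>T. red a = x" by blast
  qed
  moreover have "brauer_map \<kappa> G D (red i) \<noteq> \<zero>\<^bsub>brauer_target \<kappa> G D\<^esub>"
    using i iT by (simp add: source_idempotent_def brauer_map_red_eq_zero_iff T_def)
  ultimately show ?thesis by (simp add: source_idempotent_def T'_eq)
qed

end

section \<open>Lifting bases\<close>

lemma (in module) lincomb_image:
  assumes "inj_on f B" "f \<in> B \<rightarrow> carrier M" "a \<in> f ` B \<rightarrow> carrier R"
  shows "lincomb a (f ` B) = (\<Oplus>\<^bsub>M\<^esub>x\<in>B. a (f x) \<odot>\<^bsub>M\<^esub> f x)"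
  unfolding lincomb_def
  by (rule M.add.finprod_reindex) (use assms in auto)

lemma (in module) smult_sum_add:
  assumes "finite B" "\<And>x. x \<in> B \<Longrightarrow> f x \<in> carrier M" "r \<in> carrier R"
    and "\<And>x. x \<in> B \<Longrightarrow> c x \<in> carrier R" "\<And>x. x \<in> B \<Longrightarrow> d x \<in> carrier R"
  shows "(\<Oplus>\<^bsub>M\<^esub>x\<in>B. (c x \<oplus> r \<otimes> d x) \<odot>\<^bsub>M\<^esub> f x) =
    (\<Oplus>\<^bsub>M\<^esub>x\<in>B. c x \<odot>\<^bsub>M\<^esub> f x) \<oplus>\<^bsub>M\<^esub> r \<odot>\<^bsub>M\<^esub> (\<Oplus>\<^bsub>M\<^esub>x\<in>B. d x \<odot>\<^bsub>M\<^esub> f x)"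
proof -
  have "(\<Oplus>\<^bsub>M\<^esub>x\<in>B. (c x \<oplus> r \<otimes> d x) \<odot>\<^bsub>M\<^esub> f x) =
      (\<Oplus>\<^bsub>M\<^esub>x\<in>B. c x \<odot>\<^bsub>M\<^esub> f x \<oplus>\<^bsub>M\<^esub> r \<odot>\<^bsub>M\<^esub> (d x \<odot>\<^bsub>M\<^esub> f x))"
    by (rule M.finsum_cong') (use assms in \<open>auto simp: smult_l_distr smult_assoc1\<close>)
  also have "\<dots> = (\<Oplus>\<^bsub>M\<^esub>x\<in>B. c x \<odot>\<^bsub>M\<^esub> f x) \<oplus>\<^bsub>M\<^esub> (\<Oplus>\<^bsub>M\<^esub>x\<in>B. r \<odot>\<^bsub>M\<^esub> (d x \<odot>\<^bsub>M\<^esub> f x))"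
    by (rule M.finsum_addf) (use assms in auto)
  also have "(\<Oplus>\<^bsub>M\<^esub>x\<in>B. r \<odot>\<^bsub>M\<^esub> (d x \<odot>\<^bsub>M\<^esub> f x)) = r \<odot>\<^bsub>M\<^esub> (\<Oplus>\<^bsub>M\<^esub>x\<in>B. d x \<odot>\<^bsub>M\<^esub> f x)"
    using assms by (intro finsum_smult_ldistr[symmetric]) auto
  finally show ?thesis .
qed

text \<open>If \<open>R\<close> is a field then \<open>\<pi> = 0\<close>, which is why \<open>\<pi>\<^sup>n\<close> may vanish in the axiom on torsion.\<close>

locale residue_reduction = complete_local_pid R + M: module R M + N: module "residue_field R" N
  for R :: "('a, 'r) ring_scheme" (structure) and M :: "('a, 'b, 'c) module_scheme"
    and N :: "('a set, 'd, 'e) module_scheme" +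
  fixes \<rho> :: "'b \<Rightarrow> 'd"
  assumes \<rho>_closed: "x \<in> carrier M \<Longrightarrow> \<rho> x \<in> carrier N"
    and \<rho>_add: "\<lbrakk>x \<in> carrier M; y \<in> carrier M\<rbrakk> \<Longrightarrow> \<rho> (x \<oplus>\<^bsub>M\<^esub> y) = \<rho> x \<oplus>\<^bsub>N\<^esub> \<rho> y"
    and \<rho>_smult: "\<lbrakk>r \<in> carrier R; x \<in> carrier M\<rbrakk> \<Longrightarrow> \<rho> (r \<odot>\<^bsub>M\<^esub> x) = res r \<odot>\<^bsub>N\<^esub> \<rho> x"
    and \<rho>_kernel: "\<lbrakk>x \<in> carrier M; \<rho> x = \<zero>\<^bsub>N\<^esub>\<rbrakk> \<Longrightarrow> \<exists>y\<in>carrier M. x = \<pi> \<odot>\<^bsub>M\<^esub> y"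
    and torsion_free: "\<lbrakk>x \<in> carrier M; \<pi> [^] (n::nat) \<odot>\<^bsub>M\<^esub> x = \<zero>\<^bsub>M\<^esub>\<rbrakk> \<Longrightarrow> \<pi> [^] n = \<zero> \<or> x = \<zero>\<^bsub>M\<^esub>"
    and separated_module:
      "\<lbrakk>x \<in> carrier M; \<And>n::nat. \<exists>y\<in>carrier M. x = \<pi> [^] n \<odot>\<^bsub>M\<^esub> y\<rbrakk> \<Longrightarrow> x = \<zero>\<^bsub>M\<^esub>"
begin

lemma \<rho>_zero: "\<rho> \<zero>\<^bsub>M\<^esub> = \<zero>\<^bsub>N\<^esub>"
proof -
  have "\<rho> \<zero>\<^bsub>M\<^esub> \<oplus>\<^bsub>N\<^esub> \<rho> \<zero>\<^bsub>M\<^esub> = \<rho> \<zero>\<^bsub>M\<^esub>"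
    using \<rho>_add[of "\<zero>\<^bsub>M\<^esub>" "\<zero>\<^bsub>M\<^esub>"] by simp
  then show ?thesis using \<rho>_closed[of "\<zero>\<^bsub>M\<^esub>"] by simp
qed

lemma \<rho>_smult_sum:
  assumes "finite B" "\<And>x. x \<in> B \<Longrightarrow> f x \<in> carrier M" "\<And>x. x \<in> B \<Longrightarrow> c x \<in> carrier R"
  shows "\<rho> (\<Oplus>\<^bsub>M\<^esub>x\<in>B. c x \<odot>\<^bsub>M\<^esub> f x) = (\<Oplus>\<^bsub>N\<^esub>x\<in>B. res (c x) \<odot>\<^bsub>N\<^esub> \<rho> (f x))"
  using assms
proof (induction B)
  case empty
  then show ?case by (simp add: \<rho>_zero)
next
  case (insert b B)
  have "\<rho> (\<Oplus>\<^bsub>M\<^esub>x\<in>insert b B. c x \<odot>\<^bsub>M\<^esub> f x) =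
      \<rho> (c b \<odot>\<^bsub>M\<^esub> f b \<oplus>\<^bsub>M\<^esub> (\<Oplus>\<^bsub>M\<^esub>x\<in>B. c x \<odot>\<^bsub>M\<^esub> f x))"
    using insert.hyps insert.prems by (subst M.finsum_insert) auto
  also have "\<dots> = res (c b) \<odot>\<^bsub>N\<^esub> \<rho> (f b) \<oplus>\<^bsub>N\<^esub> (\<Oplus>\<^bsub>N\<^esub>x\<in>B. res (c x) \<odot>\<^bsub>N\<^esub> \<rho> (f x))"
    using insert by (subst \<rho>_add) (auto simp: \<rho>_smult)
  also have "\<dots> = (\<Oplus>\<^bsub>N\<^esub>x\<in>insert b B. res (c x) \<odot>\<^bsub>N\<^esub> \<rho> (f x))"
    using insert.hyps insert.prems by (subst N.finsum_insert) (auto simp: \<rho>_closed)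
  finally show ?case .
qed

text \<open>Nakayama by successive approximation. Independence: a relation can be divided by
  \<open>\<pi>\<close> again and again, since its reduction is a relation among independent
  elements. Spanning: every element is a combination of the lifts up to a multiple of
  \<open>\<pi>\<close>, and iterating on the remainder gives coefficients that converge in
  \<open>R\<close>.\<close>

lemma lifted_basis:
  assumes fin: "finite B" and B: "is_module_basis \<kappa> N B"
    and \<tau>: "\<And>x. x \<in> B \<Longrightarrow> \<tau> x \<in> carrier M" "\<And>x. x \<in> B \<Longrightarrow> \<rho> (\<tau> x) = x"
  shows "is_module_basis R M (\<tau> ` B)"
proof -
  have BN: "B \<subseteq> carrier N" and indep: "\<not> N.lin_dep B" and span: "N.span B = carrier N"
    using B by (simp_all add: is_module_basis_def)
  have inj: "inj_on \<tau> B" using \<tau>(2) by (metis inj_onI)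
  define L where "L c = (\<Oplus>\<^bsub>M\<^esub>x\<in>B. c x \<odot>\<^bsub>M\<^esub> \<tau> x)" for c
  have L_closed: "L c \<in> carrier M" if "\<And>x. x \<in> B \<Longrightarrow> c x \<in> carrier R" for c
    using that \<tau>(1) by (auto simp: L_def intro!: M.finsum_closed)
  have \<rho>_L: "\<rho> (L c) = N.lincomb (\<lambda>x. res (c x)) B" if "\<And>x. x \<in> B \<Longrightarrow> c x \<in> carrier R" for c
  proof -
    have "\<rho> (L c) = (\<Oplus>\<^bsub>N\<^esub>x\<in>B. res (c x) \<odot>\<^bsub>N\<^esub> \<rho> (\<tau> x))"
      unfolding L_def using that \<tau>(1) by (intro \<rho>_smult_sum fin)
    also have "\<dots> = N.lincomb (\<lambda>x. res (c x)) B"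
      unfolding N.lincomb_def using that \<tau>(2) BN by (intro N.finsum_cong') auto
    finally show ?thesis .
  qed
  have pc: "\<pi> [^] n \<in> carrier R" for n :: nat using uniformizer(1) by simp

  have "M.lin_indpt (\<tau> ` B)"
  proof (rule M.finite_lin_indpt2)
    show "finite (\<tau> ` B)" "\<tau> ` B \<subseteq> carrier M" using fin \<tau>(1) by auto
  next
    fix a assume a: "a \<in> \<tau> ` B \<rightarrow> carrier R" and "M.lincomb a (\<tau> ` B) = \<zero>\<^bsub>M\<^esub>"
    then have La: "L (\<lambda>x. a (\<tau> x)) = \<zero>\<^bsub>M\<^esub>"
      using M.lincomb_image[OF inj _ a] \<tau>(1) by (simp add: L_def)
    have ac: "a (\<tau> x) \<in> carrier R" if "x \<in> B" for x using a that by blast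
    \<comment> \<open>If all coefficients of a relation are multiples of a power of
      \<open>\<pi>\<close>, cancelling the power leaves a relation whose reduction is trivial, which
      yields one more factor \<open>\<pi>\<close>. Separatedness of \<open>R\<close> then makes the
      coefficients vanish.\<close>
    have div: "\<exists>c. \<forall>x\<in>B. c x \<in> carrier R \<and> a (\<tau> x) = \<pi> [^] n \<otimes> c x" for n :: nat
    proof (induction n)
      case 0
      show ?case by (rule exI[of _ "\<lambda>x. a (\<tau> x)"]) (use ac in simp)
    next
      case (Suc n)
      then obtain c where c: "\<And>x. x \<in> B \<Longrightarrow> c x \<in> carrier R"
        "\<And>x. x \<in> B \<Longrightarrow> a (\<tau> x) = \<pi> [^] n \<otimes> c x" by blast
      show ?case
      \<comment> \<open>A vanishing power cannot be cancelled, but the coefficients, being its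
        multiples, are then already zero and the zero family is a witness.\<close>
      proof (cases "\<pi> [^] n = \<zero>")
        case True
        then show ?thesis
          using c uniformizer(1) by (intro exI[of _ "\<lambda>x. \<zero>"]) simp
      next
        case False
        have "\<pi> [^] n \<odot>\<^bsub>M\<^esub> L c = L (\<lambda>x. a (\<tau> x))"
          unfolding L_def using c pc \<tau>(1) fin
          by (subst M.finsum_smult_ldistr) (auto intro!: M.finsum_cong' simp: M.smult_assoc1)
        then have "L c = \<zero>\<^bsub>M\<^esub>"
          using La torsion_free[of "L c" n] L_closed[of c, OF c(1)] False by auto
        then have lc0: "N.lincomb (\<lambda>x. res (c x)) B = \<zero>\<^bsub>N\<^esub>"
          using \<rho>_L[of c] c(1) \<rho>_zero by simp
        have "res (c x) = \<zero>\<^bsub>\<kappa>\<^esub>" if "x \<in> B" for x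
        proof (rule ccontr)
          assume "res (c x) \<noteq> \<zero>\<^bsub>\<kappa>\<^esub>"
          then have "N.lin_dep B"
            using N.lin_dep_crit[OF fin subset_refl _ that _ lc0] c(1) by auto
          then show False using indep by contradiction
        qed
        then have "\<forall>x\<in>B. \<exists>y\<in>carrier R. c x = \<pi> \<otimes> y"
          using c(1) by (simp add: res_zero_iff_uniformizer)
        then obtain d where d: "\<And>x. x \<in> B \<Longrightarrow> d x \<in> carrier R" "\<And>x. x \<in> B \<Longrightarrow> c x = \<pi> \<otimes> d x"
          by metis
        show ?thesis
          by (rule exI[of _ d]) (use c d pc uniformizer(1) in \<open>simp add: m_assoc\<close>)
      qed
    qed
    have "a (\<tau> x) = \<zero>" if "x \<in> B" for x
      using ac that div by (intro limit_unique_zero) blast+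
    then show "\<forall>v\<in>\<tau> ` B. a v = \<zero>" by simp
  qed

  moreover have "m \<in> M.span (\<tau> ` B)" if m: "m \<in> carrier M" for m
  proof -
    \<comment> \<open>A single approximation: expand the reduction of \<open>y\<close> in
      \<open>B\<close>, lift the coefficients, and observe that the difference reduces to
      zero.\<close>
    have "\<exists>c m'. (\<forall>x\<in>B. c x \<in> carrier R) \<and> m' \<in> carrier M \<and> y = L c \<oplus>\<^bsub>M\<^esub> \<pi> \<odot>\<^bsub>M\<^esub> m'"
      if y: "y \<in> carrier M" for y
    proof -
      have "\<rho> y \<in> N.span B" using span \<rho>_closed[OF y] by simp
      then obtain a where a: "a \<in> B \<rightarrow> carrier \<kappa>" "N.lincomb a B = \<rho> y"
        using N.finite_in_span[OF fin BN] by blast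
      define c where "c x = inv_into (carrier R) res (a x)" for x
      have c: "c x \<in> carrier R" "res (c x) = a x" if "x \<in> B" for x
      proof -
        have "a x \<in> res ` carrier R" using a(1) that res_surj by auto
        then show "c x \<in> carrier R" "res (c x) = a x"
          by (simp_all add: c_def inv_into_into f_inv_into_f)
      qed
      have "\<rho> (L c) = N.lincomb (\<lambda>x. res (c x)) B" by (rule \<rho>_L) (rule c(1))
      also have "\<dots> = N.lincomb a B"
        unfolding N.lincomb_def using c a(1) BN by (intro N.finsum_cong') auto
      finally have "\<rho> (L c) = \<rho> y" using a(2) by simp
      moreover have "y = L c \<oplus>\<^bsub>M\<^esub> (y \<ominus>\<^bsub>M\<^esub> L c)"
        using y L_closed[of c, OF c(1)] by (simp add: M.minus_eq M.a_ac M.r_neg M.r_neg1 M.r_neg2)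
      moreover have dc: "y \<ominus>\<^bsub>M\<^esub> L c \<in> carrier M" using y L_closed[of c, OF c(1)] by simp
      ultimately have "\<rho> (y \<ominus>\<^bsub>M\<^esub> L c) = \<zero>\<^bsub>N\<^esub>"
        using \<rho>_add[of "L c" "y \<ominus>\<^bsub>M\<^esub> L c"] L_closed[of c, OF c(1)] \<rho>_closed y
        by (metis N.add.l_cancel_one')
      then obtain m' where "m' \<in> carrier M" "y \<ominus>\<^bsub>M\<^esub> L c = \<pi> \<odot>\<^bsub>M\<^esub> m'"
        using \<rho>_kernel[OF dc] by blast
      then show ?thesis using c(1) \<open>y = L c \<oplus>\<^bsub>M\<^esub> (y \<ominus>\<^bsub>M\<^esub> L c)\<close> by auto
    qed
    then obtain C Q where CQ: "\<And>y x. \<lbrakk>y \<in> carrier M; x \<in> B\<rbrakk> \<Longrightarrow> C y x \<in> carrier R"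
      "\<And>y. y \<in> carrier M \<Longrightarrow> Q y \<in> carrier M"
      "\<And>y. y \<in> carrier M \<Longrightarrow> y = L (C y) \<oplus>\<^bsub>M\<^esub> \<pi> \<odot>\<^bsub>M\<^esub> Q y"
      by metis
    \<comment> \<open>\<open>q n\<close> is the remainder after n approximations, and
      \<open>s n\<close> holds the coefficients collected up to then, truncated expansions in powers
      of \<open>\<pi>\<close>. The invariant linking them is \<open>approx\<close>.\<close>
    define q where "q n = (Q ^^ n) m" for n
    have qc: "q n \<in> carrier M" for n by (induction n) (simp_all add: q_def m CQ(2))
    have q_Suc: "q (Suc n) = Q (q n)" for n by (simp add: q_def)
    define s where "s = rec_nat (\<lambda>x. \<zero>) (\<lambda>n c x. c x \<oplus> \<pi> [^] n \<otimes> C (q n) x)"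
    have s_0: "s 0 = (\<lambda>x. \<zero>)" and s_Suc: "s (Suc n) = (\<lambda>x. s n x \<oplus> \<pi> [^] n \<otimes> C (q n) x)" for n
      by (simp_all add: s_def)
    have sc: "s n x \<in> carrier R" if "x \<in> B" for n x
      by (induction n) (use that CQ(1) qc pc in \<open>simp_all add: s_0 s_Suc\<close>)
    have approx: "m = L (s n) \<oplus>\<^bsub>M\<^esub> \<pi> [^] n \<odot>\<^bsub>M\<^esub> q n" for n
    proof (induction n)
      case 0
      have "L (s 0) = \<zero>\<^bsub>M\<^esub>"
        unfolding L_def s_0 using \<tau>(1) by (intro M.add.finprod_one_eqI) simp
      then show ?case using m by (simp add: q_def)
    next
      case (Suc n)
      have "L (s n) \<oplus>\<^bsub>M\<^esub> \<pi> [^] n \<odot>\<^bsub>M\<^esub> q n =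
          L (s n) \<oplus>\<^bsub>M\<^esub> (\<pi> [^] n \<odot>\<^bsub>M\<^esub> L (C (q n)) \<oplus>\<^bsub>M\<^esub> \<pi> [^] Suc n \<odot>\<^bsub>M\<^esub> q (Suc n))"
        using CQ(3)[OF qc] L_closed[of "C (q n)", OF CQ(1)[OF qc]] qc pc uniformizer(1)
        by (simp add: q_Suc CQ(2) M.smult_assoc1 M.smult_r_distr[symmetric])
      also have "\<dots> = (L (s n) \<oplus>\<^bsub>M\<^esub> \<pi> [^] n \<odot>\<^bsub>M\<^esub> L (C (q n))) \<oplus>\<^bsub>M\<^esub> \<pi> [^] Suc n \<odot>\<^bsub>M\<^esub> q (Suc n)"
        using L_closed[of "C (q n)", OF CQ(1)[OF qc]] L_closed[of "s n", OF sc] qc pc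
        uniformizer(1) by (simp add: M.a_assoc)
      also have "L (s n) \<oplus>\<^bsub>M\<^esub> \<pi> [^] n \<odot>\<^bsub>M\<^esub> L (C (q n)) = L (s (Suc n))"
        unfolding L_def s_Suc by (rule M.smult_sum_add[symmetric]) (use fin \<tau>(1) pc sc CQ(1) qc in auto)
      finally show ?case using Suc by simp
    qed
    have "\<exists>l\<in>carrier R. \<forall>n. l \<ominus> s n x \<in> radical_power R n" if x: "x \<in> B" for x
    proof (rule complete)
      fix n
      have "s (Suc n) x \<ominus> s n x = \<pi> [^] n \<otimes> C (q n) x"
        unfolding s_Suc using sc[OF x, of n] CQ(1)[OF qc x, of n] pc[of n]
        by (simp add: minus_eq a_ac r_neg r_neg1 r_neg2)
      then show "s (Suc n) x \<ominus> s n x \<in> radical_power R n"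
        using CQ(1)[OF qc x] by (auto simp: radical_power_iff)
    qed (use sc x in auto)
    then obtain l where l: "\<And>x. x \<in> B \<Longrightarrow> l x \<in> carrier R"
      "\<And>x n. x \<in> B \<Longrightarrow> l x \<ominus> s n x \<in> radical_power R n" by metis
    \<comment> \<open>Replacing \<open>s n\<close> by its limit alters each coefficient by a
      multiple of the n-th power of \<open>\<pi>\<close>, and the remainder term is such a multiple
      too; so their difference is, for every n.\<close>
    have "\<exists>y\<in>carrier M. m \<ominus>\<^bsub>M\<^esub> L l = \<pi> [^] n \<odot>\<^bsub>M\<^esub> y" for n :: nat
    proof -
      have "\<forall>x\<in>B. \<exists>y\<in>carrier R. l x \<ominus> s n x = \<pi> [^] n \<otimes> y"
        using l(2) by (simp add: radical_power_iff)
      then obtain t where t: "\<And>x. x \<in> B \<Longrightarrow> t x \<in> carrier R"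
        "\<And>x. x \<in> B \<Longrightarrow> l x \<ominus> s n x = \<pi> [^] n \<otimes> t x" by metis
      have lx: "l x = s n x \<oplus> \<pi> [^] n \<otimes> t x" if "x \<in> B" for x
        unfolding t(2)[OF that, symmetric] using l(1)[OF that] sc[OF that, of n]
        by (simp add: minus_eq a_ac r_neg r_neg1 r_neg2)
      have "L l = (\<Oplus>\<^bsub>M\<^esub>x\<in>B. (s n x \<oplus> \<pi> [^] n \<otimes> t x) \<odot>\<^bsub>M\<^esub> \<tau> x)"
        unfolding L_def by (rule M.finsum_cong') (use lx l(1) \<tau>(1) sc t(1) pc in auto)
      also have "\<dots> = L (s n) \<oplus>\<^bsub>M\<^esub> \<pi> [^] n \<odot>\<^bsub>M\<^esub> L t"
        unfolding L_def by (rule M.smult_sum_add) (use fin \<tau>(1) pc sc t(1) in auto)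
      finally have Ll: "L l = L (s n) \<oplus>\<^bsub>M\<^esub> \<pi> [^] n \<odot>\<^bsub>M\<^esub> L t" .
      have cl: "L (s n) \<in> carrier M" "L t \<in> carrier M" "q n \<in> carrier M"
        using L_closed sc t(1) qc by auto
      have "m \<ominus>\<^bsub>M\<^esub> L l = \<pi> [^] n \<odot>\<^bsub>M\<^esub> q n \<ominus>\<^bsub>M\<^esub> \<pi> [^] n \<odot>\<^bsub>M\<^esub> L t"
        unfolding Ll approx[of n] using cl pc[of n]
        by (simp add: M.minus_eq M.minus_add M.a_ac M.r_neg M.r_neg1 M.r_neg2)
      also have "\<dots> = \<pi> [^] n \<odot>\<^bsub>M\<^esub> (q n \<ominus>\<^bsub>M\<^esub> L t)"
        using cl pc[of n] by (simp add: M.minus_eq M.smult_r_distr M.smult_r_minus)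
      finally show ?thesis using cl by auto
    qed
    then have "m \<ominus>\<^bsub>M\<^esub> L l = \<zero>\<^bsub>M\<^esub>"
      using separated_module[of "m \<ominus>\<^bsub>M\<^esub> L l"] m L_closed[of l, OF l(1)] by auto
    then have "m = L l" using m L_closed[of l, OF l(1)] by simp
    \<comment> \<open>On the lifted set \<open>\<rho>\<close> inverts \<open>\<tau>\<close>, which
      turns coefficients indexed by \<open>B\<close> into coefficients indexed by the lifts.\<close>
    also have "\<dots> = M.lincomb (\<lambda>y. l (\<rho> y)) (\<tau> ` B)"
      unfolding L_def using l(1) \<tau>
      by (subst M.lincomb_image[OF inj]) (auto intro!: M.finsum_cong')
    also have "\<dots> \<in> M.span (\<tau> ` B)"
      unfolding M.span_def
      by (rule CollectI, rule exI, rule exI, rule conjI[OF refl]) (use fin l(1) \<tau>(2) in auto)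
    finally show ?thesis .
  qed
  ultimately show ?thesis
    using \<tau>(1) M.span_is_subset2[of "\<tau> ` B"] unfolding is_module_basis_def by blast
qed

end

section \<open>Source algebras and their reductions\<close>

text \<open>The unit \<open>a c\<close> provides a right inverse of \<open>a\<close>, the unit
  \<open>c a\<close> a left inverse, and the two agree. Lifts of mutually inverse elements multiply
  only to units and not to the identity, which is the situation met later.\<close>

lemma (in Group.monoid) Units_of_products:
  assumes "a \<in> carrier G" "c \<in> carrier G" "a \<otimes> c \<in> Units G" "c \<otimes> a \<in> Units G"
  shows "a \<in> Units G"
proof -
  define r where "r = c \<otimes> inv (a \<otimes> c)"
  define l where "l = inv (c \<otimes> a) \<otimes> c"
  have cl: "r \<in> carrier G" "l \<in> carrier G" using assms by (simp_all add: r_def l_def)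
  have ar: "a \<otimes> r = \<one>" using assms by (simp add: r_def m_assoc[symmetric])
  have la: "l \<otimes> a = \<one>" using assms by (simp add: l_def m_assoc)
  have "l = l \<otimes> (a \<otimes> r)" using cl ar by simp
  also have "\<dots> = r" using cl la assms(1) by (simp add: m_assoc[symmetric])
  finally have "l = r" .
  then show ?thesis using assms(1) cl ar la unfolding Units_def by blast
qed

text \<open>Demands only an idempotent, so that one development serves \<open>i\<close> over
  \<open>R\<close> and \<open>red i\<close> over the residue field.\<close>

locale corner_algebra = finite_group_algebra R G
  for R :: "('a, 'r) ring_scheme" (structure) and G :: "('g, 'm) monoid_scheme" +
  fixes i :: "'g \<Rightarrow> 'a"
  assumes i_closed: "i \<in> carrier RG" and i_idem: "i \<otimes>\<^bsub>RG\<^esub> i = i"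
begin

abbreviation "A \<equiv> source_algebra R G i"

lemma A_simps [simp]:
  "mult A = mult RG" "one A = i" "zero A = zero RG" "add A = add RG" "smult A = smult RG"
  "structure_map A u = \<delta> u \<otimes>\<^bsub>RG\<^esub> i"
  by (simp_all add: source_algebra_def Let_def)

lemma corner_closed: "a \<in> carrier RG \<Longrightarrow> i \<otimes>\<^bsub>RG\<^esub> a \<otimes>\<^bsub>RG\<^esub> i \<in> carrier A"
  by (auto simp: source_algebra_def Let_def)

lemma A_iff: "x \<in> carrier A \<longleftrightarrow> x \<in> carrier RG \<and> i \<otimes>\<^bsub>RG\<^esub> x = x \<and> x \<otimes>\<^bsub>RG\<^esub> i = x"
proof
  assume "x \<in> carrier A"
  then obtain a where a: "a \<in> carrier RG" "x = i \<otimes>\<^bsub>RG\<^esub> a \<otimes>\<^bsub>RG\<^esub> i"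
    by (auto simp: source_algebra_def Let_def)
  have "i \<otimes>\<^bsub>RG\<^esub> x = i \<otimes>\<^bsub>RG\<^esub> i \<otimes>\<^bsub>RG\<^esub> a \<otimes>\<^bsub>RG\<^esub> i" "x \<otimes>\<^bsub>RG\<^esub> i = i \<otimes>\<^bsub>RG\<^esub> a \<otimes>\<^bsub>RG\<^esub> (i \<otimes>\<^bsub>RG\<^esub> i)"
    using a i_closed by (simp_all add: RG.m_assoc)
  then show "x \<in> carrier RG \<and> i \<otimes>\<^bsub>RG\<^esub> x = x \<and> x \<otimes>\<^bsub>RG\<^esub> i = x"
    using a i_closed by (simp add: i_idem)
next
  assume "x \<in> carrier RG \<and> i \<otimes>\<^bsub>RG\<^esub> x = x \<and> x \<otimes>\<^bsub>RG\<^esub> i = x"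
  then show "x \<in> carrier A" using corner_closed[of x] by simp
qed

lemma A_closed: "x \<in> carrier A \<Longrightarrow> x \<in> carrier RG"
  by (simp add: A_iff)

lemma A_zero_closed: "\<zero>\<^bsub>RG\<^esub> \<in> carrier A" and A_one_closed: "i \<in> carrier A"
  using i_closed by (simp_all add: A_iff i_idem)

lemma A_add_closed: "\<lbrakk>x \<in> carrier A; y \<in> carrier A\<rbrakk> \<Longrightarrow> x \<oplus>\<^bsub>RG\<^esub> y \<in> carrier A"
  using i_closed by (simp add: A_iff RG.l_distr RG.r_distr)

lemma A_uminus_closed: "x \<in> carrier A \<Longrightarrow> \<ominus>\<^bsub>RG\<^esub> x \<in> carrier A"
  using i_closed by (simp add: A_iff RG.l_minus RG.r_minus)

lemma A_minus_closed: "\<lbrakk>x \<in> carrier A; y \<in> carrier A\<rbrakk> \<Longrightarrow> x \<ominus>\<^bsub>RG\<^esub> y \<in> carrier A"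
  by (simp add: RG.minus_eq A_add_closed A_uminus_closed)

lemma A_mult_closed:
  assumes "x \<in> carrier A" "y \<in> carrier A" shows "x \<otimes>\<^bsub>RG\<^esub> y \<in> carrier A"
proof -
  have "i \<otimes>\<^bsub>RG\<^esub> (x \<otimes>\<^bsub>RG\<^esub> y) = i \<otimes>\<^bsub>RG\<^esub> x \<otimes>\<^bsub>RG\<^esub> y" "x \<otimes>\<^bsub>RG\<^esub> y \<otimes>\<^bsub>RG\<^esub> i = x \<otimes>\<^bsub>RG\<^esub> (y \<otimes>\<^bsub>RG\<^esub> i)"
    using assms i_closed by (simp_all add: A_closed RG.m_assoc)
  then show ?thesis using assms by (simp add: A_iff)
qed

lemma A_smult_closed: "\<lbrakk>r \<in> carrier R; x \<in> carrier A\<rbrakk> \<Longrightarrow> r \<odot>\<^bsub>RG\<^esub> x \<in> carrier A"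
  using i_closed by (simp add: A_iff ga_smult_mult_l ga_smult_mult_r)

lemma delta_i_closed:
  assumes "\<delta> u \<otimes>\<^bsub>RG\<^esub> i = i \<otimes>\<^bsub>RG\<^esub> \<delta> u" shows "\<delta> u \<otimes>\<^bsub>RG\<^esub> i \<in> carrier A"
proof -
  have "i \<otimes>\<^bsub>RG\<^esub> (\<delta> u \<otimes>\<^bsub>RG\<^esub> i) = i \<otimes>\<^bsub>RG\<^esub> \<delta> u \<otimes>\<^bsub>RG\<^esub> i" "\<delta> u \<otimes>\<^bsub>RG\<^esub> i \<otimes>\<^bsub>RG\<^esub> i = \<delta> u \<otimes>\<^bsub>RG\<^esub> (i \<otimes>\<^bsub>RG\<^esub> i)"
    using i_closed delta_closed by (simp_all add: RG.m_assoc)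
  then show ?thesis
    using i_closed delta_closed[of u] by (simp add: A_iff i_idem assms[symmetric])
qed

lemma A_abelian_group: "abelian_group A"
proof (rule abelian_groupI)
  fix x assume x: "x \<in> carrier A"
  show "\<exists>y\<in>carrier A. y \<oplus>\<^bsub>A\<^esub> x = \<zero>\<^bsub>A\<^esub>"
    by (rule bexI[OF _ A_uminus_closed[OF x]]) (simp add: A_closed[OF x] RG.l_neg)
next
  fix x y assume "x \<in> carrier A" "y \<in> carrier A"
  then show "x \<oplus>\<^bsub>A\<^esub> y = y \<oplus>\<^bsub>A\<^esub> x" by (simp add: A_closed RG.a_comm)
qed (simp_all add: A_zero_closed A_add_closed A_closed RG.a_assoc)

lemma A_ring: "ring A"
proof (rule ringI)
  show "Group.monoid A"
  proof (rule monoidI)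
    fix x assume "x \<in> carrier A"
    then show "\<one>\<^bsub>A\<^esub> \<otimes>\<^bsub>A\<^esub> x = x" "x \<otimes>\<^bsub>A\<^esub> \<one>\<^bsub>A\<^esub> = x" by (simp_all add: A_iff)
  qed (simp_all add: A_mult_closed A_one_closed A_closed RG.m_assoc)
qed (simp_all add: A_abelian_group A_closed RG.l_distr RG.r_distr)

lemma A_module: "module R A"
  by (rule moduleI) (simp_all add: is_cring A_abelian_group A_smult_closed A_closed
      RG.smult_l_distr RG.smult_r_distr RG.smult_assoc1)

end

section \<open>The source algebra modulo the radical\<close>

locale reduced_corner_algebra =
  complete_group_algebra R G + corner_algebra R G i
  for R :: "('a, 'r) ring_scheme" (structure) and G :: "('g, 'm) monoid_scheme"
    and i :: "'g \<Rightarrow> 'a"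
begin

sublocale K: corner_algebra "residue_field R" G "reduce_coeffs R G i"
  by unfold_locales (use i_closed i_idem red_mult[of i i] in \<open>simp_all add: red_closed\<close>)

abbreviation "S \<equiv> source_algebra \<kappa> G (red i)"
abbreviation "I \<equiv> radical_submodule R A"
abbreviation "Abar \<equiv> reduced_algebra R A"

definition proj :: "('g \<Rightarrow> 'a) \<Rightarrow> ('g \<Rightarrow> 'a) set" where
  "proj x = I +>\<^bsub>A\<^esub> x"

text \<open>\<open>red\<close> is constant on the cosets of \<open>I\<close>, which turns out to be
  its kernel on \<open>A\<close>, so the image of a coset has exactly one element.\<close>

definition quot_iso :: "('g \<Rightarrow> 'a) set \<Rightarrow> 'g \<Rightarrow> 'a set" where
  "quot_iso C = the_elem (red ` C)"

lemma red_A_closed: "x \<in> carrier A \<Longrightarrow> red x \<in> carrier S"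
  using i_closed red_mult[of i x] red_mult[of x i] by (simp add: A_iff K.A_iff red_closed)

lemma red_A_hom: "ring_hom_ring A S red"
  by (rule ring_hom_ringI) (simp_all add: A_ring K.A_ring red_A_closed red_mult red_add A_closed)

lemma lift_corner:
  assumes "c \<in> carrier S"
  shows "i \<otimes>\<^bsub>RG\<^esub> lift_coeffs c \<otimes>\<^bsub>RG\<^esub> i \<in> carrier A"
    and "red (i \<otimes>\<^bsub>RG\<^esub> lift_coeffs c \<otimes>\<^bsub>RG\<^esub> i) = c"
  using assms i_closed lift_coeffs_closed[of c]
  by (simp_all add: corner_closed K.A_iff red_mult red_lift_coeffs)

lemma red_A_surj: "red ` carrier A = carrier S"
  using red_A_closed lift_corner by (metis (full_types) image_eqI image_subsetI subsetI subset_antisym)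

text \<open>Compression by \<open>i\<close> fixes \<open>x\<close> and carries the quotient into the
  corner: the filtration induced on \<open>A\<close> from \<open>RG\<close> is its own
  filtration.\<close>

lemma A_adic_divisible:
  assumes x: "x \<in> carrier A" and x0: "x \<in> adic n"
  shows "\<exists>y\<in>carrier A. x = \<pi> [^] n \<odot>\<^bsub>RG\<^esub> y"
proof -
  obtain z where z: "z \<in> carrier RG" "x = \<pi> [^] n \<odot>\<^bsub>RG\<^esub> z"
    using x0 by (auto simp: adic_def)
  have "x = i \<otimes>\<^bsub>RG\<^esub> x \<otimes>\<^bsub>RG\<^esub> i" using x by (simp add: A_iff)
  also have "\<dots> = \<pi> [^] n \<odot>\<^bsub>RG\<^esub> (i \<otimes>\<^bsub>RG\<^esub> z \<otimes>\<^bsub>RG\<^esub> i)"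
    using z i_closed uniformizer(1) by (simp add: ga_smult_mult_l ga_smult_mult_r)
  finally show ?thesis using corner_closed[OF z(1)] by blast
qed

text \<open>Reduction kills \<open>J A\<close>. Conversely an element of the corner with all
  coefficients in \<open>J\<close> is \<open>\<pi>\<close> times an element of the same corner. This
  is what identifies the quotient with the corner of \<open>kG\<close>.\<close>

lemma radical_submodule_eq: "I = a_kernel A S red"
proof -
  have ker: "x \<in> a_kernel A S red \<longleftrightarrow> x \<in> carrier A \<and> x \<in> adic 1" for x
    using red_zero_iff[OF A_closed, of x] unfolding a_kernel_def' by auto
  have sub: "subgroup (a_kernel A S red) (add_monoid A)"
    by (rule additive_subgroup.a_subgroup[OF ideal.axioms(1)
          [OF ring_hom_ring.kernel_is_ideal[OF red_A_hom]]])
  show ?thesis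
  proof
    show "I \<subseteq> a_kernel A S red"
      unfolding radical_submodule_def
    proof (rule group.generate_subgroup_incl[OF abelian_group.a_group[OF A_abelian_group] _ sub],
        rule subsetI)
      fix x assume "x \<in> {r \<odot>\<^bsub>A\<^esub> a | r a. r \<in> J \<and> a \<in> carrier A}"
      then obtain r a where ra: "r \<in> J" "a \<in> carrier A" "x = r \<odot>\<^bsub>RG\<^esub> a" by auto
      have rc: "r \<in> carrier R" using ra(1) J.Icarr by blast
      have "red x = \<zero>\<^bsub>kG\<^esub>"
        using ra rc res_zero_iff[of r] by (simp add: red_smult A_closed red_closed)
      moreover have "x \<in> carrier A" unfolding ra(3) by (rule A_smult_closed[OF rc ra(2)])
      ultimately show "x \<in> a_kernel A S red" unfolding a_kernel_def' by simp
    qed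
    show "a_kernel A S red \<subseteq> I"
    proof
      fix x assume "x \<in> a_kernel A S red"
      then obtain y where y: "y \<in> carrier A" "x = \<pi> [^] (1::nat) \<odot>\<^bsub>RG\<^esub> y"
        using ker A_adic_divisible[of x 1] by blast
      have "\<pi> \<in> J" using uniformizer cgenideal_self by simp
      moreover have "x = \<pi> \<odot>\<^bsub>A\<^esub> y" using y(2) uniformizer(1) by simp
      ultimately show "x \<in> I"
        unfolding radical_submodule_def using y(1) by (intro generate.incl) blast
    qed
  qed
qed

lemma red_quot_iso: "x \<in> carrier A \<Longrightarrow> quot_iso (proj x) = red x"
  unfolding quot_iso_def proj_def radical_submodule_eq
  by (rule ring_hom_ring.the_elem_simp[OF red_A_hom])

lemma I_ideal: "ideal I A"
  unfolding radical_submodule_eq by (rule ring_hom_ring.kernel_is_ideal[OF red_A_hom])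

lemma Abar_simps [simp]:
  "carrier Abar = carrier (A Quot I)" "mult Abar = mult (A Quot I)" "one Abar = one (A Quot I)"
  "zero Abar = zero (A Quot I)" "add Abar = add (A Quot I)"
  "structure_map Abar u = proj (\<delta> u \<otimes>\<^bsub>RG\<^esub> i)"
  by (simp_all add: reduced_algebra_def Let_def proj_def)

lemma proj_hom: "proj \<in> ring_hom A (A Quot I)"
  using ideal.rcos_ring_hom[OF I_ideal] unfolding proj_def[abs_def] .

lemma proj_closed: "x \<in> carrier A \<Longrightarrow> proj x \<in> carrier (A Quot I)"
  and proj_mult: "\<lbrakk>x \<in> carrier A; y \<in> carrier A\<rbrakk> \<Longrightarrow> proj (x \<otimes>\<^bsub>RG\<^esub> y) = proj x \<otimes>\<^bsub>A Quot I\<^esub> proj y"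
  and proj_add: "\<lbrakk>x \<in> carrier A; y \<in> carrier A\<rbrakk> \<Longrightarrow> proj (x \<oplus>\<^bsub>RG\<^esub> y) = proj x \<oplus>\<^bsub>A Quot I\<^esub> proj y"
  and proj_one: "proj i = \<one>\<^bsub>A Quot I\<^esub>"
  using ring_hom_memE[OF proj_hom] by simp_all

lemma Abar_carrierE:
  assumes "C \<in> carrier (A Quot I)" obtains x where "x \<in> carrier A" "C = proj x"
  using assms by (auto simp: FactRing_def A_RCOSETS_def' proj_def)

lemma quot_iso_ring_iso: "quot_iso \<in> ring_iso (A Quot I) S"
  using ring_hom_ring.FactRing_iso_set[OF red_A_hom red_A_surj]
  unfolding quot_iso_def[abs_def] radical_submodule_eq .

lemma proj_eq_iff:
  assumes "x \<in> carrier A" "y \<in> carrier A"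
  shows "proj x = proj y \<longleftrightarrow> red x = red y"
proof -
  have "inj_on quot_iso (carrier (A Quot I))" using quot_iso_ring_iso by (simp add: ring_iso_def bij_betw_def)
  then show ?thesis
    using assms by (metis inj_onD proj_closed red_quot_iso)
qed

text \<open>Scalar multiplication on the quotient is a union over all representatives of scalar and
  vector. All of them give the same coset, and the union of a nonempty constant family is that
  coset.\<close>

lemma proj_smult:
  assumes r: "r \<in> carrier R" and x: "x \<in> carrier A"
  shows "res r \<odot>\<^bsub>Abar\<^esub> proj x = proj (r \<odot>\<^bsub>RG\<^esub> x)"
proof -
  interpret A: ring A by (rule A_ring)
  interpret I: ideal I A by (rule I_ideal)
  have eq: "proj (s \<odot>\<^bsub>RG\<^esub> y) = proj (r \<odot>\<^bsub>RG\<^esub> x)" if s: "s \<in> res r" and y: "y \<in> proj x" for s y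
  proof -
    obtain j where j: "j \<in> J" "s = j \<oplus> r"
      using s by (auto simp: residue_map_def a_r_coset_def')
    have jc: "j \<in> carrier R" using j J.Icarr by blast
    have sc: "s \<in> carrier R" "res s = res r"
      using j jc r res_zero_iff[OF jc] by simp_all
    obtain t where t: "t \<in> I" "y = t \<oplus>\<^bsub>RG\<^esub> x"
      using y by (auto simp: proj_def a_r_coset_def')
    have tc: "t \<in> carrier A" "red t = \<zero>\<^bsub>kG\<^esub>"
      using t(1) unfolding radical_submodule_eq a_kernel_def' by simp_all
    have yc: "y \<in> carrier A" "red y = red x"
      using t tc x by (simp_all add: A_add_closed A_closed red_add red_closed)
    show ?thesis
      using sc yc r x by (simp add: proj_eq_iff A_smult_closed red_smult A_closed)
  qed
  have ne: "res r \<noteq> {}" "proj x \<noteq> {}"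
    using J.a_rcos_self[OF r] I.a_rcos_self[OF x] by (auto simp: residue_map_def proj_def)
  have "res r \<odot>\<^bsub>Abar\<^esub> proj x = (\<Union>s\<in>res r. \<Union>y\<in>proj x. proj (s \<odot>\<^bsub>RG\<^esub> y))"
    by (simp add: reduced_algebra_def Let_def proj_def)
  also have "\<dots> = (\<Union>s\<in>res r. \<Union>y\<in>proj x. proj (r \<odot>\<^bsub>RG\<^esub> x))"
    by (intro SUP_cong refl eq)
  also have "\<dots> = proj (r \<odot>\<^bsub>RG\<^esub> x)" by (simp only: SUP_const ne not_False_eq_True)
  finally show ?thesis .
qed

lemma Abar_abelian_group: "abelian_group Abar"
proof -
  interpret Q: ring "A Quot I" by (rule ideal.quotient_is_ring[OF I_ideal])
  show ?thesis
  proof (rule abelian_groupI)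
    fix x assume "x \<in> carrier Abar"
    then have x: "x \<in> carrier (A Quot I)" by simp
    show "\<exists>y\<in>carrier Abar. y \<oplus>\<^bsub>Abar\<^esub> x = \<zero>\<^bsub>Abar\<^esub>"
      by (rule bexI[of _ "\<ominus>\<^bsub>A Quot I\<^esub> x"]) (simp_all add: x Q.l_neg)
  qed (simp_all add: Q.a_ac)
qed

lemma res_carrierE:
  assumes "c \<in> carrier \<kappa>" obtains r where "r \<in> carrier R" "c = res r"
  using assms res_surj by (metis imageE)

lemma Abar_module: "module \<kappa> Abar"
proof (rule moduleI)
  show "cring \<kappa>" by (rule \<kappa>.is_cring)
  show "abelian_group Abar" by (rule Abar_abelian_group)
next
  fix c x assume "c \<in> carrier \<kappa>" "x \<in> carrier Abar"
  then show "c \<odot>\<^bsub>Abar\<^esub> x \<in> carrier Abar"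
    by (auto elim!: res_carrierE Abar_carrierE simp: proj_smult A_smult_closed proj_closed)
next
  fix c d x assume "c \<in> carrier \<kappa>" "d \<in> carrier \<kappa>" "x \<in> carrier Abar"
  then obtain r s y where *: "r \<in> carrier R" "s \<in> carrier R" "y \<in> carrier A"
    and eq: "c = res r" "d = res s" "x = proj y"
    by (auto elim!: res_carrierE Abar_carrierE)
  have "(c \<oplus>\<^bsub>\<kappa>\<^esub> d) \<odot>\<^bsub>Abar\<^esub> x = proj ((r \<oplus> s) \<odot>\<^bsub>RG\<^esub> y)"
    unfolding eq using * by (subst proj_smult[symmetric]) simp_all
  also have "\<dots> = c \<odot>\<^bsub>Abar\<^esub> x \<oplus>\<^bsub>Abar\<^esub> d \<odot>\<^bsub>Abar\<^esub> x"
    unfolding eq using * by (simp add: proj_smult RG.smult_l_distr A_closed proj_add A_smult_closed)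
  finally show "(c \<oplus>\<^bsub>\<kappa>\<^esub> d) \<odot>\<^bsub>Abar\<^esub> x = c \<odot>\<^bsub>Abar\<^esub> x \<oplus>\<^bsub>Abar\<^esub> d \<odot>\<^bsub>Abar\<^esub> x" .
  have "(c \<otimes>\<^bsub>\<kappa>\<^esub> d) \<odot>\<^bsub>Abar\<^esub> x = proj ((r \<otimes> s) \<odot>\<^bsub>RG\<^esub> y)"
    unfolding eq using * by (subst proj_smult[symmetric]) simp_all
  also have "\<dots> = c \<odot>\<^bsub>Abar\<^esub> (d \<odot>\<^bsub>Abar\<^esub> x)"
    unfolding eq using * by (simp add: proj_smult RG.smult_assoc1 A_closed A_smult_closed)
  finally show "(c \<otimes>\<^bsub>\<kappa>\<^esub> d) \<odot>\<^bsub>Abar\<^esub> x = c \<odot>\<^bsub>Abar\<^esub> (d \<odot>\<^bsub>Abar\<^esub> x)" .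
next
  fix c x y assume "c \<in> carrier \<kappa>" "x \<in> carrier Abar" "y \<in> carrier Abar"
  then obtain r v w where *: "r \<in> carrier R" "v \<in> carrier A" "w \<in> carrier A"
    and eq: "c = res r" "x = proj v" "y = proj w"
    by (auto elim!: res_carrierE Abar_carrierE)
  show "c \<odot>\<^bsub>Abar\<^esub> (x \<oplus>\<^bsub>Abar\<^esub> y) = c \<odot>\<^bsub>Abar\<^esub> x \<oplus>\<^bsub>Abar\<^esub> c \<odot>\<^bsub>Abar\<^esub> y"
    unfolding eq using *
    by (simp add: proj_smult RG.smult_r_distr A_closed A_smult_closed A_add_closed proj_add[symmetric])
next
  fix x assume "x \<in> carrier Abar"
  then obtain y where y: "y \<in> carrier A" "x = proj y" by (auto elim: Abar_carrierE)
  show "\<one>\<^bsub>\<kappa>\<^esub> \<odot>\<^bsub>Abar\<^esub> x = x"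
    using proj_smult[OF one_closed y(1)] y by (simp add: A_closed)
qed

text \<open>Supplies the isomorphism by which the quotient counts as a source algebra of
  \<open>red b\<close>, the source idempotent being \<open>red i\<close>. Commutation with
  \<open>D\<close> ensures that the structure map takes values in the corner.\<close>

lemma quot_iso_interior:
  assumes "D \<subseteq> carrier G" and comm: "\<And>u. u \<in> D \<Longrightarrow> \<delta> u \<otimes>\<^bsub>RG\<^esub> i = i \<otimes>\<^bsub>RG\<^esub> \<delta> u"
  shows "quot_iso \<in> interior_algebra_iso \<kappa> D Abar S"
  unfolding interior_algebra_iso_def
proof (intro CollectI conjI ballI)
  show "quot_iso \<in> ring_iso Abar S"
    using quot_iso_ring_iso by (simp add: ring_iso_def ring_hom_def)
next
  fix c x assume "c \<in> carrier \<kappa>" "x \<in> carrier Abar"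
  then obtain r y where *: "r \<in> carrier R" "y \<in> carrier A" and eq: "c = res r" "x = proj y"
    by (auto elim!: res_carrierE Abar_carrierE)
  show "quot_iso (c \<odot>\<^bsub>Abar\<^esub> x) = c \<odot>\<^bsub>S\<^esub> quot_iso x"
    unfolding eq using * by (simp add: proj_smult red_quot_iso A_smult_closed red_smult A_closed)
next
  fix u assume "u \<in> D"
  then have u: "u \<in> carrier G" using assms by auto
  have "\<delta> u \<otimes>\<^bsub>RG\<^esub> i \<in> carrier A" by (rule delta_i_closed) (rule comm[OF \<open>u \<in> D\<close>])
  then show "quot_iso (structure_map Abar u) = structure_map S u"
    using u by (simp add: red_quot_iso red_mult delta_closed i_closed red_delta)
qed

section \<open>Lifting the unital stable basis\<close>

lemma proj_zero: "proj \<zero>\<^bsub>RG\<^esub> = \<zero>\<^bsub>A Quot I\<^esub>"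
  using ring_hom_zero[OF proj_hom A_ring ideal.quotient_is_ring[OF I_ideal]] by simp

lemma residue_reduction: "residue_reduction R A Abar proj"
proof (intro residue_reduction.intro residue_reduction_axioms.intro)
  show "complete_local_pid R" by (rule complete_local_pid_axioms)
  show "module R A" by (rule A_module)
  show "module \<kappa> Abar" by (rule Abar_module)
next
  fix x assume x: "x \<in> carrier A" and "proj x = \<zero>\<^bsub>Abar\<^esub>"
  then have "red x = red \<zero>\<^bsub>RG\<^esub>"
    using proj_eq_iff[OF x A_zero_closed] by (simp add: proj_zero)
  then have "x \<in> adic 1" using red_zero_iff[OF A_closed[OF x]] by simp
  then show "\<exists>y\<in>carrier A. x = \<pi> \<odot>\<^bsub>A\<^esub> y"
    using A_adic_divisible[OF x, of 1] uniformizer(1) by simp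
next
  fix x and n :: nat
  assume x: "x \<in> carrier A" and "\<pi> [^] n \<odot>\<^bsub>A\<^esub> x = \<zero>\<^bsub>A\<^esub>"
  then have 0: "\<pi> [^] n \<odot>\<^bsub>RG\<^esub> x = \<zero>\<^bsub>RG\<^esub>" by simp
  have "x g = \<zero>" if "\<pi> [^] n \<noteq> \<zero>" and g: "g \<in> carrier G" for g
  proof -
    have "\<pi> [^] n \<otimes> x g = \<zero>"
      using coeff_smult[OF g, of "\<pi> [^] n" x] coeff_zero[OF g] 0 by simp
    then show ?thesis
      using integral_iff[of "\<pi> [^] n" "x g"] that uniformizer(1) coeff_closed[OF A_closed[OF x] g]
      by simp
  qed
  then have "\<pi> [^] n \<noteq> \<zero> \<Longrightarrow> x = \<zero>\<^bsub>RG\<^esub>"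
    using A_closed[OF x] by (intro ga_eqI) (simp_all add: coeff_zero)
  then show "\<pi> [^] n = \<zero> \<or> x = \<zero>\<^bsub>A\<^esub>" by auto
next
  fix x assume x: "x \<in> carrier A" and d: "\<And>n::nat. \<exists>y\<in>carrier A. x = \<pi> [^] n \<odot>\<^bsub>A\<^esub> y"
  have "x \<in> adic n" for n
  proof -
    obtain y where "y \<in> carrier A" "x = \<pi> [^] n \<odot>\<^bsub>A\<^esub> y" using d by blast
    then show ?thesis by (auto simp: adic_def intro: A_closed)
  qed
  then show "x = \<zero>\<^bsub>A\<^esub>" using adic_separated by simp
qed (simp_all add: proj_closed proj_add proj_smult)

lemma Abar_vectorspace: "vectorspace \<kappa> Abar"
  by (rule vectorspace.intro) (rule Abar_module residue_field_field)+

text \<open>A module basis is not finite by definition, whereas the lifting of bases needs finite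
  sums. Finiteness comes from the finite spanning set formed by the compressed group
  elements.\<close>

lemma Abar_fin_dim: "vectorspace.fin_dim \<kappa> Abar"
proof -
  interpret V: vectorspace \<kappa> Abar by (rule Abar_vectorspace)
  define \<phi> where "\<phi> a = proj (i \<otimes>\<^bsub>RG\<^esub> a \<otimes>\<^bsub>RG\<^esub> i)" for a
  define T where "T = (\<lambda>g. \<phi> (\<delta> g)) ` carrier G"
  have \<phi>_closed: "\<phi> a \<in> carrier Abar" if "a \<in> carrier RG" for a
    using that by (simp add: \<phi>_def proj_closed corner_closed)
  have TV: "T \<subseteq> carrier Abar" using \<phi>_closed delta_closed by (auto simp: T_def simp del: Abar_simps)
  have sub: "submodule \<kappa> (V.span T) Abar" using V.span_is_submodule[OF TV] .
  have \<phi>_add_smult: "\<phi> (a \<oplus>\<^bsub>RG\<^esub> r \<odot>\<^bsub>RG\<^esub> c) = \<phi> a \<oplus>\<^bsub>Abar\<^esub> res r \<odot>\<^bsub>Abar\<^esub> \<phi> c"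
    if "a \<in> carrier RG" "c \<in> carrier RG" "r \<in> carrier R" for a c r
    using that i_closed
    by (simp add: \<phi>_def proj_smult corner_closed proj_add[symmetric] A_smult_closed RG.l_distr
        RG.r_distr ga_smult_mult_l ga_smult_mult_r)
  have "\<phi> a \<in> V.span T"
    \<comment> \<open>The induction runs over a set \<open>Y\<close> containing the support of
      \<open>a\<close>; in each step the coefficient at one group element is split off.\<close>
    if "finite Y" "Y \<subseteq> carrier G" "a \<in> carrier RG" "\<And>g. g \<in> carrier G - Y \<Longrightarrow> a g = \<zero>" for Y a
    using that
  proof (induction Y arbitrary: a)
    case empty
    then have "a = \<zero>\<^bsub>RG\<^esub>" by (intro ga_eqI) (simp_all add: coeff_zero)
    then have "\<phi> a = \<zero>\<^bsub>Abar\<^esub>" using i_closed by (simp add: \<phi>_def proj_zero)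
    then show ?case using LinearCombinations.submodule.zero_closed[OF sub] by (simp only:)
  next
    case (insert h Y)
    define c where "c = (\<lambda>g\<in>carrier G. if g = h then \<zero> else a g)"
    have h: "h \<in> carrier G" and ah: "a h \<in> carrier R" using insert.prems coeff_closed by auto
    have c: "c \<in> carrier RG"
      unfolding c_def by (rule ga_memI) (use insert.prems coeff_closed in auto)
    have "a = c \<oplus>\<^bsub>RG\<^esub> a h \<odot>\<^bsub>RG\<^esub> \<delta> h"
      by (rule ga_eqI) (use insert.prems(2) c ah h coeff_closed[OF insert.prems(2)] in
        \<open>auto simp: coeff_add coeff_smult coeff_delta c_def delta_closed\<close>)
    then have "\<phi> a = \<phi> c \<oplus>\<^bsub>Abar\<^esub> res (a h) \<odot>\<^bsub>Abar\<^esub> \<phi> (\<delta> h)"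
      using \<phi>_add_smult[OF c delta_closed ah] by metis
    moreover have "\<phi> c \<in> V.span T"
    proof (rule insert.IH)
      show "c g = \<zero>" if "g \<in> carrier G - Y" for g
        using insert.prems(3)[of g] that by (auto simp: c_def)
    qed (use insert.prems c in auto)
    moreover have "res (a h) \<odot>\<^bsub>Abar\<^esub> \<phi> (\<delta> h) \<in> V.span T"
    proof (rule LinearCombinations.submodule.smult_closed[OF sub])
      show "res (a h) \<in> carrier \<kappa>" using ah by simp
      show "\<phi> (\<delta> h) \<in> V.span T" using V.in_own_span[OF TV] h by (auto simp: T_def)
    qed
    ultimately show ?case
      using LinearCombinations.submodule.m_closed[OF sub] by (simp only:)
  qed
  note span_all = this[OF finite_G subset_refl]
  have "x \<in> V.span T" if x: "x \<in> carrier Abar" for x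
  proof -
    obtain y where y: "y \<in> carrier A" "x = proj y" using x Abar_carrierE by auto
    have "i \<otimes>\<^bsub>RG\<^esub> y \<otimes>\<^bsub>RG\<^esub> i = y" using y(1) by (simp add: A_iff)
    then have "x = \<phi> y" using y(2) by (simp add: \<phi>_def)
    then show ?thesis using span_all[OF A_closed[OF y(1)]] by simp
  qed
  then have "V.span T = carrier Abar" using V.span_is_subset2[OF TV] by blast
  then show ?thesis
    unfolding V.fin_dim_def using TV finite_G by (intro exI[of _ T]) (simp add: T_def)
qed

text \<open>With t = i - z in the radical, the inverse of z = i - t is the geometric series in t,
  which converges because the n-th power of t lies in \<open>adic n\<close>.\<close>

lemma A_unit_of_red:
  assumes z: "z \<in> carrier A" and zi: "red z = red i"
  shows "z \<in> Units A"
proof -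
  interpret A: ring A by (rule A_ring)
  define t where "t = i \<ominus>\<^bsub>RG\<^esub> z"
  have t: "t \<in> carrier A" using z A_one_closed by (simp add: t_def A_minus_closed)
  have t1: "t \<in> adic 1" using red_eq_iff[OF i_closed A_closed[OF z]] zi by (simp add: t_def)
  \<comment> \<open>These are the powers of \<open>t\<close> inside the corner, the zeroth power
    being the identity \<open>i\<close> of the corner. \<open>s n\<close> sums the first n of them,
    so that its product with \<open>z\<close> telescopes to \<open>i \<ominus> p n\<close>.\<close>
  define p where "p n = ((\<lambda>x. t \<otimes>\<^bsub>RG\<^esub> x) ^^ n) i" for n
  define s where "s = rec_nat \<zero>\<^bsub>RG\<^esub> (\<lambda>n x. x \<oplus>\<^bsub>RG\<^esub> p n)"
  have p_Suc: "p (Suc n) = t \<otimes>\<^bsub>RG\<^esub> p n" and p_0: "p 0 = i" for n by (simp_all add: p_def)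
  have s_Suc: "s (Suc n) = s n \<oplus>\<^bsub>RG\<^esub> p n" and s_0: "s 0 = \<zero>\<^bsub>RG\<^esub>" for n by (simp_all add: s_def)
  have pA: "p n \<in> carrier A" for n
    by (induction n) (simp_all add: p_0 p_Suc A_one_closed A_mult_closed t)
  have sA: "s n \<in> carrier A" for n
    by (induction n) (simp_all add: s_0 s_Suc A_zero_closed A_add_closed pA)
  note c = A_closed[OF z] A_closed[OF t] A_closed[OF pA] A_closed[OF sA] i_closed
  have p_adic: "p n \<in> adic n" for n
  proof (induction n)
    case 0
    have "\<pi> [^] (0::nat) \<odot>\<^bsub>RG\<^esub> i = i" using i_closed by simp
    then show ?case unfolding adic_def p_0 using i_closed by (metis imageI)
  next
    case (Suc n)
    then show ?case using adic_mult[OF t1 Suc] by (simp add: p_Suc)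
  qed
  have pt: "p n \<otimes>\<^bsub>RG\<^esub> t = p (Suc n)" for n
  proof (induction n)
    case 0
    then show ?case using t by (simp add: p_0 p_Suc A_iff)
  next
    case (Suc n)
    have "p (Suc n) \<otimes>\<^bsub>RG\<^esub> t = t \<otimes>\<^bsub>RG\<^esub> (p n \<otimes>\<^bsub>RG\<^esub> t)" using c by (simp add: p_Suc RG.m_assoc)
    then show ?case using Suc by (simp add: p_Suc)
  qed
  have z_eq: "z = i \<ominus>\<^bsub>RG\<^esub> t" unfolding t_def using c by algebra
  have zp: "z \<otimes>\<^bsub>RG\<^esub> p n = p n \<ominus>\<^bsub>RG\<^esub> p (Suc n)" "p n \<otimes>\<^bsub>RG\<^esub> z = p n \<ominus>\<^bsub>RG\<^esub> p (Suc n)" for n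
    unfolding z_eq using c pA[of n] pt[of n]
    by (simp_all add: RG.minus_eq RG.l_distr RG.r_distr RG.l_minus RG.r_minus A_iff p_Suc)
  have zs: "z \<otimes>\<^bsub>RG\<^esub> s n = i \<ominus>\<^bsub>RG\<^esub> p n" "s n \<otimes>\<^bsub>RG\<^esub> z = i \<ominus>\<^bsub>RG\<^esub> p n" for n
  proof (induction n)
    case 0
    { case 1 then show ?case using c by (simp add: s_0 p_0 RG.minus_eq RG.r_neg) }
    { case 2 then show ?case using c by (simp add: s_0 p_0 RG.minus_eq RG.r_neg) }
  next
    case (Suc n)
    have *: "(i \<ominus>\<^bsub>RG\<^esub> p n) \<oplus>\<^bsub>RG\<^esub> (p n \<ominus>\<^bsub>RG\<^esub> p (Suc n)) = i \<ominus>\<^bsub>RG\<^esub> p (Suc n)"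
      using c(5) c(3)[of n] c(3)[of "Suc n"] by algebra
    { case 1 then show ?case using Suc c * by (simp add: s_Suc RG.r_distr zp) }
    { case 2 then show ?case using Suc c * by (simp add: s_Suc RG.l_distr zp) }
  qed
  have "s (Suc n) \<ominus>\<^bsub>RG\<^esub> s n = p n" for n
    unfolding s_Suc using c(4)[of n] c(3)[of n] by algebra
  then obtain l0 where l0: "l0 \<in> carrier RG" "\<And>n. l0 \<ominus>\<^bsub>RG\<^esub> s n \<in> adic n"
    using adic_complete[of s] c(4) p_adic by auto
  \<comment> \<open>Completeness yields a limit in \<open>RG\<close> only. Compression by
    \<open>i\<close> moves it into the corner and preserves the estimates, as \<open>i\<close> fixes
    every \<open>s n\<close>.\<close>
  define l where "l = i \<otimes>\<^bsub>RG\<^esub> l0 \<otimes>\<^bsub>RG\<^esub> i"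
  have lA: "l \<in> carrier A" unfolding l_def by (rule corner_closed[OF l0(1)])
  have l: "l \<ominus>\<^bsub>RG\<^esub> s n \<in> adic n" for n
  proof -
    have "l \<ominus>\<^bsub>RG\<^esub> s n = i \<otimes>\<^bsub>RG\<^esub> (l0 \<ominus>\<^bsub>RG\<^esub> s n) \<otimes>\<^bsub>RG\<^esub> i"
      using l0(1) c sA[of n]
      by (simp add: l_def RG.minus_eq RG.l_distr RG.r_distr RG.l_minus RG.r_minus A_iff)
    then show ?thesis using l0(2) i_closed by (simp add: adic_mult_l adic_mult_r)
  qed
  have ip: "i \<ominus>\<^bsub>RG\<^esub> (i \<ominus>\<^bsub>RG\<^esub> p n) = p n" for n using c(5) c(3)[of n] by algebra
  have "z \<otimes>\<^bsub>RG\<^esub> l = i"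
  proof (rule adic_eqI[of _ _ "\<lambda>n. z \<otimes>\<^bsub>RG\<^esub> s n"])
    fix n
    have "z \<otimes>\<^bsub>RG\<^esub> l \<ominus>\<^bsub>RG\<^esub> z \<otimes>\<^bsub>RG\<^esub> s n = z \<otimes>\<^bsub>RG\<^esub> (l \<ominus>\<^bsub>RG\<^esub> s n)"
      using c A_closed[OF lA] by (simp add: RG.minus_eq RG.r_distr RG.r_minus)
    then show "z \<otimes>\<^bsub>RG\<^esub> l \<ominus>\<^bsub>RG\<^esub> z \<otimes>\<^bsub>RG\<^esub> s n \<in> adic n" using l c by (simp add: adic_mult_l)
    show "i \<ominus>\<^bsub>RG\<^esub> z \<otimes>\<^bsub>RG\<^esub> s n \<in> adic n" using p_adic by (simp add: zs ip)
  qed (use c A_closed[OF lA] in simp_all)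
  moreover have "l \<otimes>\<^bsub>RG\<^esub> z = i"
  proof (rule adic_eqI[of _ _ "\<lambda>n. s n \<otimes>\<^bsub>RG\<^esub> z"])
    fix n
    have "l \<otimes>\<^bsub>RG\<^esub> z \<ominus>\<^bsub>RG\<^esub> s n \<otimes>\<^bsub>RG\<^esub> z = (l \<ominus>\<^bsub>RG\<^esub> s n) \<otimes>\<^bsub>RG\<^esub> z"
      using c A_closed[OF lA] by (simp add: RG.minus_eq RG.l_distr RG.l_minus)
    then show "l \<otimes>\<^bsub>RG\<^esub> z \<ominus>\<^bsub>RG\<^esub> s n \<otimes>\<^bsub>RG\<^esub> z \<in> adic n" using l c by (simp add: adic_mult_r)
    show "i \<ominus>\<^bsub>RG\<^esub> s n \<otimes>\<^bsub>RG\<^esub> z \<in> adic n" using p_adic by (simp add: zs ip)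
  qed (use c A_closed[OF lA] in simp_all)
  ultimately show ?thesis using z lA unfolding Units_def by auto
qed

text \<open>The factors \<open>i\<close> are required because a coefficientwise lift of an element
  of the corner of \<open>kG\<close> need not lie in \<open>A\<close>.\<close>

definition lift_proj :: "('g \<Rightarrow> 'a) set \<Rightarrow> 'g \<Rightarrow> 'a" where
  "lift_proj x = i \<otimes>\<^bsub>RG\<^esub> lift_coeffs (quot_iso x) \<otimes>\<^bsub>RG\<^esub> i"

lemma quot_iso_closed: "x \<in> carrier (A Quot I) \<Longrightarrow> quot_iso x \<in> carrier S"
  using quot_iso_ring_iso by (auto simp: ring_iso_def ring_hom_def)

lemma quot_iso_mult:
  "\<lbrakk>x \<in> carrier (A Quot I); y \<in> carrier (A Quot I)\<rbrakk> \<Longrightarrow>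
    quot_iso (x \<otimes>\<^bsub>A Quot I\<^esub> y) = quot_iso x \<otimes>\<^bsub>kG\<^esub> quot_iso y"
  using quot_iso_ring_iso by (auto simp: ring_iso_def ring_hom_def)

lemma lift_proj_closed: "x \<in> carrier (A Quot I) \<Longrightarrow> lift_proj x \<in> carrier A"
  unfolding lift_proj_def by (rule lift_corner(1)[OF quot_iso_closed])

lemma red_lift_proj: "x \<in> carrier (A Quot I) \<Longrightarrow> red (lift_proj x) = quot_iso x"
  unfolding lift_proj_def by (rule lift_corner(2)[OF quot_iso_closed])

lemma proj_lift_proj: "x \<in> carrier (A Quot I) \<Longrightarrow> proj (lift_proj x) = x"
  by (metis Abar_carrierE lift_proj_closed proj_eq_iff red_lift_proj red_quot_iso)

text \<open>As \<open>i\<close> commutes with \<open>\<delta> u\<close> and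
  \<open>\<delta> v\<close>, the translations slide past it onto the coefficientwise lift, where
  equivariance is exact.\<close>

lemma lift_proj_translate:
  assumes x: "x \<in> carrier (A Quot I)" and uv: "u \<in> carrier G" "v \<in> carrier G"
    and cu: "\<delta> u \<otimes>\<^bsub>RG\<^esub> i = i \<otimes>\<^bsub>RG\<^esub> \<delta> u" and cv: "\<delta> v \<otimes>\<^bsub>RG\<^esub> i = i \<otimes>\<^bsub>RG\<^esub> \<delta> v"
  shows "\<delta> u \<otimes>\<^bsub>RG\<^esub> i \<otimes>\<^bsub>RG\<^esub> lift_proj x \<otimes>\<^bsub>RG\<^esub> (\<delta> v \<otimes>\<^bsub>RG\<^esub> i) =
    lift_proj (proj (\<delta> u \<otimes>\<^bsub>RG\<^esub> i) \<otimes>\<^bsub>A Quot I\<^esub> x \<otimes>\<^bsub>A Quot I\<^esub> proj (\<delta> v \<otimes>\<^bsub>RG\<^esub> i))"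
proof -
  interpret Q: ring "A Quot I" by (rule ideal.quotient_is_ring[OF I_ideal])
  let ?\<delta> = "group_element \<kappa> G"
  define c where "c = quot_iso x"
  have c: "c \<in> carrier kG" "red i \<otimes>\<^bsub>kG\<^esub> c = c" "c \<otimes>\<^bsub>kG\<^esub> red i = c"
    using quot_iso_closed[OF x] by (simp_all add: c_def K.A_iff)
  note uA = delta_i_closed[OF cu] and vA = delta_i_closed[OF cv]
  have ri: "red i \<in> carrier kG" by (rule red_closed[OF i_closed])
  have rv: "?\<delta> v \<otimes>\<^bsub>kG\<^esub> red i = red i \<otimes>\<^bsub>kG\<^esub> ?\<delta> v"
    using arg_cong[OF cv, of red] uv by (simp add: red_mult delta_closed i_closed red_delta)
  have "quot_iso (proj (\<delta> u \<otimes>\<^bsub>RG\<^esub> i) \<otimes>\<^bsub>A Quot I\<^esub> x \<otimes>\<^bsub>A Quot I\<^esub> proj (\<delta> v \<otimes>\<^bsub>RG\<^esub> i)) =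
      ?\<delta> u \<otimes>\<^bsub>kG\<^esub> red i \<otimes>\<^bsub>kG\<^esub> c \<otimes>\<^bsub>kG\<^esub> (?\<delta> v \<otimes>\<^bsub>kG\<^esub> red i)"
    using x uv by (simp add: quot_iso_mult proj_closed uA vA red_quot_iso red_mult delta_closed
        i_closed red_delta c_def)
  \<comment> \<open>The copies of \<open>red i\<close> are moved next to \<open>c\<close> and
    absorbed there. What remains is a translate by group elements alone, the form to which
    \<open>lift_coeffs_translate\<close> applies.\<close>
  also have "\<dots> = ?\<delta> u \<otimes>\<^bsub>kG\<^esub> (red i \<otimes>\<^bsub>kG\<^esub> c) \<otimes>\<^bsub>kG\<^esub> (red i \<otimes>\<^bsub>kG\<^esub> ?\<delta> v)"
    unfolding rv using c(1) ri K.delta_closed by (simp only: K.RG.m_assoc K.RG.m_closed)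
  also have "\<dots> = ?\<delta> u \<otimes>\<^bsub>kG\<^esub> (c \<otimes>\<^bsub>kG\<^esub> red i) \<otimes>\<^bsub>kG\<^esub> ?\<delta> v"
    unfolding c(2) using c(1) ri K.delta_closed by (simp only: K.RG.m_assoc K.RG.m_closed)
  finally have q: "quot_iso (proj (\<delta> u \<otimes>\<^bsub>RG\<^esub> i) \<otimes>\<^bsub>A Quot I\<^esub> x \<otimes>\<^bsub>A Quot I\<^esub> proj (\<delta> v \<otimes>\<^bsub>RG\<^esub> i)) =
      ?\<delta> u \<otimes>\<^bsub>kG\<^esub> c \<otimes>\<^bsub>kG\<^esub> ?\<delta> v" by (simp only: c(3))
  define L where "L = lift_coeffs c"
  have L: "L \<in> carrier RG" unfolding L_def by (rule lift_coeffs_closed[OF c(1)])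
  note cl = L i_closed delta_closed[of u] delta_closed[of v]
  have "lift_proj (proj (\<delta> u \<otimes>\<^bsub>RG\<^esub> i) \<otimes>\<^bsub>A Quot I\<^esub> x \<otimes>\<^bsub>A Quot I\<^esub> proj (\<delta> v \<otimes>\<^bsub>RG\<^esub> i)) =
      i \<otimes>\<^bsub>RG\<^esub> (\<delta> u \<otimes>\<^bsub>RG\<^esub> L \<otimes>\<^bsub>RG\<^esub> \<delta> v) \<otimes>\<^bsub>RG\<^esub> i"
    unfolding lift_proj_def q L_def lift_coeffs_translate[OF c(1) uv] ..
  also have "\<dots> = (i \<otimes>\<^bsub>RG\<^esub> \<delta> u) \<otimes>\<^bsub>RG\<^esub> L \<otimes>\<^bsub>RG\<^esub> (\<delta> v \<otimes>\<^bsub>RG\<^esub> i)"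
    using cl by (simp only: RG.m_assoc RG.m_closed)
  \<comment> \<open>Doubling \<open>i\<close> on each side leaves one copy to enclose
    \<open>L\<close> as in \<open>lift_proj\<close> and returns the other to the structure
    maps.\<close>
  also have "\<dots> = (\<delta> u \<otimes>\<^bsub>RG\<^esub> (i \<otimes>\<^bsub>RG\<^esub> i)) \<otimes>\<^bsub>RG\<^esub> L \<otimes>\<^bsub>RG\<^esub> ((i \<otimes>\<^bsub>RG\<^esub> i) \<otimes>\<^bsub>RG\<^esub> \<delta> v)"
    by (simp only: i_idem cu cv)
  also have "\<dots> = \<delta> u \<otimes>\<^bsub>RG\<^esub> i \<otimes>\<^bsub>RG\<^esub> (i \<otimes>\<^bsub>RG\<^esub> L \<otimes>\<^bsub>RG\<^esub> i) \<otimes>\<^bsub>RG\<^esub> (i \<otimes>\<^bsub>RG\<^esub> \<delta> v)"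
    using cl by (simp only: RG.m_assoc RG.m_closed)
  finally show ?thesis by (simp only: cv lift_proj_def L_def c_def)
qed

lemma has_unital_stable_basis_lift:
  assumes D: "subgroup D G" and comm: "\<And>u. u \<in> D \<Longrightarrow> \<delta> u \<otimes>\<^bsub>RG\<^esub> i = i \<otimes>\<^bsub>RG\<^esub> \<delta> u"
    and stable: "has_unital_stable_basis \<kappa> G D Abar"
  shows "has_unital_stable_basis R G D A"
proof -
  interpret A: ring A by (rule A_ring)
  interpret V: vectorspace \<kappa> Abar by (rule Abar_vectorspace)
  interpret rr: residue_reduction R A Abar proj by (rule residue_reduction)
  obtain B where B: "is_module_basis \<kappa> Abar B" "B \<subseteq> Units Abar"
    and st: "\<And>u v x. \<lbrakk>u \<in> D; v \<in> D; x \<in> B\<rbrakk> \<Longrightarrow>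
      structure_map Abar u \<otimes>\<^bsub>Abar\<^esub> x \<otimes>\<^bsub>Abar\<^esub> structure_map Abar (inv\<^bsub>G\<^esub> v) \<in> B"
    using stable unfolding has_unital_stable_basis_def by blast
  have BQ: "x \<in> carrier (A Quot I)" if "x \<in> B" for x
    using B(1) that by (auto simp: is_module_basis_def)
  have "finite B"
    using V.fin_dim_li_fin[OF Abar_fin_dim] B(1) by (simp add: is_module_basis_def)
  then have basis: "is_module_basis R A (lift_proj ` B)"
    by (rule rr.lifted_basis[OF _ B(1)]) (auto simp: BQ lift_proj_closed proj_lift_proj)
  have units: "lift_proj x \<in> Units A" if "x \<in> B" for x
  proof -
    have "x \<in> Units Abar" using B(2) that by blast
    then obtain y where y: "y \<in> carrier (A Quot I)" "y \<otimes>\<^bsub>A Quot I\<^esub> x = \<one>\<^bsub>A Quot I\<^esub>" "x \<otimes>\<^bsub>A Quot I\<^esub> y = \<one>\<^bsub>A Quot I\<^esub>"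
      by (auto simp: Units_def)
    note c = lift_proj_closed[OF BQ[OF that]] lift_proj_closed[OF y(1)]
    note m = A_mult_closed[OF c] A_mult_closed[OF c(2,1)]
    \<comment> \<open>The lift of the inverse inverts the lift modulo the radical only;
      \<open>A_unit_of_red\<close> makes both products units.\<close>
    have "proj (lift_proj x \<otimes>\<^bsub>RG\<^esub> lift_proj y) = proj i" "proj (lift_proj y \<otimes>\<^bsub>RG\<^esub> lift_proj x) = proj i"
      using c y by (simp_all add: proj_mult proj_lift_proj BQ[OF that] proj_one)
    then have "lift_proj x \<otimes>\<^bsub>RG\<^esub> lift_proj y \<in> Units A" "lift_proj y \<otimes>\<^bsub>RG\<^esub> lift_proj x \<in> Units A"
      using m by (simp_all add: A_unit_of_red proj_eq_iff[OF _ A_one_closed])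
    then show ?thesis using A.Units_of_products[of "lift_proj x" "lift_proj y"] c by simp
  qed
  have "structure_map A u \<otimes>\<^bsub>A\<^esub> lift_proj x \<otimes>\<^bsub>A\<^esub> structure_map A (inv\<^bsub>G\<^esub> v) \<in> lift_proj ` B"
    if "u \<in> D" "v \<in> D" "x \<in> B" for u v x
  proof -
    \<comment> \<open>The action on the right is by the inverse of \<open>v\<close>, so it is this
      element of \<open>D\<close> that has to commute with \<open>i\<close>.\<close>
    have v: "inv\<^bsub>G\<^esub> v \<in> D" using D that by (simp add: subgroup.m_inv_closed)
    have "structure_map A u \<otimes>\<^bsub>A\<^esub> lift_proj x \<otimes>\<^bsub>A\<^esub> structure_map A (inv\<^bsub>G\<^esub> v) =
      lift_proj (structure_map Abar u \<otimes>\<^bsub>Abar\<^esub> x \<otimes>\<^bsub>Abar\<^esub> structure_map Abar (inv\<^bsub>G\<^esub> v))"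
      using lift_proj_translate[OF BQ[OF that(3)] _ _ comm[OF that(1)] comm[OF v]]
        subgroup.mem_carrier[OF D] that(1) v by simp
    then show ?thesis using st[OF that] by (simp del: Abar_simps A_simps)
  qed
  then show ?thesis
    unfolding has_unital_stable_basis_def using basis units by blast
qed

end

theorem theorem1p2:
  fixes R :: "('a, 'r) ring_scheme"
    and G :: "('g, 'm) monoid_scheme"
    and p :: nat and D :: "'g set" and b i :: "'g \<Rightarrow> 'a"
  assumes "Factorial_Ring.prime p"
    and "complete_local_pid R"
    and "algebraically_closed (residue_field R)"
    and "has_characteristic (residue_field R) p"
    and "group G" and "finite (carrier G)" and "p dvd order G"
    and "block_idempotent R G b"
    and "defect_group p R G b D"
    and "source_idempotent R G D b i"
  shows "block_idempotent (residue_field R) G (reduce_coeffs R G b) \<and>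
    defect_group p (residue_field R) G (reduce_coeffs R G b) D \<and>
    is_source_algebra (residue_field R) G D (reduce_coeffs R G b)
      (reduced_algebra R (source_algebra R G i)) \<and>
    (uniform_source_algebra (residue_field R) G D (reduce_coeffs R G b)
      (reduced_algebra R (source_algebra R G i)) \<longrightarrow>
     uniform_source_algebra R G D b (source_algebra R G i))"
proof -
  have fg: "finite_group_algebra R G"
  proof (intro finite_group_algebra.intro finite_group_algebra_axioms.intro)
    interpret complete_local_pid R by fact
    show "cring R" by (rule is_cring)
  qed fact+
  interpret C: complete_group_algebra R G
    by (rule complete_group_algebra.intro) (fact assms(2) fg)+
  have D: "subgroup D G" using assms(9) by (simp add: defect_group_def p_subgroup_def)
  note DG = subgroup.subset[OF D]
  note b = C.block_idempotentD[OF assms(8)]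
  have "i \<in> conj_fixed_points R G D (block_algebra R G b)" and ii: "i \<otimes>\<^bsub>group_algebra R G\<^esub> i = i"
    using assms(10) by (auto simp: source_idempotent_def primitive_idempotent_def)
  then have i: "i \<in> carrier (group_algebra R G)"
    and comm: "\<And>u. u \<in> D \<Longrightarrow> group_element R G u \<otimes>\<^bsub>group_algebra R G\<^esub> i =
      i \<otimes>\<^bsub>group_algebra R G\<^esub> group_element R G u"
    unfolding C.conj_fixed_block_eq[OF b(2,3) DG] by auto
  interpret S: reduced_corner_algebra R G i
    by (intro reduced_corner_algebra.intro corner_algebra.intro corner_algebra_axioms.intro
        C.complete_group_algebra_axioms fg i ii)
  have src: "is_source_algebra (residue_field R) G D (reduce_coeffs R G b)
      (reduced_algebra R (source_algebra R G i))"
    unfolding is_source_algebra_def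
    using C.source_idempotent_red[OF assms(8) DG assms(10)] S.quot_iso_interior[OF DG comm] by blast
  \<comment> \<open>Over \<open>R\<close> the algebra is the corner of the given source idempotent
    itself, so the identity map serves as the isomorphism.\<close>
  have "id \<in> interior_algebra_iso R D (source_algebra R G i) (source_algebra R G i)"
    by (simp add: interior_algebra_iso_def ring_iso_set_refl)
  then have "is_source_algebra R G D b (source_algebra R G i)"
    unfolding is_source_algebra_def using assms(10) by blast
  then show ?thesis
    using src C.block_idempotent_red[OF assms(8)] C.defect_group_red[OF b(2) assms(9)]
      S.has_unital_stable_basis_lift[OF D comm]
    unfolding uniform_source_algebra_def by blast
qed

end
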